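(* Let $\phi$ be a smooth plurisubharmonic function on the unit polydisc $\mathbb D^n\subset\mathbb C^n$. Then for all $1\le j,k\le n$, $$\lim_{t\to0}\frac{\partial^2F(\phi)}{\partial t_j\partial\bar t_k}(t,0)=\begin{cases}\dfrac12\cdot\dfrac{\partial^2\phi}{\partial z_j\partial\bar z_j}(0),&\text{if } j=k,\\[2mm]0,&\text{if } j\ne k.\end{cases}$$ In particular, the function $t\mapsto F(\phi)(t,0)$ is strictly plurisubharmonic at $t=0$ if $\phi$ is strictly plurisubharmonic at $z=0$.
   Context: For a domain $\Omega\subset\mathbb C^n$ and a plurisubharmonic function $\phi$ on $\Omega$, the weighted Bergman kernel is $$K_{\phi,\Omega}(z)=\sup\left\{|f(z)|^2:\ f\in\mathcal O(\Omega),\ \int_\Omega|f|^2e^{-\phi}\le1\right\}$$ (integral with respect to Lebesgue measure). For $t\in\mathbb D^n$, $\phi^t(z):=\phi(t_1z_1,\dots,t_nz_n)$, and $F(\phi)(t,z):=\log K_{\phi^t,\mathbb D^n}(z)$ for $(t,z)\in\mathbb D^n\times\mathbb D^n$. A smooth function is strictly plurisubharmonic at a point if its complex Hessian there is positive definite. *)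

theory Defs
  imports "HOL-Analysis.Analysis"
begin

definition unit_polydisc :: "(complex ^ 'n) set" where
  "unit_polydisc = {z. \<forall>i. norm (z $ i) < 1}"


subsection \<open>Smooth functions and Wirtinger derivatives\<close>

(* For open S this is the class C^k(S) of k times continuously differentiable functions. *)
primrec Ck_on ::
  "nat \<Rightarrow> 'a::real_normed_vector set \<Rightarrow> ('a \<Rightarrow> 'b::real_normed_vector) \<Rightarrow> bool" where
  "Ck_on 0 S f \<longleftrightarrow> continuous_on S f"
| "Ck_on (Suc k) S f \<longleftrightarrow>
     (\<forall>x\<in>S. f differentiable (at x)) \<and>
     (\<forall>v. Ck_on k S (\<lambda>x. frechet_derivative f (at x) v))"

definition smooth_on ::
  "'a::real_normed_vector set \<Rightarrow> ('a \<Rightarrow> 'b::real_normed_vector) \<Rightarrow> bool" where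
  "smooth_on S f \<longleftrightarrow> (\<forall>k. Ck_on k S f)"

(* With z_j = x_j + i y_j, axis j 1 and axis j i are the real directions of x_j and y_j. *)
definition wirtinger :: "'n::finite \<Rightarrow> (complex ^ 'n \<Rightarrow> complex) \<Rightarrow> complex ^ 'n \<Rightarrow> complex" where
  "wirtinger j f z =
     (frechet_derivative f (at z) (axis j 1) - \<i> * frechet_derivative f (at z) (axis j \<i>)) / 2"

definition wirtinger_bar :: "'n::finite \<Rightarrow> (complex ^ 'n \<Rightarrow> complex) \<Rightarrow> complex ^ 'n \<Rightarrow> complex" where
  "wirtinger_bar j f z =
     (frechet_derivative f (at z) (axis j 1) + \<i> * frechet_derivative f (at z) (axis j \<i>)) / 2"

definition complex_hessian :: "(complex ^ 'n::finite \<Rightarrow> real) \<Rightarrow> complex ^ 'n \<Rightarrow> complex ^ 'n ^ 'n" where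
  "complex_hessian u z =
     (\<chi> j k. wirtinger j (wirtinger_bar k (\<lambda>w. complex_of_real (u w))) z)"


subsection \<open>Plurisubharmonic functions\<close>

(* The restriction to real-valued functions of the usual notion: upper semicontinuity, and the
   sub-mean value inequality on every closed disc in a complex line contained in S.
   For usc functions with values in [-infinity, infinity) the circle means always exist in
   [-infinity, infinity); where u a is finite, the inequality forces the mean to be finite,
   so that integrability is part of it (the library integral of a
   non-integrable function is 0). *)
definition plurisubharmonic_on :: "(complex ^ 'n::finite) set \<Rightarrow> (complex ^ 'n \<Rightarrow> real) \<Rightarrow> bool" where
  "plurisubharmonic_on S u \<longleftrightarrow>
     (\<forall>c. openin (top_of_set S) {z \<in> S. u z < c}) \<and>
     (\<forall>a b. (\<forall>\<zeta>\<in>cball 0 1. a + \<zeta> *s b \<in> S) \<longrightarrow>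
        set_integrable lborel {0..2 * pi} (\<lambda>\<theta>. u (a + cis \<theta> *s b)) \<and>
        u a \<le> 1 / (2 * pi) * (LBINT \<theta>:{0..2 * pi}. u (a + cis \<theta> *s b)))"

definition positive_definite :: "complex ^ 'n ^ 'n::finite \<Rightarrow> bool" where
  "positive_definite H \<longleftrightarrow>
     (\<forall>j k. H $ k $ j = cnj (H $ j $ k)) \<and>
     (\<forall>v. v \<noteq> 0 \<longrightarrow> 0 < Re (\<Sum>j\<in>UNIV. \<Sum>k\<in>UNIV. H $ j $ k * v $ j * cnj (v $ k)))"

definition strictly_plurisubharmonic_at :: "(complex ^ 'n::finite \<Rightarrow> real) \<Rightarrow> complex ^ 'n \<Rightarrow> bool" where
  "strictly_plurisubharmonic_at u a \<longleftrightarrow>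
     (\<exists>U. open U \<and> a \<in> U \<and> smooth_on U u) \<and> positive_definite (complex_hessian u a)"


subsection \<open>Weighted Bergman kernels\<close>

definition holomorphic_several_on :: "(complex ^ 'n::finite) set \<Rightarrow> (complex ^ 'n \<Rightarrow> complex) \<Rightarrow> bool" where
  "holomorphic_several_on S f \<longleftrightarrow>
     (\<forall>z\<in>S. \<exists>f'. (f has_derivative f') (at z) \<and> (\<forall>c v. f' (c *s v) = c * f' v))"

(* For S open and u plurisubharmonic, u is locally bounded above, so by the mean value property
   the set is bounded and the real supremum is the true one. *)
definition bergman_kernel ::
  "(complex ^ 'n::finite \<Rightarrow> real) \<Rightarrow> (complex ^ 'n) set \<Rightarrow> complex ^ 'n \<Rightarrow> real" where
  "bergman_kernel u S z =
     Sup {(norm (f z))\<^sup>2 | f. holomorphic_several_on S f \<and>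
            (\<integral>\<^sup>+w\<in>S. ennreal ((norm (f w))\<^sup>2 * exp (- u w)) \<partial>lborel) \<le> 1}"

definition dilate :: "complex ^ 'n::finite \<Rightarrow> (complex ^ 'n \<Rightarrow> real) \<Rightarrow> complex ^ 'n \<Rightarrow> real" where
  "dilate t u z = u (\<chi> i. t $ i * z $ i)"

(* Only meaningful for t and z in the unit polydisc. *)
definition log_bergman ::
  "(complex ^ 'n::finite \<Rightarrow> real) \<Rightarrow> complex ^ 'n \<Rightarrow> complex ^ 'n \<Rightarrow> real" where
  "log_bergman u t z = ln (bergman_kernel (dilate t u) unit_polydisc z)"

end

theory Submission
  imports Defs "HOL-Complex_Analysis.Cauchy_Integral_Formula"
begin

text \<open>
  The kernel at the origin is the squared norm of point evaluation, dual to the weighted \<open>L\<^sup>2\<close> form on the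
  Bergman space \<open>V\<close>. Viewed as an operator from \<open>V\<close> to its dual, the form depends smoothly on \<open>t\<close>, and
  transposition turns it into an isomorphism from the bidual of \<open>V\<close> (complete for free) onto the dual; the kernel is
  the inverse of this isomorphism applied twice to point evaluation, hence smooth in \<open>t\<close>. It is invariant under
  \<open>t\<^sub>j \<mapsto> -t\<^sub>j\<close>, so mixed derivatives vanish at \<open>0\<close>. On the \<open>j\<close>-th axis the pluriharmonic part of the second-order
  Taylor polynomial of \<open>\<phi>\<close> is absorbed into the holomorphic competitor, which leaves the weight
  \<open>exp (- c \<bar>t\<^sub>j z\<^sub>j\<bar>\<^sup>2)\<close> up to \<open>o(\<bar>t\<^sub>j\<bar>\<^sup>2)\<close>. For this rotation invariant weight constants are extremal, and the
  factor \<open>1 / 2\<close> is the mean of \<open>\<bar>z\<^sub>j\<bar>\<^sup>2\<close> over the polydisc.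
\<close>

section \<open>Continuously differentiable functions\<close>

text \<open>The extremal function for the kernel would usually come from the Riesz representation,
  which needs completeness of the Bergman space; the detour through the bidual avoids proving that.
  Only t of norm below 1/2 is considered, which keeps every dilated argument in a compact part of
  the polydisc: \<open>\<phi>\<close> may be unbounded near the boundary, but on that part it and
  all its derivatives are bounded, so the weights are differentiable in t in the sup norm and share
  one coercivity constant. Smoothness has to come first: it reduces the limit of the Hessian to its
  value at 0, and it allows second derivatives at 0 to be read off from an estimate of the kernel
  with error o(|t_j|^2), which by itself says nothing about derivatives. The Bergman space is
  treated as a real space; since a competitor can be multiplied by a unimodular constant, taking the
  real part of point evaluation loses nothing.\<close>

lemma Ck_on_cong:
  assumes "open S" "\<And>x. x \<in> S \<Longrightarrow> f x = g x"
  shows "Ck_on k S f \<longleftrightarrow> Ck_on k S g"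
proof -
  have "Ck_on k S g" if "\<And>x. x \<in> S \<Longrightarrow> f x = g x" "Ck_on k S f" for f g :: "'a \<Rightarrow> 'b"
    using that
  proof (induction k arbitrary: f g)
    case 0
    then show ?case by (simp cong: continuous_on_cong)
  next
    case (Suc k)
    have d: "f differentiable (at x)" if "x \<in> S" for x using Suc that by simp
    have "g differentiable (at x)" if "x \<in> S" for x
      using d[OF that] Suc.prems(1) that \<open>open S\<close>
      unfolding differentiable_def by (metis has_derivative_transform_within_open)
    moreover have "Ck_on k S (\<lambda>x. frechet_derivative g (at x) v)" for v
    proof (rule Suc.IH[of "\<lambda>x. frechet_derivative f (at x) v"])
      show "frechet_derivative f (at x) v = frechet_derivative g (at x) v" if "x \<in> S" for x
        using frechet_derivative_transform_within_open[OF d[OF that] \<open>open S\<close> that Suc.prems(1)] by simp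
      show "Ck_on k S (\<lambda>x. frechet_derivative f (at x) v)" using Suc.prems(2) by simp
    qed
    ultimately show ?case by simp
  qed
  from this[of f g] this[of g f] show ?thesis using assms by metis
qed

text \<open>Replaces the choice behind \<open>frechet_derivative\<close> by an explicit formula, so
  that each induction on the order below only has to recognise that formula as built from
  lower-order pieces.\<close>

lemma Ck_on_SucI:
  assumes "open S" "\<And>x. x \<in> S \<Longrightarrow> (f has_derivative f' x) (at x)"
    and "\<And>v. Ck_on k S (\<lambda>x. f' x v)"
  shows "Ck_on (Suc k) S f"
proof -
  have "frechet_derivative f (at x) = f' x" if "x \<in> S" for x
    using frechet_derivative_at[OF assms(2)[OF that]] by simp
  then have "Ck_on k S (\<lambda>x. frechet_derivative f (at x) v)" for v
    using assms(3)[of v] Ck_on_cong[OF \<open>open S\<close>, of "\<lambda>x. frechet_derivative f (at x) v" "\<lambda>x. f' x v"] by simp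
  then show ?thesis using assms(2) by (auto simp: differentiable_def)
qed

lemma Ck_on_has_derivative:
  assumes "Ck_on (Suc k) S f" "x \<in> S"
  shows "(f has_derivative frechet_derivative f (at x)) (at x)"
  using assms frechet_derivative_works by auto

lemma Ck_on_frechet_derivative:
  "Ck_on (Suc k) S f \<Longrightarrow> Ck_on k S (\<lambda>x. frechet_derivative f (at x) v)"
  by simp

lemma Ck_on_imp_continuous_on: "Ck_on k S f \<Longrightarrow> continuous_on S f"
  by (cases k) (auto intro!: continuous_at_imp_continuous_on differentiable_imp_continuous_within)

lemma Ck_on_pred: "Ck_on (Suc k) S f \<Longrightarrow> Ck_on k S f"
proof (induction k arbitrary: f)
  case 0
  then show ?case using Ck_on_imp_continuous_on[OF 0] by simp
next
  case (Suc k)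
  then have "\<And>v. Ck_on (Suc k) S (\<lambda>x. frechet_derivative f (at x) v)" by simp
  with Suc show ?case by auto
qed

lemma Ck_on_const: "open S \<Longrightarrow> Ck_on k S (\<lambda>x. c)"
proof (induction k arbitrary: c)
  case (Suc k)
  show ?case by (rule Ck_on_SucI[where f'="\<lambda>x v. 0"]) (use Suc in auto)
qed auto

lemma Ck_on_bounded_linear:
  assumes "open S" "bounded_linear L" "Ck_on k S f"
  shows "Ck_on k S (\<lambda>x. L (f x))"
  using assms(3)
proof (induction k arbitrary: f)
  case 0
  then show ?case using bounded_linear.continuous_on[OF assms(2)] by simp
next
  case (Suc k)
  show ?case
  proof (rule Ck_on_SucI[OF \<open>open S\<close>])
    show "((\<lambda>x. L (f x)) has_derivative (\<lambda>v. L (frechet_derivative f (at x) v))) (at x)" if "x \<in> S" for x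
      using bounded_linear.has_derivative[OF assms(2) Ck_on_has_derivative[OF Suc.prems that]] .
  qed (use Suc in auto)
qed

lemma Ck_on_add:
  assumes "open S" "Ck_on k S f" "Ck_on k S g"
  shows "Ck_on k S (\<lambda>x. f x + g x)"
  using assms(2,3)
proof (induction k arbitrary: f g)
  case 0
  then show ?case by (simp add: continuous_on_add)
next
  case (Suc k)
  show ?case
  proof (rule Ck_on_SucI[OF \<open>open S\<close>])
    show "((\<lambda>x. f x + g x) has_derivative (\<lambda>v. frechet_derivative f (at x) v + frechet_derivative g (at x) v)) (at x)" if "x \<in> S" for x
      using has_derivative_add[OF Ck_on_has_derivative[OF Suc.prems(1) that] Ck_on_has_derivative[OF Suc.prems(2) that]] .
  qed (use Suc in auto)
qed

lemma Ck_on_sum: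
  assumes "open S" "\<And>i. i \<in> I \<Longrightarrow> Ck_on k S (f i)"
  shows "Ck_on k S (\<lambda>x. \<Sum>i\<in>I. f i x)"
  using assms(2) by (induction I rule: infinite_finite_induct) (auto intro: Ck_on_add[OF \<open>open S\<close>] Ck_on_const[OF \<open>open S\<close>])

lemma Ck_on_bounded_bilinear:
  fixes prod :: "'b::real_normed_vector \<Rightarrow> 'c::real_normed_vector \<Rightarrow> 'd::real_normed_vector"
  assumes "open S" "bounded_bilinear prod" "Ck_on k S f" "Ck_on k S g"
  shows "Ck_on k S (\<lambda>x. prod (f x) (g x))"
  using assms(3,4)
proof (induction k arbitrary: f g)
  case 0
  then show ?case using bounded_bilinear.continuous_on[OF assms(2)] by simp
next
  case (Suc k)
  show ?case
  proof (rule Ck_on_SucI[OF \<open>open S\<close>])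
    show "((\<lambda>x. prod (f x) (g x)) has_derivative 
      (\<lambda>v. prod (f x) (frechet_derivative g (at x) v) + prod (frechet_derivative f (at x) v) (g x))) (at x)" if "x \<in> S" for x
      using bounded_bilinear.FDERIV[OF assms(2) Ck_on_has_derivative[OF Suc.prems(1) that] Ck_on_has_derivative[OF Suc.prems(2) that]] .
    show "Ck_on k S (\<lambda>x. prod (f x) (frechet_derivative g (at x) v) + prod (frechet_derivative f (at x) v) (g x))" for v
      by (intro Ck_on_add \<open>open S\<close> Suc.IH Suc.prems[THEN Ck_on_pred] Suc.prems[THEN Ck_on_frechet_derivative])
  qed
qed

lemmas Ck_on_mult = Ck_on_bounded_bilinear[OF _ bounded_bilinear_mult]

lemma Ck_on_uminus:
  "open S \<Longrightarrow> Ck_on k S f \<Longrightarrow> Ck_on k S (\<lambda>x. - f x)"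
  using Ck_on_bounded_linear[OF _ bounded_linear_minus[OF bounded_linear_ident]] by blast

lemma Ck_on_exp:
  fixes f :: "'a::real_normed_vector \<Rightarrow> real"
  assumes "open S" "Ck_on k S f"
  shows "Ck_on k S (\<lambda>x. exp (f x))"
  using assms(2)
proof (induction k)
  case 0
  then show ?case by (simp add: continuous_on_exp)
next
  case (Suc k)
  show ?case
  proof (rule Ck_on_SucI[OF \<open>open S\<close>])
    show "((\<lambda>x. exp (f x)) has_derivative (\<lambda>v. frechet_derivative f (at x) v * exp (f x))) (at x)" if "x \<in> S" for x
      using has_derivative_exp[OF Ck_on_has_derivative[OF Suc.prems that]] by (simp add: algebra_simps)
    show "Ck_on k S (\<lambda>x. frechet_derivative f (at x) v * exp (f x))" for v
      by (intro Ck_on_mult \<open>open S\<close> Suc.IH Ck_on_pred[OF Suc.prems] Ck_on_frechet_derivative[OF Suc.prems])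
  qed
qed

lemma Ck_on_inverse:
  fixes f :: "'a::real_normed_vector \<Rightarrow> real"
  assumes "open S" "Ck_on k S f" and nz: "\<And>x. x \<in> S \<Longrightarrow> f x \<noteq> 0"
  shows "Ck_on k S (\<lambda>x. inverse (f x))"
  using assms(2)
proof (induction k)
  case 0
  then show ?case using nz by (simp add: continuous_on_inverse)
next
  case (Suc k)
  \<comment> \<open>The derivative of the reciprocal contains the reciprocal itself, at one order
    less: exactly the induction hypothesis.\<close>
  have *: "Ck_on k S (\<lambda>x. inverse (f x))" by (rule Suc.IH[OF Ck_on_pred[OF Suc.prems]])
  show ?case
  proof (rule Ck_on_SucI[OF \<open>open S\<close>])
    show "((\<lambda>x. inverse (f x)) has_derivative (\<lambda>v. - (inverse (f x) * frechet_derivative f (at x) v * inverse (f x)))) (at x)" if "x \<in> S" for x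
      using Deriv.has_derivative_inverse[OF nz[OF that] Ck_on_has_derivative[OF Suc.prems that]] .
    show "Ck_on k S (\<lambda>x. - (inverse (f x) * frechet_derivative f (at x) v * inverse (f x)))" for v
      by (intro Ck_on_mult Ck_on_uminus \<open>open S\<close> * Ck_on_frechet_derivative[OF Suc.prems])
  qed
qed

lemma Ck_on_ln:
  fixes f :: "'a::real_normed_vector \<Rightarrow> real"
  assumes "open S" "Ck_on k S f" and pos: "\<And>x. x \<in> S \<Longrightarrow> f x > 0"
  shows "Ck_on k S (\<lambda>x. ln (f x))"
proof (cases k)
  case 0
  have "f x \<noteq> 0" if "x \<in> S" for x using pos[OF that] by simp
  then show ?thesis using assms(2) 0 by (simp add: continuous_on_ln)
next
  case (Suc m)
  have f: "Ck_on (Suc m) S f" using assms(2) Suc by metis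
  have nz: "f x \<noteq> 0" if "x \<in> S" for x using pos[OF that] by simp
  show ?thesis unfolding Suc
  proof (rule Ck_on_SucI[OF \<open>open S\<close>])
    show "((\<lambda>x. ln (f x)) has_derivative (\<lambda>v. frechet_derivative f (at x) v * inverse (f x))) (at x)" if "x \<in> S" for x
      using has_derivative_ln[OF pos[OF that] Ck_on_has_derivative[OF f that]] .
    show "Ck_on m S (\<lambda>x. frechet_derivative f (at x) v * inverse (f x))" for v
      by (intro Ck_on_mult Ck_on_inverse \<open>open S\<close> Ck_on_pred[OF f] Ck_on_frechet_derivative[OF f] nz)
  qed
qed

section \<open>Inverses of operator-valued maps\<close>

text \<open>The resolvent identity. A right inverse at one point and a left inverse at the other
  suffice, and no Neumann series, hence no completeness, enters.\<close>

lemma blinfun_inverse_diff: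
  fixes A A' :: "'b::real_normed_vector \<Rightarrow>\<^sub>L 'c::real_normed_vector"
  assumes "A o\<^sub>L R = id_blinfun" "R' o\<^sub>L A' = id_blinfun"
  shows "R' - R = - (R' o\<^sub>L ((A' - A) o\<^sub>L R))"
proof (rule blinfun_eqI)
  fix w
  have "A (R w) = w" "R' (A' (R w)) = R w"
    using arg_cong[OF assms(1), of "\<lambda>T. blinfun_apply T w"] arg_cong[OF assms(2), of "\<lambda>T. blinfun_apply T (R w)"] by simp_all
  then show "blinfun_apply (R' - R) w = blinfun_apply (- (R' o\<^sub>L ((A' - A) o\<^sub>L R))) w"
    by (simp add: blinfun.diff_left blinfun.diff_right blinfun.minus_left)
qed

text \<open>Invertibility near x is given rather than deduced, so the resolvent identity and
  continuity of R already produce the familiar derivative -R A' R.\<close>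

lemma blinfun_inverse_has_derivative:
  fixes A :: "'a::real_normed_vector \<Rightarrow> ('b::real_normed_vector \<Rightarrow>\<^sub>L 'c::real_normed_vector)"
    and R :: "'a \<Rightarrow> ('c \<Rightarrow>\<^sub>L 'b)"
  assumes "open S" "x \<in> S"
    and AR: "\<And>x. x \<in> S \<Longrightarrow> A x o\<^sub>L R x = id_blinfun"
    and RA: "\<And>x. x \<in> S \<Longrightarrow> R x o\<^sub>L A x = id_blinfun"
    and cont: "continuous_on S R"
    and A': "(A has_derivative A') (at x)"
  shows "(R has_derivative (\<lambda>v. - (R x o\<^sub>L (A' v o\<^sub>L R x)))) (at x)"
proof -
  interpret A': bounded_linear A' using A' by (rule has_derivative_bounded_linear)
  have diff: "R y - R x = - (R y o\<^sub>L ((A y - A x) o\<^sub>L R x))" if "y \<in> S" for y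
    by (rule blinfun_inverse_diff[OF AR[OF \<open>x \<in> S\<close>] RA[OF that]])
  have bl: "bounded_linear (\<lambda>v. - (R x o\<^sub>L (A' v o\<^sub>L R x)))"
    by (rule bounded_linear_minus[OF bounded_linear_compose[OF
          bounded_bilinear.bounded_linear_right[OF bounded_bilinear_blinfun_compose]
          bounded_linear_compose[OF bounded_bilinear.bounded_linear_left[OF bounded_bilinear_blinfun_compose] A'.bounded_linear_axioms]]])
  \<comment> \<open>Two sources of error: replacing A y - A x by its linearisation, which is o(|y -
    x|), and replacing R y by R x, which is o(1) times the linear term.\<close>
  have rem: "(R y - R x) + (R x o\<^sub>L (A' (y - x) o\<^sub>L R x)) =
      - (R y o\<^sub>L ((A y - A x - A' (y - x)) o\<^sub>L R x)) - ((R y - R x) o\<^sub>L (A' (y - x) o\<^sub>L R x))" if "y \<in> S" for y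
  proof (rule blinfun_eqI)
    fix w
    have "R y w - R x w = - R y (A y (R x w) - A x (R x w))"
      using arg_cong[OF diff[OF that], of "\<lambda>T. blinfun_apply T w"] by (simp add: blinfun.diff_left blinfun.minus_left)
    then show "blinfun_apply ((R y - R x) + (R x o\<^sub>L (A' (y - x) o\<^sub>L R x))) w =
      blinfun_apply (- (R y o\<^sub>L ((A y - A x - A' (y - x)) o\<^sub>L R x)) - ((R y - R x) o\<^sub>L (A' (y - x) o\<^sub>L R x))) w"
      by (simp add: blinfun.diff_left blinfun.diff_right blinfun.add_left blinfun.minus_left)
  qed
  have evS: "\<forall>\<^sub>F y in at x. y \<in> S" using \<open>open S\<close> \<open>x \<in> S\<close> eventually_at_in_open' by blast
  obtain K where K: "K > 0" "\<And>v. norm (A' v) \<le> norm v * K" using A'.pos_bounded by blast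
  have contR: "((\<lambda>y. R y) \<longlongrightarrow> R x) (at x)"
    using cont \<open>open S\<close> \<open>x \<in> S\<close> by (auto simp: continuous_on_eq_continuous_at continuous_at)
  have A'n: "((\<lambda>y. norm ((A y - A x) - A' (y - x)) / norm (y - x)) \<longlongrightarrow> 0) (at x)"
    using A' by (simp add: has_derivative_iff_norm)
  have lim: "((\<lambda>y. norm (R y) * (norm ((A y - A x) - A' (y - x)) / norm (y - x)) * norm (R x) + norm (R y - R x) * (K * norm (R x))) \<longlongrightarrow> norm (R x) * 0 * norm (R x) + norm (R x - R x) * (K * norm (R x))) (at x)"
    by (intro tendsto_intros contR A'n)
  have "((\<lambda>y. norm ((R y - R x) - (- (R x o\<^sub>L (A' (y - x) o\<^sub>L R x)))) / norm (y - x)) \<longlongrightarrow> 0) (at x)"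
  proof (rule Lim_null_comparison)
    show "\<forall>\<^sub>F y in at x. norm (norm ((R y - R x) - (- (R x o\<^sub>L (A' (y - x) o\<^sub>L R x)))) / norm (y - x))
        \<le> norm (R y) * (norm ((A y - A x) - A' (y - x)) / norm (y - x)) * norm (R x) + norm (R y - R x) * (K * norm (R x))"
      using evS eventually_neq_at_within[of x]
    proof eventually_elim
      case (elim y)
      have "norm ((R y - R x) - (- (R x o\<^sub>L (A' (y - x) o\<^sub>L R x)))) \<le>
         norm (R y o\<^sub>L ((A y - A x - A' (y - x)) o\<^sub>L R x)) + norm ((R y - R x) o\<^sub>L (A' (y - x) o\<^sub>L R x))"
        using rem[OF elim(1)] norm_triangle_ineq4[of "- (R y o\<^sub>L ((A y - A x - A' (y - x)) o\<^sub>L R x))" "((R y - R x) o\<^sub>L (A' (y - x) o\<^sub>L R x))"] by simp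
      also have "\<dots> \<le> norm (R y) * (norm (A y - A x - A' (y - x)) * norm (R x)) + norm (R y - R x) * ((norm (y - x) * K) * norm (R x))"
        by (intro add_mono order_trans[OF norm_blinfun_compose] mult_left_mono mult_right_mono K order_refl) auto
      finally have "norm ((R y - R x) - (- (R x o\<^sub>L (A' (y - x) o\<^sub>L R x)))) / norm (y - x) \<le>
        (norm (R y) * (norm (A y - A x - A' (y - x)) * norm (R x)) + norm (R y - R x) * ((norm (y - x) * K) * norm (R x))) / norm (y - x)"
        by (simp add: divide_right_mono)
      also have "\<dots> = norm (R y) * (norm ((A y - A x) - A' (y - x)) / norm (y - x)) * norm (R x) + norm (R y - R x) * (K * norm (R x))"
        using elim(2) by (simp add: field_simps)
      finally show ?case by simp
    qed
    show "((\<lambda>y. norm (R y) * (norm ((A y - A x) - A' (y - x)) / norm (y - x)) * norm (R x) + norm (R y - R x) * (K * norm (R x))) \<longlongrightarrow> 0) (at x)"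
      using lim by simp
  qed
  with bl show ?thesis unfolding has_derivative_iff_norm by simp
qed

text \<open>With R bounded by M, the resolvent identity makes R Lipschitz as a function of A, with
  constant M^2. In the application the bound comes from coercivity.\<close>

lemma blinfun_inverse_continuous_on:
  fixes A :: "'a::real_normed_vector \<Rightarrow> ('b::real_normed_vector \<Rightarrow>\<^sub>L 'c::real_normed_vector)"
    and R :: "'a \<Rightarrow> ('c \<Rightarrow>\<^sub>L 'b)"
  assumes AR: "\<And>x. x \<in> S \<Longrightarrow> A x o\<^sub>L R x = id_blinfun"
    and RA: "\<And>x. x \<in> S \<Longrightarrow> R x o\<^sub>L A x = id_blinfun"
    and bd: "\<And>x. x \<in> S \<Longrightarrow> norm (R x) \<le> M"
    and A: "continuous_on S A"
  shows "continuous_on S R"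
proof -
  have bound: "norm (R y - R x) \<le> M * (norm (A y - A x) * M)" if "x \<in> S" "y \<in> S" for x y
  proof -
    have "R y - R x = - (R y o\<^sub>L ((A y - A x) o\<^sub>L R x))"
      by (rule blinfun_inverse_diff[OF AR[OF that(1)] RA[OF that(2)]])
    then have "norm (R y - R x) = norm (R y o\<^sub>L ((A y - A x) o\<^sub>L R x))" by simp
    also have "\<dots> \<le> norm (R y) * (norm (A y - A x) * norm (R x))"
      by (intro order_trans[OF norm_blinfun_compose] mult_left_mono norm_blinfun_compose) auto
    also have "\<dots> \<le> M * (norm (A y - A x) * M)"
      using bd that by (intro mult_mono) (auto intro: order_trans[OF norm_ge_zero bd])
    finally show ?thesis .
  qed
  show ?thesis unfolding continuous_on_def
  proof
    fix x assume x: "x \<in> S"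
    have "((\<lambda>y. R y - R x) \<longlongrightarrow> 0) (at x within S)"
    proof (rule Lim_null_comparison)
      show "\<forall>\<^sub>F y in at x within S. norm (R y - R x) \<le> M * (norm (A y - A x) * M)"
        using bound x by (auto simp: eventually_at_filter)
      have "((\<lambda>y. M * (norm (A y - A x) * M)) \<longlongrightarrow> M * (norm (A x - A x) * M)) (at x within S)"
        using A x by (intro tendsto_intros) (auto simp: continuous_on_def)
      then show "((\<lambda>y. M * (norm (A y - A x) * M)) \<longlongrightarrow> 0) (at x within S)" by simp
    qed
    then show "(R \<longlongrightarrow> R x) (at x within S)" by (rule LIM_zero_cancel)
  qed
qed

text \<open>Bootstrapping: the derivative -R A' R involves R without derivatives, so C^k of R and
  C^(k+1) of A give C^(k+1) of R.\<close>

lemma Ck_on_blinfun_inverse: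
  fixes A :: "'a::real_normed_vector \<Rightarrow> ('b::real_normed_vector \<Rightarrow>\<^sub>L 'c::real_normed_vector)"
    and R :: "'a \<Rightarrow> ('c \<Rightarrow>\<^sub>L 'b)"
  assumes "open S"
    and AR: "\<And>x. x \<in> S \<Longrightarrow> A x o\<^sub>L R x = id_blinfun"
    and RA: "\<And>x. x \<in> S \<Longrightarrow> R x o\<^sub>L A x = id_blinfun"
    and bd: "\<And>x. x \<in> S \<Longrightarrow> norm (R x) \<le> M"
    and A: "Ck_on k S A"
  shows "Ck_on k S R"
  using A
proof (induction k)
  case 0
  then show ?case using blinfun_inverse_continuous_on[OF AR RA bd] by simp
next
  case (Suc k)
  have R: "Ck_on k S R" by (rule Suc.IH[OF Ck_on_pred[OF Suc.prems]])
  show ?case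
  proof (rule Ck_on_SucI[OF \<open>open S\<close>])
    show "(R has_derivative (\<lambda>v. - (R x o\<^sub>L (frechet_derivative A (at x) v o\<^sub>L R x)))) (at x)" if "x \<in> S" for x
      using that by (intro blinfun_inverse_has_derivative[OF \<open>open S\<close> _ AR RA] Ck_on_imp_continuous_on[OF R]
           Ck_on_has_derivative[OF Suc.prems])
    show "Ck_on k S (\<lambda>x. - (R x o\<^sub>L (frechet_derivative A (at x) v o\<^sub>L R x)))" for v
      by (intro Ck_on_uminus Ck_on_bounded_bilinear[OF _ bounded_bilinear_blinfun_compose] \<open>open S\<close> R Ck_on_frechet_derivative[OF Suc.prems])
  qed
qed

section \<open>Second differences and symmetry of second derivatives\<close>

lemma Ck_on_DERIV_line:
  fixes f :: "'a::real_normed_vector \<Rightarrow> real"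
  assumes "Ck_on (Suc k) S f" "c + a *\<^sub>R u \<in> S"
  shows "((\<lambda>a. f (c + a *\<^sub>R u)) has_real_derivative frechet_derivative f (at (c + a *\<^sub>R u)) u) (at a)"
proof -
  note d = Ck_on_has_derivative[OF assms]
  interpret d: bounded_linear "frechet_derivative f (at (c + a *\<^sub>R u))"
    using d by (rule has_derivative_bounded_linear)
  have "((\<lambda>a. c + a *\<^sub>R u) has_derivative (\<lambda>r. r *\<^sub>R u)) (at a)"
    by (auto intro!: derivative_eq_intros)
  from has_derivative_compose[OF this d]
  have "((\<lambda>a. f (c + a *\<^sub>R u)) has_derivative (\<lambda>r. frechet_derivative f (at (c + a *\<^sub>R u)) (r *\<^sub>R u))) (at a)" .
  then show ?thesis
    by (simp add: has_field_derivative_def d.scaleR mult.commute[of _ "frechet_derivative f (at (c + a *\<^sub>R u)) u"])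
qed

text \<open>The mean value theorem is used in a, for the difference of f along two parallel
  segments, and then in b, for the derivative so obtained.\<close>

lemma second_difference_mvt:
  fixes f :: "'a::real_normed_vector \<Rightarrow> real"
  assumes f: "Ck_on (Suc (Suc 0)) S f" and "0 < s"
    and S: "\<And>a b. \<lbrakk>0 \<le> a; a \<le> s; 0 \<le> b; b \<le> s\<rbrakk> \<Longrightarrow> x + a *\<^sub>R u + b *\<^sub>R v \<in> S"
  obtains a b where "0 < a" "a < s" "0 < b" "b < s"
    "f (x + s *\<^sub>R u + s *\<^sub>R v) - f (x + s *\<^sub>R u) - f (x + s *\<^sub>R v) + f x =
      s * s * frechet_derivative (\<lambda>y. frechet_derivative f (at y) u) (at (x + a *\<^sub>R u + b *\<^sub>R v)) v"
proof -
  let ?D = "\<lambda>y. frechet_derivative f (at y) u"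
  have 1: "((\<lambda>a. f (x + s *\<^sub>R v + a *\<^sub>R u) - f (x + a *\<^sub>R u)) has_real_derivative (?D (x + s *\<^sub>R v + a *\<^sub>R u) - ?D (x + a *\<^sub>R u))) (at a)"
    if "0 \<le> a" "a \<le> s" for a
    using S[of a s] S[of a 0] that \<open>0 < s\<close>
    by (intro DERIV_diff Ck_on_DERIV_line[OF f]) (auto simp: algebra_simps)
  obtain a where a: "0 < a" "a < s" "f (x + s *\<^sub>R v + s *\<^sub>R u) - f (x + s *\<^sub>R u) - (f (x + s *\<^sub>R v + 0 *\<^sub>R u) - f (x + 0 *\<^sub>R u))
     = (s - 0) * (?D (x + s *\<^sub>R v + a *\<^sub>R u) - ?D (x + a *\<^sub>R u))"
    using MVT2[OF \<open>0 < s\<close> 1] by blast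
  have 2: "((\<lambda>b. ?D (x + a *\<^sub>R u + b *\<^sub>R v)) has_real_derivative frechet_derivative ?D (at (x + a *\<^sub>R u + b *\<^sub>R v)) v) (at b)"
    if "0 \<le> b" "b \<le> s" for b
    using S[of a b] that a
    by (intro Ck_on_DERIV_line[OF Ck_on_frechet_derivative[OF f]]) auto
  obtain b where b: "0 < b" "b < s" "?D (x + a *\<^sub>R u + s *\<^sub>R v) - ?D (x + a *\<^sub>R u + 0 *\<^sub>R v) = (s - 0) * frechet_derivative ?D (at (x + a *\<^sub>R u + b *\<^sub>R v)) v"
    using MVT2[OF \<open>0 < s\<close> 2] by blast
  show thesis
    by (rule that[OF a(1,2) b(1,2)]) (use a(3) b(3) in \<open>simp add: algebra_simps\<close>)
qed

lemma Ck_on_second_derivative_symmetric: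
  fixes f :: "'a::real_normed_vector \<Rightarrow> real"
  assumes "open S" "x \<in> S" and f: "Ck_on (Suc (Suc 0)) S f"
  shows "frechet_derivative (\<lambda>y. frechet_derivative f (at y) u) (at x) v =
         frechet_derivative (\<lambda>y. frechet_derivative f (at y) v) (at x) u"
proof -
  let ?D = "\<lambda>u v x. frechet_derivative (\<lambda>y. frechet_derivative f (at y) u) (at x) v"
  have "\<bar>?D u v x - ?D v u x\<bar> \<le> 2 * e" if "e > 0" for e
  proof -
    have c: "isCont (?D u v) x" for u v
    proof -
      have "Ck_on 0 S (?D u v)" by (intro Ck_on_frechet_derivative f)
      then show ?thesis using \<open>open S\<close> \<open>x \<in> S\<close> by (simp add: continuous_on_eq_continuous_at)
    qed
    obtain d1 where d1: "d1 > 0" "\<And>y. dist y x < d1 \<Longrightarrow> dist (?D u v y) (?D u v x) < e"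
      using c[of u v] \<open>e > 0\<close> unfolding continuous_at_eps_delta by metis
    obtain d2 where d2: "d2 > 0" "\<And>y. dist y x < d2 \<Longrightarrow> dist (?D v u y) (?D v u x) < e"
      using c[of v u] \<open>e > 0\<close> unfolding continuous_at_eps_delta by metis
    obtain d3 where d3: "d3 > 0" "\<And>y. dist y x < d3 \<Longrightarrow> y \<in> S"
      using \<open>open S\<close> \<open>x \<in> S\<close> unfolding open_dist by blast
    define d where "d = min d1 (min d2 d3)"
    define N where "N = norm u + norm v + 1"
    \<comment> \<open>The whole parallelogram spanned by s u and s v then stays within d / 2 of
      x.\<close>
    define s where "s = d / (2 * N)"
    have d: "d > 0" using d1 d2 d3 by (simp add: d_def)
    have pos: "N > 0" unfolding N_def using norm_ge_zero[of u] norm_ge_zero[of v] by linarith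
    then have s: "s > 0" using d by (simp add: s_def)
    have near: "dist (x + a *\<^sub>R u + b *\<^sub>R v) x < d" if "0 \<le> a" "a \<le> s" "0 \<le> b" "b \<le> s" for a b
    proof -
      have "dist (x + a *\<^sub>R u + b *\<^sub>R v) x = norm (a *\<^sub>R u + b *\<^sub>R v)" by (simp add: dist_norm algebra_simps)
      also have "\<dots> \<le> a * norm u + b * norm v" using norm_triangle_ineq[of "a *\<^sub>R u" "b *\<^sub>R v"] that by simp
      also have "\<dots> \<le> s * norm u + s * norm v" using that by (intro add_mono mult_right_mono) auto
      also have "\<dots> \<le> s * N" using s by (simp add: algebra_simps N_def)
      also have "\<dots> = d / 2" using pos by (simp add: s_def)
      finally show ?thesis using d by simp
    qed
    have S1: "x + a *\<^sub>R u + b *\<^sub>R v \<in> S" if "0 \<le> a" "a \<le> s" "0 \<le> b" "b \<le> s" for a b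
      using near[OF that] d3 by (simp add: d_def)
    have S2: "x + a *\<^sub>R v + b *\<^sub>R u \<in> S" if "0 \<le> a" "a \<le> s" "0 \<le> b" "b \<le> s" for a b
      using S1[of b a] that by (simp add: algebra_simps)
    obtain a b where ab: "0 < a" "a < s" "0 < b" "b < s"
    "f (x + s *\<^sub>R u + s *\<^sub>R v) - f (x + s *\<^sub>R u) - f (x + s *\<^sub>R v) + f x = s * s * ?D u v (x + a *\<^sub>R u + b *\<^sub>R v)"
      using second_difference_mvt[OF f s S1] by blast
    obtain a' b' where ab': "0 < a'" "a' < s" "0 < b'" "b' < s"
    "f (x + s *\<^sub>R v + s *\<^sub>R u) - f (x + s *\<^sub>R v) - f (x + s *\<^sub>R u) + f x = s * s * ?D v u (x + a' *\<^sub>R v + b' *\<^sub>R u)"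
      using second_difference_mvt[OF f s S2] by blast
    \<comment> \<open>The second difference is symmetric in u and v, so the two mixed derivatives
      agree at two points near x.\<close>
    have "s * s * ?D u v (x + a *\<^sub>R u + b *\<^sub>R v) = s * s * ?D v u (x + a' *\<^sub>R v + b' *\<^sub>R u)"
      using ab(5) ab'(5) by (simp add: algebra_simps)
    then have eq: "?D u v (x + a *\<^sub>R u + b *\<^sub>R v) = ?D v u (x + a' *\<^sub>R v + b' *\<^sub>R u)"
      using s by simp
    have "dist (?D u v (x + a *\<^sub>R u + b *\<^sub>R v)) (?D u v x) < e"
      using near[of a b] ab by (intro d1(2)) (auto simp: d_def)
    moreover have "dist (?D v u (x + a' *\<^sub>R v + b' *\<^sub>R u)) (?D v u x) < e"
      using near[of b' a'] ab' by (intro d2(2)) (auto simp: d_def algebra_simps)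
    ultimately show ?thesis using eq by (simp add: dist_real_def)
  qed
  \<comment> \<open>With e a quarter of the gap, the gap is at most half of itself, hence
    zero.\<close>
  from this[of "\<bar>?D u v x - ?D v u x\<bar> / 4"] show ?thesis by (cases "?D u v x = ?D v u x") auto
qed

section \<open>Coercive forms on incomplete spaces\<close>

locale coercive_form =
  fixes b :: "'v::real_normed_vector \<Rightarrow>\<^sub>L 'v \<Rightarrow>\<^sub>L real" and c :: real
  assumes sym: "b f g = b g f"
    and c_pos: "0 < c"
    and coercive: "c * (norm f)\<^sup>2 \<le> b f f"
begin

text \<open>The canonical embedding into the bidual.\<close>

abbreviation ev :: "'v \<Rightarrow> ('v \<Rightarrow>\<^sub>L real) \<Rightarrow>\<^sub>L real" where
  "ev \<equiv> blinfun.prod_left"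

lemma nonneg: "0 \<le> b f f"
  using coercive[of f] c_pos by (meson mult_nonneg_nonneg order.trans less_imp_le zero_le_power2)

lemma eq_zero: "b f f = 0 \<Longrightarrow> f = 0"
  using coercive[of f] c_pos by (simp add: mult_le_0_iff)

lemma norm_le: "c * norm f \<le> norm (b f)"
proof (cases "f = 0")
  case False
  have "c * norm f * norm f \<le> b f f" using coercive[of f] by (simp add: power2_eq_square algebra_simps)
  also have "\<dots> \<le> norm (b f) * norm f" using norm_blinfun[of "b f" f] by simp
  finally show ?thesis using False by simp
qed simp

lemma expand: "b (f + s *\<^sub>R g) (f + s *\<^sub>R g) = b f f + 2 * s * b f g + s * s * b g g"
  by (simp add: blinfun.add_left blinfun.add_right blinfun.scaleR_left blinfun.scaleR_right sym[of g f] algebra_simps)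

lemma Cauchy_Schwarz: "(b f g)\<^sup>2 \<le> b f f * b g g"
proof (cases "b g g = 0")
  case True
  then show ?thesis using eq_zero[OF True] by simp
next
  case False
  then have pos: "b g g > 0" using nonneg[of g] by simp
  have "0 \<le> b (f + (- (b f g / b g g)) *\<^sub>R g) (f + (- (b f g / b g g)) *\<^sub>R g)" by (rule nonneg)
  also have "\<dots> = b f f - (b f g)\<^sup>2 / b g g"
    unfolding expand using pos by (simp add: power2_eq_square field_simps)
  finally show ?thesis using pos by (simp add: field_simps)
qed

text \<open>Almost minimisers of the energy \<open>b f f / 2 - l f\<close> almost represent \<open>l\<close>.\<close>

lemma dense_range:
  fixes l :: "'v \<Rightarrow>\<^sub>L real"
  assumes "e > 0"
  obtains f :: 'v where "norm (b f - l) \<le> e"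
proof -
  define E where "E = (\<lambda>f :: 'v. b f f / 2 - l f)"
  have bdd: "bdd_below (range E)"
  proof (rule bdd_belowI2)
    fix f :: 'v
    \<comment> \<open>Completing the square: by coercivity the quadratic term of the energy
      dominates the linear one.\<close>
    have "0 \<le> (c * norm f - norm l)\<^sup>2 / (2 * c)" using c_pos by simp
    also have "\<dots> = c * (norm f)\<^sup>2 / 2 - norm l * norm f + (norm l)\<^sup>2 / (2 * c)"
      using c_pos by (simp add: power2_eq_square field_simps)
    finally have "- ((norm l)\<^sup>2 / (2 * c)) \<le> c * (norm f)\<^sup>2 / 2 - norm l * norm f" by simp
    also have "\<dots> \<le> E f"
      unfolding E_def using coercive[of f] norm_blinfun[of l f] by simp
    finally show "- ((norm l)\<^sup>2 / (2 * c)) \<le> E f" .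
  qed
  \<comment> \<open>The added 1 keeps B positive when b = 0. The slack \<open>\<delta>\<close> is
    then tuned so that \<open>2 * Q * \<delta>\<close> is exactly the square of
    \<open>e * norm g\<close>.\<close>
  define B where "B = norm b + 1"
  have B: "B > 0" unfolding B_def using norm_ge_zero[of b] by linarith
  define \<delta> where "\<delta> = e\<^sup>2 / (2 * B)"
  have "\<delta> > 0" using assms B by (simp add: \<delta>_def)
  then have "Inf (range E) < Inf (range E) + \<delta>" by simp
  then obtain f :: 'v where f: "E f < Inf (range E) + \<delta>"
    using cInf_lessD[of "range E" "Inf (range E) + \<delta>"] by blast
  have "norm (blinfun_apply (b f - l) g) \<le> e * norm g" for g
  proof (cases "g = 0")
    case False
    define p where "p = b f g - l g"
    define Q where "Q = B * (norm g)\<^sup>2"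
    have Q: "Q > 0" using B False by (simp add: Q_def)
    have qQ: "b g g \<le> Q"
    proof -
      have "b g g \<le> norm (b g) * norm g" using norm_blinfun[of "b g" g] by simp
      also have "\<dots> \<le> (norm b * norm g) * norm g" by (intro mult_right_mono norm_blinfun) auto
      also have "\<dots> \<le> Q" unfolding Q_def B_def by (simp add: power2_eq_square algebra_simps)
      finally show ?thesis .
    qed
    \<comment> \<open>Minimiser of the quadratic majorant s p + s^2 Q / 2 of the energy change; the
      decrease p^2 / (2 Q) that it guarantees cannot exceed \<open>\<delta>\<close>.\<close>
    define s where "s = - p / Q"
    have "E f - \<delta> < E (f + s *\<^sub>R g)"
      using f cInf_lower[OF _ bdd, of "E (f + s *\<^sub>R g)"] by simp
    also have "E (f + s *\<^sub>R g) = E f + s * p + s * s * b g g / 2"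
      unfolding E_def expand p_def by (simp add: blinfun.add_right blinfun.scaleR_right field_simps)
    finally have "- \<delta> < s * p + s * s * b g g / 2" by simp
    also have "\<dots> \<le> s * p + s * s * Q / 2" using qQ by (intro add_left_mono divide_right_mono mult_left_mono) auto
    also have "\<dots> = - (p\<^sup>2 / (2 * Q))" using Q by (simp add: s_def power2_eq_square field_simps)
    finally have "p\<^sup>2 < 2 * Q * \<delta>" using Q by (simp add: field_simps)
    also have "\<dots> = (e * norm g)\<^sup>2" unfolding Q_def \<delta>_def using B by (simp add: field_simps)
    finally have "\<bar>p\<bar> \<le> e * norm g" using abs_le_square_iff[of p "e * norm g"] assms by (simp add: abs_mult)
    then show ?thesis by (simp add: p_def blinfun.diff_left)
  qed simp
  then have "norm (b f - l) \<le> e" using assms by (intro norm_blinfun_bound) auto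
  then show thesis by (rule that)
qed

text \<open>Coercivity turns convergence of \<open>b (f n)\<close> into the Cauchy property of f.
  The limit of f may be missing from the space, but the images in the bidual converge because the
  bidual is complete.\<close>

lemma representing_sequence:
  fixes l :: "'v \<Rightarrow>\<^sub>L real"
  obtains f \<xi> where "(\<lambda>n. b (f n)) \<longlonglongrightarrow> l" "(\<lambda>n. ev (f n)) \<longlonglongrightarrow> \<xi>" "Bseq f"
proof -
  have "\<forall>n::nat. \<exists>f. norm (b f - l) \<le> inverse (real (Suc n))"
    using dense_range[of _ l] by (metis inverse_positive_iff_positive of_nat_0_less_iff zero_less_Suc)
  then obtain f where f: "\<And>n::nat. norm (b (f n) - l) \<le> inverse (real (Suc n))" by metis
  have lim: "(\<lambda>n. b (f n)) \<longlonglongrightarrow> l"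
    by (rule LIM_zero_cancel, rule Lim_null_comparison[OF _ LIMSEQ_inverse_real_of_nat]) (use f in auto)
  have Cf: "Cauchy f"
  proof (rule CauchyI)
    fix e :: real assume "e > 0"
    then obtain M where M: "\<And>m n. m \<ge> M \<Longrightarrow> n \<ge> M \<Longrightarrow> norm (b (f m) - b (f n)) < c * e"
      using CauchyD[OF LIMSEQ_imp_Cauchy[OF lim], of "c * e"] c_pos by auto
    have "norm (f m - f n) < e" if "m \<ge> M" "n \<ge> M" for m n
      using norm_le[of "f m - f n"] M[OF that] c_pos by (simp add: blinfun.diff_right) (smt (verit) mult_less_cancel_left_pos)
    then show "\<exists>M. \<forall>m\<ge>M. \<forall>n\<ge>M. norm (f m - f n) < e" by blast
  qed
  have "Cauchy (\<lambda>n. ev (f n))"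
    using bounded_linear.Cauchy[OF blinfun.bounded_linear_prod_left Cf] .
  then obtain \<xi> where "(\<lambda>n. ev (f n)) \<longlonglongrightarrow> \<xi>" using Cauchy_convergent convergent_def by blast
  with lim show thesis using that Cauchy_Bseq[OF Cf] by blast
qed

text \<open>On functionals of the form \<open>b g\<close> the bound is coercivity; it extends to all
  functionals because the range of b is dense.\<close>

lemma bidual_lower_bound:
  fixes \<xi> :: "('v \<Rightarrow>\<^sub>L real) \<Rightarrow>\<^sub>L real"
  shows "norm \<xi> \<le> norm (\<xi> o\<^sub>L b) / c"
proof (rule norm_blinfun_bound)
  fix l :: "'v \<Rightarrow>\<^sub>L real"
  obtain f where f: "(\<lambda>n. b (f n)) \<longlonglongrightarrow> l" using representing_sequence by blast
  have "norm (\<xi> (b g)) \<le> norm (\<xi> o\<^sub>L b) / c * norm (b g)" for g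
  proof -
    have "norm (\<xi> (b g)) \<le> norm (\<xi> o\<^sub>L b) * norm g" using norm_blinfun[of "\<xi> o\<^sub>L b" g] by simp
    also have "\<dots> \<le> norm (\<xi> o\<^sub>L b) * (norm (b g) / c)"
      using norm_le[of g] c_pos by (intro mult_left_mono) (auto simp: field_simps)
    finally show ?thesis by simp
  qed
  then show "norm (\<xi> l) \<le> norm (\<xi> o\<^sub>L b) / c * norm l"
    by (intro LIMSEQ_le[OF tendsto_norm[OF blinfun.tendsto[OF tendsto_const f]] tendsto_mult[OF tendsto_const tendsto_norm[OF f]]]) auto
qed (use c_pos in auto)

text \<open>R inverts the transpose of b, a map from the bidual to the dual. The transpose is onto
  by taking limits of evaluations along a representing sequence; it is injective with bounded
  inverse by \<open>bidual_lower_bound\<close>.\<close>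

lemma transpose_inverse:
  obtains R :: "('v \<Rightarrow>\<^sub>L real) \<Rightarrow>\<^sub>L (('v \<Rightarrow>\<^sub>L real) \<Rightarrow>\<^sub>L real)"
  where "\<And>l. R l o\<^sub>L b = l" "\<And>\<xi>. R (\<xi> o\<^sub>L b) = \<xi>" "norm R \<le> 1 / c"
proof -
  interpret comp: bounded_bilinear "(o\<^sub>L) :: (('v \<Rightarrow>\<^sub>L real) \<Rightarrow>\<^sub>L real) \<Rightarrow> _ \<Rightarrow> ('v \<Rightarrow>\<^sub>L real)"
    by (rule bounded_bilinear_blinfun_compose)
  have ex: "\<exists>\<xi>. \<xi> o\<^sub>L b = l" for l :: "'v \<Rightarrow>\<^sub>L real"
  proof -
    obtain f \<xi> where f: "(\<lambda>n. b (f n)) \<longlonglongrightarrow> l" "(\<lambda>n. ev (f n)) \<longlonglongrightarrow> \<xi>"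
      using representing_sequence by blast
    have "blinfun_apply (\<xi> o\<^sub>L b) g = l g" for g
    proof (rule LIMSEQ_unique)
      show "(\<lambda>n. b (f n) g) \<longlonglongrightarrow> l g" by (intro blinfun.tendsto f tendsto_const)
      \<comment> \<open>Evaluation at \<open>f n\<close> sends \<open>b g\<close> to
        \<open>b g (f n)\<close>, which is \<open>b (f n) g\<close> by symmetry of the form.\<close>
      have "(\<lambda>n. blinfun_apply (ev (f n)) (b g)) \<longlonglongrightarrow> \<xi> (b g)"
        by (intro blinfun.tendsto f tendsto_const)
      then show "(\<lambda>n. b (f n) g) \<longlonglongrightarrow> blinfun_apply (\<xi> o\<^sub>L b) g"
        by (simp add: sym[of g])
    qed
    then show ?thesis by (blast intro: blinfun_eqI)
  qed
  have uniq: "\<xi> = \<xi>'" if "\<xi> o\<^sub>L b = \<xi>' o\<^sub>L b" for \<xi> \<xi>' :: "('v \<Rightarrow>\<^sub>L real) \<Rightarrow>\<^sub>L real"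
    using bidual_lower_bound[of "\<xi> - \<xi>'"] that by (simp add: comp.diff_left)
  define r where "r = (\<lambda>l :: 'v \<Rightarrow>\<^sub>L real. SOME \<xi>. \<xi> o\<^sub>L b = l)"
  have r: "r l o\<^sub>L b = l" for l unfolding r_def using ex by (rule someI_ex)
  have rn: "norm (r l) \<le> norm l * (1 / c)" for l using bidual_lower_bound[of "r l"] by (simp add: r)
  have bl: "bounded_linear r"
  proof (rule bounded_linear_intro)
    show "r (x + y) = r x + r y" for x y by (rule uniq) (simp add: r comp.add_left)
    show "r (s *\<^sub>R x) = s *\<^sub>R r x" for s x by (rule uniq) (simp add: r comp.scaleR_left)
  qed (rule rn)
  show thesis
  proof (rule that[of "Blinfun r"])
    show "blinfun_apply (Blinfun r) l o\<^sub>L b = l" for l by (simp add: bounded_linear_Blinfun_apply bl r)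
    show "blinfun_apply (Blinfun r) (\<xi> o\<^sub>L b) = \<xi>" for \<xi> by (rule uniq) (simp add: bounded_linear_Blinfun_apply bl r)
    show "norm (Blinfun r) \<le> 1 / c"
      by (rule norm_blinfun_bound) (use c_pos rn in \<open>auto simp: bounded_linear_Blinfun_apply bl mult.commute\<close>)
  qed
qed

text \<open>Both \<open>b (f n) (f n)\<close> and \<open>l (f n)\<close> tend to
  \<open>\<xi> l\<close> along a representing sequence, so \<open>\<xi> l\<close> is the squared
  norm of l dual to the form: Cauchy-Schwarz gives the upper bound, and the normalised
  \<open>f n\<close> approach it.\<close>

lemma Sup_eq_bidual:
  fixes l :: "'v \<Rightarrow>\<^sub>L real"
  assumes "\<xi> o\<^sub>L b = l"
  shows "(SUP f\<in>{f. b f f \<le> 1}. (l f)\<^sup>2) = \<xi> l" "bdd_above ((\<lambda>f. (l f)\<^sup>2) ` {f. b f f \<le> 1})"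
proof -
  obtain f \<eta> where f: "(\<lambda>n. b (f n)) \<longlonglongrightarrow> l" "(\<lambda>n. ev (f n)) \<longlonglongrightarrow> \<eta>" "Bseq f"
    using representing_sequence by blast
  have lim1: "(\<lambda>n. l (f n)) \<longlonglongrightarrow> \<xi> l"
  proof -
    have "(\<lambda>n. \<xi> (b (f n))) \<longlonglongrightarrow> \<xi> l" by (intro blinfun.tendsto f tendsto_const)
    moreover have "\<xi> (b (f n)) = l (f n)" for n
      using assms by (metis blinfun_apply_blinfun_compose)
    ultimately show ?thesis by simp
  qed
  \<comment> \<open>A null sequence of functionals applied to a bounded sequence of vectors; this is
    where \<open>Bseq f\<close> is needed.\<close>
  have "(\<lambda>n. (b (f n) - l) (f n)) \<longlonglongrightarrow> 0"
  proof -
    have "Zfun (\<lambda>n. b (f n) - l) sequentially" using f(1) by (simp add: tendsto_Zfun_iff)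
    moreover have "Bfun f sequentially" by (rule f(3))
    ultimately have "Zfun (\<lambda>n. (b (f n) - l) (f n)) sequentially" by (rule blinfun.Zfun_prod_Bfun)
    then show ?thesis by (simp add: tendsto_Zfun_iff)
  qed
  from tendsto_add[OF this lim1] have lim2: "(\<lambda>n. b (f n) (f n)) \<longlonglongrightarrow> \<xi> l"
    by (simp add: blinfun.diff_left)
  have upper: "(l g)\<^sup>2 \<le> \<xi> l * b g g" for g
  proof (rule LIMSEQ_le)
    show "(\<lambda>n. (b (f n) g)\<^sup>2) \<longlonglongrightarrow> (l g)\<^sup>2" by (intro tendsto_intros blinfun.tendsto f)
    show "(\<lambda>n. b (f n) (f n) * b g g) \<longlonglongrightarrow> \<xi> l * b g g" by (intro tendsto_intros lim2)
  qed (use Cauchy_Schwarz in blast)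
  have nn: "\<xi> l \<ge> 0" by (rule LIMSEQ_le_const[OF lim2]) (use nonneg in blast)
  have upper1: "(l g)\<^sup>2 \<le> \<xi> l" if "b g g \<le> 1" for g
    using upper[of g] mult_left_mono[OF that nn] by simp
  then show bdd: "bdd_above ((\<lambda>f. (l f)\<^sup>2) ` {f. b f f \<le> 1})" by (auto intro!: bdd_aboveI2)
  have "\<xi> l \<le> (SUP f\<in>{f. b f f \<le> 1}. (l f)\<^sup>2)"
  proof (cases "\<xi> l = 0")
    \<comment> \<open>If the limit is 0, the \<open>f n\<close> cannot be normalised; the vector 0
      attains the bound.\<close>
    case True
    then show ?thesis by (auto intro!: cSUP_upper2[OF bdd, of 0])
  next
    case False
    then have pos: "\<xi> l > 0" using nn by simp
    have "(\<lambda>n. (l (f n))\<^sup>2 / b (f n) (f n)) \<longlonglongrightarrow> (\<xi> l)\<^sup>2 / \<xi> l"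
      by (intro tendsto_intros lim1 lim2 False)
    then have lim3: "(\<lambda>n. (l (f n))\<^sup>2 / b (f n) (f n)) \<longlonglongrightarrow> \<xi> l" by (simp add: power2_eq_square)
    have "\<forall>\<^sub>F n in sequentially. b (f n) (f n) > 0" using order_tendstoD(1)[OF lim2 pos] .
    then have "\<forall>\<^sub>F n in sequentially. (l (f n))\<^sup>2 / b (f n) (f n) \<le> (SUP f\<in>{f. b f f \<le> 1}. (l f)\<^sup>2)"
    proof eventually_elim
      case (elim n)
      define g where "g = (1 / sqrt (b (f n) (f n))) *\<^sub>R f n"
      have "b g g = 1" using elim by (simp add: g_def blinfun.scaleR_left blinfun.scaleR_right)
      then have "(l g)\<^sup>2 \<le> (SUP f\<in>{f. b f f \<le> 1}. (l f)\<^sup>2)" by (intro cSUP_upper[OF _ bdd]) auto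
      moreover have "(l g)\<^sup>2 = (l (f n))\<^sup>2 / b (f n) (f n)"
        using elim by (simp add: g_def blinfun.scaleR_right power_mult_distrib power_divide)
      ultimately show ?case by simp
    qed
    then show ?thesis by (rule tendsto_upperbound[OF lim3]) simp
  qed
  moreover have "(SUP f\<in>{f. b f f \<le> 1}. (l f)\<^sup>2) \<le> \<xi> l"
    by (rule cSUP_least) (use upper1 in \<open>auto intro!: exI[of _ 0]\<close>)
  ultimately show "(SUP f\<in>{f. b f f \<le> 1}. (l f)\<^sup>2) = \<xi> l" by simp
qed

end

text \<open>The supremum equals \<open>R t l l\<close>, where \<open>R t\<close> inverts the
  transpose of \<open>B t\<close>. The transpose depends linearly on \<open>B t\<close>, and the
  common coercivity constant c bounds every \<open>R t\<close> by 1 / c, as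
  \<open>Ck_on_blinfun_inverse\<close> requires.\<close>

lemma Ck_on_SUP_coercive_form:
  fixes B :: "'a::real_normed_vector \<Rightarrow> 'v::real_normed_vector \<Rightarrow>\<^sub>L 'v \<Rightarrow>\<^sub>L real" and l :: "'v \<Rightarrow>\<^sub>L real"
  assumes "open S" "Ck_on k S B" and form: "\<And>t. t \<in> S \<Longrightarrow> coercive_form (B t) c"
  shows "Ck_on k S (\<lambda>t. SUP f\<in>{f. B t f f \<le> 1}. (l f)\<^sup>2)"
proof -
  interpret comp: bounded_bilinear "(o\<^sub>L) :: (('v \<Rightarrow>\<^sub>L real) \<Rightarrow>\<^sub>L real) \<Rightarrow> _ \<Rightarrow> ('v \<Rightarrow>\<^sub>L real)"
    by (rule bounded_bilinear_blinfun_compose)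
  have "\<forall>t\<in>S. \<exists>R :: ('v \<Rightarrow>\<^sub>L real) \<Rightarrow>\<^sub>L (('v \<Rightarrow>\<^sub>L real) \<Rightarrow>\<^sub>L real).
      (\<forall>l. blinfun_apply R l o\<^sub>L B t = l) \<and> (\<forall>\<xi>. blinfun_apply R (\<xi> o\<^sub>L B t) = \<xi>) \<and> norm R \<le> 1 / c"
    using coercive_form.transpose_inverse[OF form] by metis
  then obtain R :: "'a \<Rightarrow> ('v \<Rightarrow>\<^sub>L real) \<Rightarrow>\<^sub>L (('v \<Rightarrow>\<^sub>L real) \<Rightarrow>\<^sub>L real)"
    where R: "\<And>t l. t \<in> S \<Longrightarrow> R t l o\<^sub>L B t = l" "\<And>t \<xi>. t \<in> S \<Longrightarrow> R t (\<xi> o\<^sub>L B t) = \<xi>"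
      "\<And>t. t \<in> S \<Longrightarrow> norm (R t) \<le> 1 / c" by metis
  have A: "Ck_on k S (\<lambda>t. comp.prod_left (B t))"
    by (rule Ck_on_bounded_linear[OF assms(1) comp.bounded_linear_prod_left assms(2)])
  have "Ck_on k S R"
    by (rule Ck_on_blinfun_inverse[OF assms(1) _ _ R(3) A])
      (auto intro!: blinfun_eqI simp: R(1,2))
  from Ck_on_bounded_bilinear[OF assms(1) bounded_bilinear_blinfun_apply this Ck_on_const[OF assms(1)]]
  have "Ck_on k S (\<lambda>t. R t l)" .
  from Ck_on_bounded_bilinear[OF assms(1) bounded_bilinear_blinfun_apply this Ck_on_const[OF assms(1)]]
  have "Ck_on k S (\<lambda>t. R t l l)" .
  moreover have "(SUP f\<in>{f. B t f f \<le> 1}. (l f)\<^sup>2) = R t l l" if "t \<in> S" for t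
    using coercive_form.Sup_eq_bidual(1)[OF form[OF that] R(1)[OF that]] .
  ultimately show ?thesis
    using Ck_on_cong[OF assms(1), of "\<lambda>t. SUP f\<in>{f. B t f f \<le> 1}. (l f)\<^sup>2" "\<lambda>t. R t l l"] by simp
qed

section \<open>Orthogonal invariance of Lebesgue measure and the sub-mean value property\<close>

lemma nn_integral_lborel_translate:
  fixes c :: "'a::euclidean_space"
  assumes "f \<in> borel_measurable borel"
  shows "(\<integral>\<^sup>+x. f (c + x) \<partial>lborel) = (\<integral>\<^sup>+x. f x \<partial>lborel)"
proof -
  have "(\<integral>\<^sup>+x. f x \<partial>lborel) = (\<integral>\<^sup>+x. f x \<partial>distr lborel borel ((+) c))"
    by (simp add: lborel_distr_plus)
  also have "\<dots> = (\<integral>\<^sup>+x. f (c + x) \<partial>lborel)"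
    using assms by (subst nn_integral_distr) auto
  finally show ?thesis by simp
qed

text \<open>Uniqueness of Haar measure: integrate \<open>1\<^sub>A (T x - y) 1\<^sub>B (T x)\<close> over \<open>x\<close> and \<open>y\<close> in both orders.\<close>

lemma nn_integral_lborel_linear_exchange:
  fixes T :: "'a::euclidean_space \<Rightarrow> 'a"
  assumes T: "linear T" "surj T" and [measurable]: "A \<in> sets borel" "B \<in> sets borel"
  shows "(\<integral>\<^sup>+x. indicator A (T x) \<partial>lborel) * emeasure lborel B =
         (\<integral>\<^sup>+x. indicator B (T x) \<partial>lborel) * (\<integral>\<^sup>+y. indicator A (- y) \<partial>lborel)"
proof -
  have [measurable]: "T \<in> borel \<rightarrow>\<^sub>M borel"
    using linear_continuous_on[OF linear_conv_bounded_linear[THEN iffD1, OF T(1)]] by (rule borel_measurable_continuous_onI)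
  have "(\<integral>\<^sup>+x. indicator A (T x) \<partial>lborel) * emeasure lborel B =
      (\<integral>\<^sup>+x. indicator A (T x) * (\<integral>\<^sup>+y. indicator B (T x + y) \<partial>lborel) \<partial>lborel)"
    by (subst nn_integral_lborel_translate) (auto simp: nn_integral_multc)
  also have "\<dots> = (\<integral>\<^sup>+x. (\<integral>\<^sup>+y. indicator A (T x) * indicator B (T x + y) \<partial>lborel) \<partial>lborel)"
    by (subst nn_integral_cmult) auto
  also have "\<dots> = (\<integral>\<^sup>+y. (\<integral>\<^sup>+x. indicator A (T x) * indicator B (T x + y) \<partial>lborel) \<partial>lborel)"
    by (rule lborel_pair.Fubini') measurable
  also have "\<dots> = (\<integral>\<^sup>+y. (\<integral>\<^sup>+x. indicator A (T x - y) * indicator B (T x) \<partial>lborel) \<partial>lborel)"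
  proof (rule nn_integral_cong)
    fix y
    \<comment> \<open>Surjectivity enters here: shifting x by a preimage of y moves the translation
      out of B and into A.\<close>
    obtain z where z: "T z = y" using T(2) by (metis surjE)
    have "(\<integral>\<^sup>+x. indicator A (T x) * indicator B (T x + y) \<partial>lborel) =
       (\<integral>\<^sup>+x. indicator A (T (- z + x)) * indicator B (T (- z + x) + y) \<partial>lborel)"
      by (subst nn_integral_lborel_translate[where f = "\<lambda>x. indicator A (T x) * indicator B (T x + y)"]) auto
    also have "\<dots> = (\<integral>\<^sup>+x. indicator A (T x - y) * indicator B (T x) \<partial>lborel)"
      by (simp add: linear_add[OF T(1)] linear_neg[OF T(1)] linear_diff[OF T(1)] z)
    finally show "(\<integral>\<^sup>+x. indicator A (T x) * indicator B (T x + y) \<partial>lborel) =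
      (\<integral>\<^sup>+x. indicator A (T x - y) * (indicator B (T x) :: ennreal) \<partial>lborel)" .
  qed
  also have "\<dots> = (\<integral>\<^sup>+x. (\<integral>\<^sup>+y. indicator A (T x - y) * indicator B (T x) \<partial>lborel) \<partial>lborel)"
    by (rule lborel_pair.Fubini'[symmetric]) measurable
  also have "\<dots> = (\<integral>\<^sup>+x. indicator B (T x) * (\<integral>\<^sup>+y. indicator A (T x - y) \<partial>lborel) \<partial>lborel)"
    by (subst nn_integral_cmult[symmetric]) (auto simp: mult.commute)
  also have "\<dots> = (\<integral>\<^sup>+x. indicator B (T x) * (\<integral>\<^sup>+y. indicator A (- y) \<partial>lborel) \<partial>lborel)"
  proof (rule nn_integral_cong)
    fix x
    have "(\<integral>\<^sup>+y. indicator A (T x - y) \<partial>lborel) = (\<integral>\<^sup>+y. indicator A (T x - (T x + y)) \<partial>lborel :: ennreal)"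
      by (subst nn_integral_lborel_translate[where f = "\<lambda>y. indicator A (T x - y)"]) auto
    then show "indicator B (T x) * (\<integral>\<^sup>+y. indicator A (T x - y) \<partial>lborel) = 
        indicator B (T x) * (\<integral>\<^sup>+y. indicator A (- y) \<partial>lborel :: ennreal)" by simp
  qed
  also have "\<dots> = (\<integral>\<^sup>+x. indicator B (T x) \<partial>lborel) * (\<integral>\<^sup>+y. indicator A (- y) \<partial>lborel)"
    by (rule nn_integral_multc) auto
  finally show ?thesis .
qed

text \<open>The exchange formula with B the unit ball, once for T and once for the identity. The
  ball is invariant under T, so the right-hand sides agree, and its positive finite volume
  cancels.\<close>

lemma lborel_distr_orthogonal:
  fixes T :: "'a::euclidean_space \<Rightarrow> 'a"
  assumes T: "orthogonal_transformation T"
  shows "distr lborel borel T = lborel"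
proof (rule measure_eqI)
  have lin: "linear T" and surj: "surj T"
    using T orthogonal_transformation_linear orthogonal_transformation_surj by blast+
  have [measurable]: "T \<in> borel \<rightarrow>\<^sub>M borel"
    using linear_continuous_on[OF linear_conv_bounded_linear[THEN iffD1, OF lin]] by (rule borel_measurable_continuous_onI)
  fix A assume "A \<in> sets (distr lborel borel T)"
  then have [measurable]: "A \<in> sets borel" by simp
  let ?B = "ball (0::'a) 1"
  have B: "emeasure lborel ?B \<noteq> 0" "emeasure lborel ?B \<noteq> \<infinity>"
    using unit_ball_vol_pos[of "real DIM('a)"] by (simp_all add: emeasure_ball less_imp_neq[symmetric])
  have TB: "(\<integral>\<^sup>+x. indicator ?B (T x) \<partial>lborel) = emeasure lborel ?B"
  proof -
    have "indicator ?B (T x) = (indicator ?B x :: ennreal)" for x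
      using orthogonal_transformation_norm[OF T, of x] by (simp add: indicator_def)
    then show ?thesis by simp
  qed
  have 1: "(\<integral>\<^sup>+x. indicator A (T x) \<partial>lborel) * emeasure lborel ?B = emeasure lborel ?B * (\<integral>\<^sup>+y. indicator A (- y) \<partial>lborel)"
    using nn_integral_lborel_linear_exchange[OF lin surj, of A ?B] TB by simp
  have 2: "emeasure lborel A * emeasure lborel ?B = emeasure lborel ?B * (\<integral>\<^sup>+y. indicator A (- y) \<partial>lborel)"
    using nn_integral_lborel_linear_exchange[of "\<lambda>x. x" A ?B] by (simp add: module_hom_ident)
  have "(\<integral>\<^sup>+x. indicator A (T x) \<partial>lborel) = emeasure lborel A"
  proof -
    have "emeasure lborel ?B * (\<integral>\<^sup>+x. indicator A (T x) \<partial>lborel) = emeasure lborel ?B * emeasure lborel A"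
      using 1 2 by (simp add: mult.commute)
    then show ?thesis using B by (simp add: ennreal_mult_cancel_left)
  qed
  moreover have "(\<integral>\<^sup>+x. indicator A (T x) \<partial>lborel) = emeasure (distr lborel borel T) A"
    using nn_integral_distr[of T lborel borel "indicator A"] by simp
  ultimately show "emeasure (distr lborel borel T) A = emeasure lborel A" by simp
qed simp

lemma nn_integral_lborel_orthogonal:
  fixes T :: "'a::euclidean_space \<Rightarrow> 'a"
  assumes T: "orthogonal_transformation T" and [measurable]: "f \<in> borel_measurable borel"
  shows "(\<integral>\<^sup>+x. f (T x) \<partial>lborel) = (\<integral>\<^sup>+x. f x \<partial>lborel)"
proof -
  have [measurable]: "T \<in> borel \<rightarrow>\<^sub>M borel"
    using linear_continuous_on[OF linear_conv_bounded_linear[THEN iffD1, OF orthogonal_transformation_linear[OF T]]]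
    by (rule borel_measurable_continuous_onI)
  have "(\<integral>\<^sup>+x. f x \<partial>lborel) = (\<integral>\<^sup>+x. f x \<partial>distr lborel borel T)"
    by (simp add: lborel_distr_orthogonal[OF T])
  then show ?thesis by (simp add: nn_integral_distr)
qed

section \<open>Coordinatewise multiplication and the polydisc\<close>

text \<open>One bilinear product for two purposes: dilations of the weight, with t as parameter, and
  torus rotations, when all entries of t have modulus one.\<close>

definition coord_mult :: "complex ^ 'n::finite \<Rightarrow> complex ^ 'n \<Rightarrow> complex ^ 'n" where
  "coord_mult t z = (\<chi> i. t $ i * z $ i)"

lemma coord_mult_nth [simp]: "coord_mult t z $ i = t $ i * z $ i"
  by (simp add: coord_mult_def)

lemma norm_coord_mult_le: "norm (coord_mult t z) \<le> norm t * norm z"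
proof -
  have "norm (coord_mult t z) = L2_set (\<lambda>i. norm (t $ i) * norm (z $ i)) UNIV"
    by (simp add: norm_vec_def norm_mult)
  also have "\<dots> \<le> L2_set (\<lambda>i. norm t * norm (z $ i)) UNIV"
    by (intro L2_set_mono mult_right_mono Finite_Cartesian_Product.norm_nth_le) auto
  also have "\<dots> = norm t * norm z"
    by (simp add: L2_set_left_distrib norm_vec_def L2_set_right_distrib)
  finally show ?thesis .
qed

lemma bounded_bilinear_coord_mult: "bounded_bilinear (coord_mult :: complex ^ 'n::finite \<Rightarrow> _)"
proof
  show "\<exists>K. \<forall>a b. norm (coord_mult a b :: complex ^ 'n) \<le> norm a * norm b * K"
    using norm_coord_mult_le by (intro exI[of _ 1]) auto
qed (auto simp: vec_eq_iff algebra_simps)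

interpretation coord_mult: bounded_bilinear "coord_mult :: complex ^ 'n::finite \<Rightarrow> _"
  by (rule bounded_bilinear_coord_mult)

lemma orthogonal_transformation_coord_mult:
  assumes "\<And>i. norm (u $ i) = 1"
  shows "orthogonal_transformation (coord_mult u)"
  unfolding orthogonal_transformation_def
proof (intro conjI allI)
  show "linear (coord_mult u)"
    by (rule bounded_linear.linear[OF coord_mult.bounded_linear_right])
  have "inner (a * x) (a * y) = inner x y" if "norm a = 1" for a x y :: complex
  proof -
    have "(Re a)\<^sup>2 + (Im a)\<^sup>2 = 1" using that by (metis cmod_power2 one_power2)
    then show ?thesis unfolding inner_complex_def complex_mult
      by simp algebra
  qed
  then show "inner (coord_mult u v) (coord_mult u w) = inner v w" for v w
    using assms by (simp add: inner_vec_def)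
qed

lemma open_unit_polydisc: "open (unit_polydisc :: (complex ^ 'n::finite) set)"
proof -
  have "unit_polydisc = (\<Inter>i. (\<lambda>z. z $ i) -` ball (0::complex) 1)"
    by (auto simp: unit_polydisc_def)
  also have "open \<dots>"
    by (intro open_INT ballI continuous_open_vimage) (auto intro: continuous_intros)
  finally show ?thesis .
qed

lemma zero_in_unit_polydisc [simp]: "0 \<in> unit_polydisc"
  by (simp add: unit_polydisc_def)

lemma unit_polydisc_borel [measurable]: "unit_polydisc \<in> sets (borel :: (complex ^ 'n::finite) measure)"
  by (rule borel_open[OF open_unit_polydisc])

lemma coord_mult_in_unit_polydisc:
  assumes "\<And>i. norm (t $ i) \<le> 1" "z \<in> unit_polydisc"
  shows "coord_mult t z \<in> unit_polydisc"
  using assms mult_mono[OF assms(1) order_refl, of "norm (z $ _)"] by (auto simp: unit_polydisc_def norm_mult) (smt (verit) mult_left_le_one_le norm_ge_zero)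

lemma scalar_in_unit_polydisc:
  assumes "norm c \<le> 1" "z \<in> unit_polydisc"
  shows "c *s z \<in> unit_polydisc"
proof -
  have "c *s z = coord_mult (\<chi> i. c) z" by (simp add: vec_eq_iff)
  then show ?thesis using coord_mult_in_unit_polydisc[of "\<chi> i. c" z] assms by simp
qed

section \<open>Mean values of holomorphic functions over circles and the polydisc\<close>

lemma holomorphic_several_on_continuous_on:
  "holomorphic_several_on S f \<Longrightarrow> continuous_on S f"
  unfolding holomorphic_several_on_def
  by (blast intro: continuous_at_imp_continuous_on has_derivative_continuous)

lemma holomorphic_on_complex_line:
  assumes "holomorphic_several_on S f" "\<And>\<zeta>. \<zeta> \<in> A \<Longrightarrow> \<zeta> *s z \<in> S"
  shows "(\<lambda>\<zeta>. f (\<zeta> *s z)) holomorphic_on A"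
  unfolding holomorphic_on_def
proof
  fix \<zeta> assume "\<zeta> \<in> A"
  then obtain f' where f': "(f has_derivative f') (at (\<zeta> *s z))" "\<And>c v. f' (c *s v) = c * f' v"
    using assms unfolding holomorphic_several_on_def by blast
  have "bounded_linear (\<lambda>\<zeta>::complex. \<zeta> *s z)"
  proof -
    have "(\<lambda>\<zeta>::complex. \<zeta> *s z) = (\<lambda>\<zeta>. coord_mult (\<chi> i. \<zeta>) z)" by (auto simp: vec_eq_iff)
    moreover have "linear (\<lambda>\<zeta>::complex. coord_mult (\<chi> i. \<zeta>) z)"
      by (rule linearI) (auto simp: vec_eq_iff algebra_simps)
    ultimately show ?thesis by (simp add: linear_conv_bounded_linear)
  qed
  then have "((\<lambda>\<zeta>. \<zeta> *s z) has_derivative (\<lambda>v. v *s z)) (at \<zeta>)"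
    by (rule bounded_linear_imp_has_derivative)
  from has_derivative_compose[OF this f'(1)]
  have "((\<lambda>\<zeta>. f (\<zeta> *s z)) has_derivative (\<lambda>v. f' z * v)) (at \<zeta>)"
    by (simp add: f'(2) mult.commute)
  then have "((\<lambda>\<zeta>. f (\<zeta> *s z)) has_field_derivative f' z) (at \<zeta>)"
    by (simp add: has_field_derivative_def)
  then show "(\<lambda>\<zeta>. f (\<zeta> *s z)) field_differentiable at \<zeta> within A"
    using field_differentiable_at_within field_differentiable_def by blast
qed

lemma holomorphic_circle_mean:
  assumes "h holomorphic_on cball 0 1"
  shows "((\<lambda>t. h (exp (2 * of_real pi * \<i> * of_real t))) has_integral h 0) {0..1}"
proof -
  have "((\<lambda>u. h u / (u - 0)) has_contour_integral (2 * of_real pi * \<i> * h 0)) (circlepath 0 1)"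
    by (rule Cauchy_integral_circlepath_simple[OF assms]) simp
  then have "((\<lambda>x. h (circlepath 0 1 x) / circlepath 0 1 x * vector_derivative (circlepath 0 1) (at x within {0..1})) has_integral (2 * of_real pi * \<i> * h 0)) {0..1}"
    by (simp add: has_contour_integral_def)
  then have "((\<lambda>x. (2 * of_real pi * \<i>) * h (exp (2 * of_real pi * \<i> * of_real x))) has_integral (2 * of_real pi * \<i> * h 0)) {0..1}"
    by (rule has_integral_eq[rotated]) (simp add: vector_derivative_circlepath01, simp add: circlepath)
  from has_integral_mult_right[OF this, of "1 / (2 * of_real pi * \<i>)"]
  show ?thesis by simp
qed

text \<open>The mean value identity is applied to h^2, so the triangle inequality for integrals
  bounds the squared modulus directly, without Jensen's inequality.\<close>

lemma holomorphic_circle_submean: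
  assumes "h holomorphic_on cball 0 1"
  shows "ennreal ((norm (h 0))\<^sup>2) \<le>
    (\<integral>\<^sup>+t. indicator {0..1} t * ennreal ((norm (h (exp (2 * of_real pi * \<i> * of_real t))))\<^sup>2) \<partial>lborel)"
proof -
  let ?e = "\<lambda>t::real. exp (2 * of_real pi * \<i> * of_real t)"
  have "(\<lambda>\<zeta>. (h \<zeta>)\<^sup>2) holomorphic_on cball 0 1" using assms by (intro holomorphic_intros)
  from holomorphic_circle_mean[OF this]
  have I: "((\<lambda>t. (h (?e t))\<^sup>2) has_integral (h 0)\<^sup>2) {0..1}" .
  have "continuous_on {0..1} (\<lambda>t. (norm (h (?e t)))\<^sup>2)"
    by (intro continuous_intros continuous_on_compose2[OF holomorphic_on_imp_continuous_on[OF assms]]) auto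
  then have int: "(\<lambda>t. (norm (h (?e t)))\<^sup>2) integrable_on {0..1}"
    by (rule integrable_continuous_real)
  have "norm (integral {0..1} (\<lambda>t. (h (?e t))\<^sup>2)) \<le> integral {0..1} (\<lambda>t. (norm (h (?e t)))\<^sup>2)"
    by (rule integral_norm_bound_integral) (use I int in \<open>auto simp: norm_power\<close>)
  then have "(norm (h 0))\<^sup>2 \<le> integral {0..1} (\<lambda>t. (norm (h (?e t)))\<^sup>2)"
    using integral_unique[OF I] by (simp add: norm_power)
  then have "ennreal ((norm (h 0))\<^sup>2) \<le> ennreal (integral {0..1} (\<lambda>t. (norm (h (?e t)))\<^sup>2))"
    by (rule ennreal_leI)
  also have "\<dots> = (\<integral>\<^sup>+t. ennreal (indicator {0..1} t * (norm (h (?e t)))\<^sup>2) \<partial>lborel)"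
    using nn_integral_has_integral_lebesgue[OF _ integrable_integral[OF int]] by simp
  also have "\<dots> = (\<integral>\<^sup>+t. indicator {0..1} t * ennreal ((norm (h (?e t)))\<^sup>2) \<partial>lborel)"
    by (intro nn_integral_cong) (auto simp: indicator_def)
  finally show ?thesis .
qed

lemma borel_measurable_norm_power2_polydisc:
  assumes "holomorphic_several_on unit_polydisc f"
  shows "(\<lambda>z. ennreal ((norm (f z))\<^sup>2) * indicator unit_polydisc z) \<in> borel_measurable borel"
proof -
  have "continuous_on unit_polydisc (\<lambda>z. (norm (f z))\<^sup>2)"
    by (intro continuous_intros holomorphic_several_on_continuous_on assms)
  then have "(\<lambda>z. indicator unit_polydisc z *\<^sub>R (norm (f z))\<^sup>2) \<in> borel_measurable borel"
    by (intro borel_measurable_continuous_on_indicator) auto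
  from measurable_compose[OF this measurable_ennreal] show ?thesis
    by (rule measurable_cong[THEN iffD1, rotated]) (auto simp: indicator_def)
qed

text \<open>The circle acts on the polydisc by z -> c z, and each orbit lies in a disc of one
  complex line, so Cauchy's formula in one variable is enough. After Fubini the rotation disappears,
  since Lebesgue measure, the polydisc and w are all invariant.\<close>

lemma polydisc_submean:
  fixes f :: "complex ^ 'n::finite \<Rightarrow> complex"
  assumes f: "holomorphic_several_on unit_polydisc f"
    and w [measurable]: "w \<in> borel_measurable borel"
    and inv: "\<And>c z. norm c = 1 \<Longrightarrow> w (c *s z) = w z"
  shows "ennreal ((norm (f 0))\<^sup>2) * (\<integral>\<^sup>+z\<in>unit_polydisc. w z \<partial>lborel) \<le>
         (\<integral>\<^sup>+z\<in>unit_polydisc. ennreal ((norm (f z))\<^sup>2) * w z \<partial>lborel)"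
proof -
  define e where "e = (\<lambda>t::real. exp (2 * of_real pi * \<i> * of_real t))"
  let ?D = "unit_polydisc :: (complex ^ 'n) set"
  \<comment> \<open>Cutting off at the polydisc gives a function measurable on the whole space, so
    that the rotation can be carried out there.\<close>
  define G where "G = (\<lambda>z. ennreal ((norm (f z))\<^sup>2) * indicator ?D z)"
  have [measurable]: "G \<in> borel_measurable borel"
    unfolding G_def by (rule borel_measurable_norm_power2_polydisc[OF f])
  have ne: "norm (e t) = 1" for t by (simp add: e_def)
  have "continuous_on UNIV (\<lambda>(t, z). e t *s (z :: complex ^ 'n))"
  proof -
    have "(\<lambda>(t, z). e t *s (z :: complex ^ 'n)) = (\<lambda>p. coord_mult (\<chi> i. e (fst p)) (snd p))"
      by (auto simp: vec_eq_iff)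
    moreover have "continuous_on UNIV (\<lambda>p :: real \<times> (complex ^ 'n). coord_mult (\<chi> i. e (fst p)) (snd p))"
      unfolding e_def by (intro coord_mult.continuous_on continuous_on_vec_lambda continuous_intros)
    ultimately show ?thesis by (simp only:)
  qed
  then have rot: "(\<lambda>(t, z). e t *s (z :: complex ^ 'n)) \<in> lborel \<Otimes>\<^sub>M lborel \<rightarrow>\<^sub>M borel"
    unfolding lborel_prod by (simp add: borel_measurable_continuous_onI)
  have [measurable]: "(\<lambda>(t, z). G (e t *s z)) \<in> borel_measurable (lborel \<Otimes>\<^sub>M lborel)"
    using measurable_compose[OF rot, of G] by (simp add: case_prod_beta')
  have "ennreal ((norm (f 0))\<^sup>2) * (\<integral>\<^sup>+z\<in>?D. w z \<partial>lborel) = (\<integral>\<^sup>+z\<in>?D. ennreal ((norm (f 0))\<^sup>2) * w z \<partial>lborel)"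
    by (subst nn_integral_cmult[symmetric]) (auto simp: mult.assoc)
  also have "\<dots> \<le> (\<integral>\<^sup>+z. (\<integral>\<^sup>+t. indicator {0..1} t * (G (e t *s z) * w z) \<partial>lborel) \<partial>lborel)"
  proof (rule nn_integral_mono)
    fix z :: "complex ^ 'n"
    show "ennreal ((norm (f 0))\<^sup>2) * w z * indicator ?D z \<le> (\<integral>\<^sup>+t. indicator {0..1} t * (G (e t *s z) * w z) \<partial>lborel)"
    proof (cases "z \<in> ?D")
      case True
      have hol: "(\<lambda>\<zeta>. f (\<zeta> *s z)) holomorphic_on cball 0 1"
        by (rule holomorphic_on_complex_line[OF f]) (use True in \<open>auto intro: scalar_in_unit_polydisc\<close>)
      have G: "G (e t *s z) = ennreal ((norm (f (e t *s z)))\<^sup>2)" for t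
        using scalar_in_unit_polydisc[of "e t" z] True by (simp add: G_def ne)
      have [measurable]: "(\<lambda>t. G (e t *s z)) \<in> borel_measurable lborel"
      proof -
        have "(\<lambda>t. (t, z)) \<in> lborel \<rightarrow>\<^sub>M lborel \<Otimes>\<^sub>M lborel" by measurable
        from measurable_compose[OF this, of "\<lambda>(t, z). G (e t *s z)"] show ?thesis by simp
      qed
      have "ennreal ((norm (f 0))\<^sup>2) \<le> (\<integral>\<^sup>+t. indicator {0..1} t * G (e t *s z) \<partial>lborel)"
        using holomorphic_circle_submean[OF hol] by (simp add: G e_def[symmetric] fun_cong[OF e_def, symmetric])
      then have "ennreal ((norm (f 0))\<^sup>2) * w z \<le> (\<integral>\<^sup>+t. indicator {0..1} t * G (e t *s z) \<partial>lborel) * w z"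
        by (rule mult_right_mono) simp
      also have "\<dots> = (\<integral>\<^sup>+t. indicator {0..1} t * (G (e t *s z) * w z) \<partial>lborel)"
        by (subst nn_integral_multc[symmetric]) (auto simp: mult.assoc)
      finally show ?thesis using True by simp
    qed simp
  qed
  also have "\<dots> = (\<integral>\<^sup>+t. (\<integral>\<^sup>+z. indicator {0..1} t * (G (e t *s z) * w z) \<partial>lborel) \<partial>lborel)"
    by (rule lborel_pair.Fubini') measurable
  also have "\<dots> = (\<integral>\<^sup>+(t::real). indicator {0..1} t * (\<integral>\<^sup>+z. G z * w z \<partial>lborel) \<partial>lborel)"
  proof (rule nn_integral_cong)
    fix t :: real
    have eq: "e t *s z = coord_mult (\<chi> i. e t) z" for z :: "complex ^ 'n" by (simp add: vec_eq_iff)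
    have "(\<integral>\<^sup>+z. G (e t *s z) * w z \<partial>lborel) = (\<integral>\<^sup>+z. G (e t *s z) * w (e t *s z) \<partial>lborel)"
      by (simp add: inv ne)
    also have "\<dots> = (\<integral>\<^sup>+z. G z * w z \<partial>lborel)"
      unfolding eq by (rule nn_integral_lborel_orthogonal[OF orthogonal_transformation_coord_mult]) (auto simp: ne)
    finally show "(\<integral>\<^sup>+z. indicator {0..1} t * (G (e t *s z) * w z) \<partial>lborel) = indicator {0..1} t * (\<integral>\<^sup>+z. G z * w z \<partial>lborel)"
      by (cases "t \<in> {0..1}") auto
  qed
  also have "\<dots> = (\<integral>\<^sup>+z. G z * w z \<partial>lborel)"
    by (subst nn_integral_multc) auto
  also have "\<dots> = (\<integral>\<^sup>+z\<in>?D. ennreal ((norm (f z))\<^sup>2) * w z \<partial>lborel)"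
    by (simp add: G_def mult_ac)
  finally show ?thesis .
qed

section \<open>The Bergman space and its weighted forms\<close>

text \<open>Vanishing off the polydisc makes a member determined by its values inside, so the L^2
  norm is definite without a quotient. The unweighted norm serves all weights bounded above and away
  from zero.\<close>

definition bergman_functions :: "(complex ^ 'n::finite \<Rightarrow> complex) set" where
  "bergman_functions = {f. holomorphic_several_on unit_polydisc f \<and>
     (\<forall>z. z \<notin> unit_polydisc \<longrightarrow> f z = 0) \<and> integrable lborel (\<lambda>z. (norm (f z))\<^sup>2)}"

lemma holomorphic_several_on_cong:
  assumes "open S" "\<And>z. z \<in> S \<Longrightarrow> f z = g z" "holomorphic_several_on S f"
  shows "holomorphic_several_on S g"
  unfolding holomorphic_several_on_def
proof
  fix z assume z: "z \<in> S"
  then obtain f' where f': "(f has_derivative f') (at z)" "\<forall>c v. f' (c *s v) = c * f' v"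
    using assms(3) unfolding holomorphic_several_on_def by blast
  have "(g has_derivative f') (at z)"
    using has_derivative_transform_within_open[OF f'(1) assms(1) z assms(2)] .
  then show "\<exists>f'. (g has_derivative f') (at z) \<and> (\<forall>c v. f' (c *s v) = c * f' v)"
    using f'(2) by blast
qed

lemma holomorphic_several_on_const: "holomorphic_several_on S (\<lambda>z. c)"
  unfolding holomorphic_several_on_def by (auto intro!: exI[of _ "\<lambda>v. 0"])

lemma holomorphic_several_on_add:
  assumes "holomorphic_several_on S f" "holomorphic_several_on S g"
  shows "holomorphic_several_on S (\<lambda>z. f z + g z)"
  unfolding holomorphic_several_on_def
proof
  fix z assume z: "z \<in> S"
  obtain f' where f': "(f has_derivative f') (at z)" "\<forall>c v. f' (c *s v) = c * f' v"
    using assms(1) z unfolding holomorphic_several_on_def by blast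
  obtain g' where g': "(g has_derivative g') (at z)" "\<forall>c v. g' (c *s v) = c * g' v"
    using assms(2) z unfolding holomorphic_several_on_def by blast
  show "\<exists>h'. ((\<lambda>z. f z + g z) has_derivative h') (at z) \<and> (\<forall>c v. h' (c *s v) = c * h' v)"
    using has_derivative_add[OF f'(1) g'(1)] f'(2) g'(2) by (intro exI[of _ "\<lambda>v. f' v + g' v"]) (auto simp: algebra_simps)
qed

lemma holomorphic_several_on_mult:
  assumes "holomorphic_several_on S f" "holomorphic_several_on S g"
  shows "holomorphic_several_on S (\<lambda>z. f z * g z)"
  unfolding holomorphic_several_on_def
proof
  fix z assume z: "z \<in> S"
  obtain f' where f': "(f has_derivative f') (at z)" "\<forall>c v. f' (c *s v) = c * f' v"
    using assms(1) z unfolding holomorphic_several_on_def by blast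
  obtain g' where g': "(g has_derivative g') (at z)" "\<forall>c v. g' (c *s v) = c * g' v"
    using assms(2) z unfolding holomorphic_several_on_def by blast
  show "\<exists>h'. ((\<lambda>z. f z * g z) has_derivative h') (at z) \<and> (\<forall>c v. h' (c *s v) = c * h' v)"
    using has_derivative_mult[OF f'(1) g'(1)] f'(2) g'(2)
    by (intro exI[of _ "\<lambda>v. f z * g' v + f' v * g z"]) (auto simp: algebra_simps)
qed

lemma holomorphic_several_on_borel_measurable:
  assumes "holomorphic_several_on unit_polydisc f" "\<And>z. z \<notin> unit_polydisc \<Longrightarrow> f z = 0"
  shows "f \<in> borel_measurable borel"
proof -
  have "(\<lambda>z. indicator unit_polydisc z *\<^sub>R f z) \<in> borel_measurable borel"
    by (intro borel_measurable_continuous_on_indicator holomorphic_several_on_continuous_on assms(1)) auto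
  moreover have "(\<lambda>z. indicator unit_polydisc z *\<^sub>R f z) = f"
    using assms(2) by (auto simp: indicator_def fun_eq_iff)
  ultimately show ?thesis by (simp only:)
qed

lemma bergman_functions_zero: "(\<lambda>z. 0) \<in> bergman_functions"
  by (simp add: bergman_functions_def holomorphic_several_on_const)

lemma bergman_functions_measurable: "f \<in> bergman_functions \<Longrightarrow> f \<in> borel_measurable borel"
  using holomorphic_several_on_borel_measurable by (auto simp: bergman_functions_def)

lemma bergman_functions_add:
  assumes "f \<in> bergman_functions" "g \<in> bergman_functions"
  shows "(\<lambda>z. f z + g z) \<in> bergman_functions"
proof -
  have [measurable]: "f \<in> borel_measurable borel" "g \<in> borel_measurable borel"
    using assms bergman_functions_measurable by auto
  have "integrable lborel (\<lambda>z. (norm (f z + g z))\<^sup>2)"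
  proof (rule Bochner_Integration.integrable_bound)
    show "integrable lborel (\<lambda>z. 2 * (norm (f z))\<^sup>2 + 2 * (norm (g z))\<^sup>2)"
      using assms by (auto simp: bergman_functions_def)
    have "(norm (f z + g z))\<^sup>2 \<le> 2 * (norm (f z))\<^sup>2 + 2 * (norm (g z))\<^sup>2" for z
    proof -
      have "(norm (f z + g z))\<^sup>2 \<le> (norm (f z) + norm (g z))\<^sup>2"
        by (intro power_mono norm_triangle_ineq) auto
      also have "\<dots> \<le> 2 * (norm (f z))\<^sup>2 + 2 * (norm (g z))\<^sup>2"
        using zero_le_power2[of "norm (f z) - norm (g z)"] by (simp add: power2_eq_square algebra_simps)
      finally show ?thesis .
    qed
    then show "AE z in lborel. norm ((norm (f z + g z))\<^sup>2) \<le> norm (2 * (norm (f z))\<^sup>2 + 2 * (norm (g z))\<^sup>2)"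
      by simp
  qed measurable
  then show ?thesis using assms by (auto simp: bergman_functions_def intro!: holomorphic_several_on_add)
qed

lemma bergman_functions_cmult:
  assumes "f \<in> bergman_functions"
  shows "(\<lambda>z. c * f z) \<in> bergman_functions"
  using assms by (auto simp: bergman_functions_def norm_mult power_mult_distrib
      intro!: holomorphic_several_on_mult holomorphic_several_on_const)

lemma bergman_functions_scaleR:
  assumes "f \<in> bergman_functions"
  shows "(\<lambda>z. c *\<^sub>R f z) \<in> bergman_functions"
  using bergman_functions_cmult[OF assms, of "of_real c"] by (simp add: scaleR_conv_of_real)

lemma bergman_functions_uminus:
  assumes "f \<in> bergman_functions"
  shows "(\<lambda>z. - f z) \<in> bergman_functions"
  using bergman_functions_cmult[OF assms, of "-1"] by simp

text \<open>The weight is only relevant on the polydisc, since Bergman functions are extended by zero.\<close>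

definition bounded_weight :: "(complex ^ 'n::finite \<Rightarrow> real) \<Rightarrow> real \<Rightarrow> bool" where
  "bounded_weight u M \<longleftrightarrow> (\<lambda>z. indicator unit_polydisc z * u z) \<in> borel_measurable borel \<and>
     (\<forall>z\<in>unit_polydisc. \<bar>u z\<bar> \<le> M)"

text \<open>With \<open>inner\<close> the real inner product on complex numbers, this is the real
  part of the usual Hermitian weighted product.\<close>

definition weighted_inner ::
  "(complex ^ 'n::finite \<Rightarrow> real) \<Rightarrow> (complex ^ 'n \<Rightarrow> complex) \<Rightarrow> (complex ^ 'n \<Rightarrow> complex) \<Rightarrow> real" where
  "weighted_inner u f g = (\<integral>z. u z * inner (f z) (g z) \<partial>lborel)"

lemma abs_inner_le_norm_squares: "\<bar>inner x y\<bar> \<le> ((norm x)\<^sup>2 + (norm y)\<^sup>2) / 2"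
proof -
  have "\<bar>inner x y\<bar> \<le> norm x * norm y" by (rule Cauchy_Schwarz_ineq2)
  also have "\<dots> \<le> ((norm x)\<^sup>2 + (norm y)\<^sup>2) / 2"
    using zero_le_power2[of "norm x - norm y"] by (simp add: power2_eq_square algebra_simps)
  finally show ?thesis .
qed

lemma bounded_weight_nonneg: "bounded_weight u M \<Longrightarrow> 0 \<le> M"
  unfolding bounded_weight_def using zero_in_unit_polydisc by (metis abs_ge_zero order_trans)

lemma weighted_inner_integrable:
  assumes "bounded_weight u M" "f \<in> bergman_functions" "g \<in> bergman_functions"
  shows "integrable lborel (\<lambda>z. u z * inner (f z) (g z))"
proof (rule Bochner_Integration.integrable_bound)
  have [measurable]: "f \<in> borel_measurable borel" "g \<in> borel_measurable borel"
    using assms bergman_functions_measurable by auto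
  show "integrable lborel (\<lambda>z. M * (((norm (f z))\<^sup>2 + (norm (g z))\<^sup>2) / 2))"
    using assms by (auto simp: bergman_functions_def)
  have [measurable]: "(\<lambda>z. indicator unit_polydisc z * u z) \<in> borel_measurable borel"
    using assms by (simp add: bounded_weight_def)
  have "(\<lambda>z. (indicator unit_polydisc z * u z) * inner (f z) (g z)) \<in> borel_measurable borel"
    by measurable
  moreover have "(\<lambda>z. (indicator unit_polydisc z * u z) * inner (f z) (g z)) = (\<lambda>z. u z * inner (f z) (g z))"
    using assms by (auto simp: bergman_functions_def indicator_def fun_eq_iff)
  ultimately show "(\<lambda>z. u z * inner (f z) (g z)) \<in> borel_measurable lborel" by simp
  have "\<bar>u z * inner (f z) (g z)\<bar> \<le> M * (((norm (f z))\<^sup>2 + (norm (g z))\<^sup>2) / 2)" for z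
  proof (cases "z \<in> unit_polydisc")
    case True
    then show ?thesis unfolding abs_mult using assms(1) bounded_weight_nonneg[OF assms(1)]
      by (intro mult_mono abs_inner_le_norm_squares) (auto simp: bounded_weight_def)
  next
    case False
    then show ?thesis using assms by (auto simp: bergman_functions_def)
  qed
  then show "AE z in lborel. norm (u z * inner (f z) (g z)) \<le> norm (M * (((norm (f z))\<^sup>2 + (norm (g z))\<^sup>2) / 2))"
    by (simp add: order_trans[OF _ abs_ge_self])
qed

lemma weighted_inner_add_right:
  assumes "bounded_weight u M" "f \<in> bergman_functions" "g \<in> bergman_functions" "h \<in> bergman_functions"
  shows "weighted_inner u f (\<lambda>z. g z + h z) = weighted_inner u f g + weighted_inner u f h"
  unfolding weighted_inner_def
  using Bochner_Integration.integral_add[OF weighted_inner_integrable[OF assms(1,2,3)] weighted_inner_integrable[OF assms(1,2,4)]]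
  by (simp add: inner_add_right algebra_simps)

lemma weighted_inner_scaleR_right: "weighted_inner u f (\<lambda>z. c *\<^sub>R g z) = c * weighted_inner u f g"
  unfolding weighted_inner_def by (simp add: mult.left_commute)

lemma weighted_inner_commute: "weighted_inner u f g = weighted_inner u g f"
  unfolding weighted_inner_def by (simp add: inner_commute)

lemma bounded_weight_1: "bounded_weight (\<lambda>z. 1) 1"
  by (simp add: bounded_weight_def)

text \<open>By continuity the set where f is nonzero is open; it is also null, hence empty.\<close>

lemma weighted_inner_self_eq_0:
  fixes f :: "complex ^ 'n::finite \<Rightarrow> complex"
  assumes f: "f \<in> bergman_functions" and 0: "weighted_inner (\<lambda>z. 1) f f = 0"
  shows "f = (\<lambda>z. 0)"
proof -
  let ?D = "unit_polydisc :: (complex ^ 'n) set"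
  have "AE z in lborel. inner (f z) (f z) = 0"
    using 0 integral_nonneg_eq_0_iff_AE[of lborel "\<lambda>z. inner (f z) (f z)"]
      weighted_inner_integrable[OF bounded_weight_1 f f] by (simp add: weighted_inner_def)
  then have ae: "AE z in lborel. z \<notin> {z \<in> ?D. f z \<noteq> 0}" by eventually_elim simp
  have cont: "continuous_on ?D f"
    using f by (auto simp: bergman_functions_def intro!: holomorphic_several_on_continuous_on)
  have op: "open {z \<in> ?D. f z \<noteq> 0}"
  proof -
    have "{z \<in> ?D. f z \<noteq> 0} = ?D \<inter> f -` (- {0})" by auto
    then show ?thesis using continuous_open_preimage[OF cont open_unit_polydisc open_Compl[OF closed_singleton]] by (simp only:)
  qed
  then have "{z \<in> ?D. f z \<noteq> 0} \<in> null_sets lborel"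
    using ae AE_iff_null_sets[of "{z \<in> ?D. f z \<noteq> 0}" lborel] by simp
  then have "negligible {z \<in> ?D. f z \<noteq> 0}"
    unfolding negligible_iff_null_sets by (rule null_sets_completionI)
  then have "{z \<in> ?D. f z \<noteq> 0} = {}" using open_not_negligible[OF op] by blast
  then show ?thesis using f by (auto simp: bergman_functions_def)
qed

section \<open>The Bergman space as a real inner product space\<close>

text \<open>A type of its own, because bounded operators and \<open>coercive_form\<close> are built
  over type classes. It is made an inner product space only; completeness is not
  established.\<close>

typedef ('n::finite) bergman_space = "bergman_functions :: (complex ^ 'n \<Rightarrow> complex) set"
  using bergman_functions_zero by blast

abbreviation "bfun \<equiv> Rep_bergman_space"

lemma bfun_in [simp]: "bfun f \<in> bergman_functions"
  by (rule Rep_bergman_space)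

instantiation bergman_space :: (finite) real_inner
begin

definition "0 = Abs_bergman_space (\<lambda>z. 0)"
definition "f + g = Abs_bergman_space (\<lambda>z. bfun f z + bfun g z)"
definition "- f = Abs_bergman_space (\<lambda>z. - bfun f z)"
definition "f - g = (f + (- g) :: 'a bergman_space)"
definition "c *\<^sub>R f = Abs_bergman_space (\<lambda>z. c *\<^sub>R bfun f z)"
definition "inner f g = weighted_inner (\<lambda>z. 1) (bfun f) (bfun g)"
definition "norm (f :: 'a bergman_space) = sqrt (inner f f)"
definition "sgn (f :: 'a bergman_space) = inverse (norm f) *\<^sub>R f"
definition "dist f g = norm (f - g :: 'a bergman_space)"
definition "(uniformity :: ('a bergman_space \<times> 'a bergman_space) filter) =
  (INF e\<in>{0 <..}. principal {(f, g). dist f g < e})"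
definition "open (U :: 'a bergman_space set) \<longleftrightarrow>
  (\<forall>f\<in>U. eventually (\<lambda>(f', g). f' = f \<longrightarrow> g \<in> U) uniformity)"

lemma bfun_zero: "bfun 0 = (\<lambda>z. 0)"
  by (simp add: zero_bergman_space_def Abs_bergman_space_inverse bergman_functions_zero)

lemma bfun_add: "bfun (f + g) = (\<lambda>z. bfun f z + bfun g z)"
  by (simp add: plus_bergman_space_def Abs_bergman_space_inverse bergman_functions_add)

lemma bfun_uminus: "bfun (- f) = (\<lambda>z. - bfun f z)"
  by (simp add: uminus_bergman_space_def Abs_bergman_space_inverse bergman_functions_uminus)

lemma bfun_scaleR: "bfun (c *\<^sub>R f) = (\<lambda>z. c *\<^sub>R bfun f z)"
  by (simp add: scaleR_bergman_space_def Abs_bergman_space_inverse bergman_functions_scaleR)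

instance
proof
  fix f g h :: "'a bergman_space" and a b :: real
  note eqI = Rep_bergman_space_inject[THEN iffD1]
  show "f + g + h = f + (g + h)" by (rule eqI) (simp add: bfun_add algebra_simps)
  show "f + g = g + f" by (rule eqI) (simp add: bfun_add algebra_simps)
  show "0 + f = f" by (rule eqI) (simp add: bfun_add bfun_zero)
  show "- f + f = 0" by (rule eqI) (simp add: bfun_add bfun_zero bfun_uminus)
  show "f - g = f + - g" by (simp add: minus_bergman_space_def)
  show "a *\<^sub>R (f + g) = a *\<^sub>R f + a *\<^sub>R g" by (rule eqI) (simp add: bfun_add bfun_scaleR algebra_simps)
  show "(a + b) *\<^sub>R f = a *\<^sub>R f + b *\<^sub>R f" by (rule eqI) (simp add: bfun_add bfun_scaleR algebra_simps)
  show "a *\<^sub>R b *\<^sub>R f = (a * b) *\<^sub>R f" by (rule eqI) (simp add: bfun_scaleR)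
  show "1 *\<^sub>R f = f" by (rule eqI) (simp add: bfun_scaleR)
  show "dist f g = norm (f - g)" by (simp add: dist_bergman_space_def)
  show "sgn f = inverse (norm f) *\<^sub>R f" by (simp add: sgn_bergman_space_def)
  show "(uniformity :: ('a bergman_space \<times> 'a bergman_space) filter) = (INF e\<in>{0 <..}. principal {(f, g). dist f g < e})"
    by (rule uniformity_bergman_space_def)
  show "open U \<longleftrightarrow> (\<forall>f\<in>U. eventually (\<lambda>(f', g). f' = f \<longrightarrow> g \<in> U) uniformity)" for U :: "'a bergman_space set"
    by (rule open_bergman_space_def)
  show "inner f g = inner g f" by (simp add: inner_bergman_space_def weighted_inner_commute)
  have add: "inner f (g + h) = inner f g + inner f h" for f g h :: "'a bergman_space"
    by (simp add: inner_bergman_space_def bfun_add weighted_inner_add_right[OF bounded_weight_1])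
  have comm: "inner f g = inner g f" for f g :: "'a bergman_space"
    by (simp add: inner_bergman_space_def weighted_inner_commute)
  show "inner (f + g) h = inner f h + inner g h" using add[of h f g] by (simp add: comm)
  have "inner f (a *\<^sub>R g) = a * inner f g" for f g :: "'a bergman_space"
    by (simp add: inner_bergman_space_def bfun_scaleR weighted_inner_scaleR_right)
  from this[of g f] show "inner (a *\<^sub>R f) g = a * inner f g" by (simp add: comm)
  show "0 \<le> inner f f" by (simp add: inner_bergman_space_def weighted_inner_def)
  show "inner f f = 0 \<longleftrightarrow> f = 0"
  proof
    assume "inner f f = 0"
    then have "bfun f = (\<lambda>z. 0)" by (simp add: inner_bergman_space_def weighted_inner_self_eq_0)
    then show "f = 0" by (intro eqI) (simp add: bfun_zero)
  qed (simp add: inner_bergman_space_def weighted_inner_def bfun_zero)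
  show "norm f = sqrt (inner f f)" by (simp add: norm_bergman_space_def)
qed

end

lemma norm_bergman_space_power2: "(norm (f :: 'n::finite bergman_space))\<^sup>2 = (\<integral>z. (norm (bfun f z))\<^sup>2 \<partial>lborel)"
  by (simp only: power2_norm_eq_inner inner_bergman_space_def weighted_inner_def mult_1)

text \<open>The weight may change sign, so Cauchy-Schwarz for a positive form does not apply.
  Instead a pointwise arithmetic-geometric inequality is integrated, with s = |g| / |f| making its
  two terms equal.\<close>

lemma abs_weighted_inner_le:
  fixes f g :: "'n::finite bergman_space"
  assumes u: "bounded_weight u M"
  shows "\<bar>weighted_inner u (bfun f) (bfun g)\<bar> \<le> M * (norm f * norm g)"
proof (cases "f = 0 \<or> g = 0")
  case True
  then show ?thesis by (auto simp: weighted_inner_def bfun_zero)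
next
  case False
  define s where "s = norm g / norm f"
  have s: "s > 0" using False by (simp add: s_def)
  have int: "integrable lborel (\<lambda>z. (norm (bfun f z))\<^sup>2)" for f :: "'n bergman_space"
    using bfun_in[of f] by (simp add: bergman_functions_def)
  have pw: "norm (u z * inner (bfun f z) (bfun g z)) \<le> M * ((s * (norm (bfun f z))\<^sup>2 + (norm (bfun g z))\<^sup>2 / s) / 2)" for z
  proof (cases "z \<in> unit_polydisc")
    case True
    have "\<bar>inner (bfun f z) (bfun g z)\<bar> = \<bar>inner (sqrt s *\<^sub>R bfun f z) (bfun g z /\<^sub>R sqrt s)\<bar>"
      using s by (simp add: mult.assoc[symmetric])
    also have "\<dots> \<le> ((norm (sqrt s *\<^sub>R bfun f z))\<^sup>2 + (norm (bfun g z /\<^sub>R sqrt s))\<^sup>2) / 2"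
      by (rule abs_inner_le_norm_squares)
    also have "\<dots> = (s * (norm (bfun f z))\<^sup>2 + (norm (bfun g z))\<^sup>2 / s) / 2"
      using s by (simp add: power_mult_distrib field_simps)
    finally have "\<bar>inner (bfun f z) (bfun g z)\<bar> \<le> (s * (norm (bfun f z))\<^sup>2 + (norm (bfun g z))\<^sup>2 / s) / 2" .
    then show ?thesis using True u bounded_weight_nonneg[OF u]
      by (simp only: real_norm_def abs_mult) (rule mult_mono, auto simp: bounded_weight_def)
  next
    case False
    then show ?thesis using bfun_in[of f] bfun_in[of g] by (auto simp: bergman_functions_def)
  qed
  have "\<bar>weighted_inner u (bfun f) (bfun g)\<bar> \<le> (\<integral>z. norm (u z * inner (bfun f z) (bfun g z)) \<partial>lborel)"
    unfolding weighted_inner_def using integral_norm_bound[of lborel "\<lambda>z. u z * inner (bfun f z) (bfun g z)"] by simp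
  also have "\<dots> \<le> (\<integral>z. M * ((s * (norm (bfun f z))\<^sup>2 + (norm (bfun g z))\<^sup>2 / s) / 2) \<partial>lborel)"
    by (intro integral_mono integrable_norm weighted_inner_integrable[OF u] pw) (auto simp: int)
  also have "\<dots> = M * ((s * (norm f)\<^sup>2 + (norm g)\<^sup>2 / s) / 2)"
    unfolding norm_bergman_space_power2 using int[of f] int[of g] by simp
  also have "\<dots> = M * (norm f * norm g)"
    using False by (simp add: s_def power2_eq_square field_simps)
  finally show ?thesis .
qed

section \<open>Weights as bounded bilinear forms\<close>

definition weight_form ::
  "(complex ^ 'n::finite \<Rightarrow> real) \<Rightarrow> 'n bergman_space \<Rightarrow>\<^sub>L 'n bergman_space \<Rightarrow>\<^sub>L real" where
  "weight_form u = Blinfun (\<lambda>f. Blinfun (\<lambda>g. weighted_inner u (bfun f) (bfun g)))"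

lemma weight_form_apply:
  assumes u: "bounded_weight u M"
  shows "blinfun_apply (blinfun_apply (weight_form u) f) g = weighted_inner u (bfun f) (bfun g)"
proof -
  let ?w = "\<lambda>f g. weighted_inner u (bfun f) (bfun g)"
  interpret w: bounded_bilinear ?w
  proof
    have 1: "?w a (b + b') = ?w a b + ?w a b'" for a b b' 
      by (simp add: bfun_add weighted_inner_add_right[OF u])
    have 2: "?w a (r *\<^sub>R b) = r *\<^sub>R ?w a b" for a b r by (simp add: bfun_scaleR weighted_inner_scaleR_right)
    show "?w a (b + b') = ?w a b + ?w a b'" for a b b' by (rule 1)
    show "?w (a + a') b = ?w a b + ?w a' b" for a b a' using 1[of b a a'] by (simp add: weighted_inner_commute)
    show "?w a (r *\<^sub>R b) = r *\<^sub>R ?w a b" for a b r by (rule 2)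
    show "?w (r *\<^sub>R a) b = r *\<^sub>R ?w a b" for a b r using 2[of b r a] by (simp add: weighted_inner_commute)
    show "\<exists>K. \<forall>a b. norm (?w a b) \<le> norm a * norm b * K"
      using abs_weighted_inner_le[OF u] by (intro exI[of _ M]) (auto simp: mult_ac)
  qed
  have "(\<lambda>f. Blinfun (?w f)) = w.prod_right"
    by (auto simp: fun_eq_iff intro!: blinfun_eqI simp: bounded_linear_Blinfun_apply w.bounded_linear_right)
  then have "weight_form u = Blinfun w.prod_right" by (simp add: weight_form_def)
  then show ?thesis by (simp add: bounded_linear_Blinfun_apply w.bounded_linear_prod_right)
qed

text \<open>The operator norm is controlled by the sup norm of the weight alone; expansions of the
  form in t thereby reduce to expansions of the weight that are uniform in z.\<close>

lemma norm_weight_form_le: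
  assumes u: "bounded_weight u M"
  shows "norm (weight_form u) \<le> M"
proof (rule norm_blinfun_bound)
  show "0 \<le> M" by (rule bounded_weight_nonneg[OF u])
  fix f
  show "norm (blinfun_apply (weight_form u) f) \<le> M * norm f"
    using abs_weighted_inner_le[OF u] bounded_weight_nonneg[OF u]
    by (intro norm_blinfun_bound) (auto simp: weight_form_apply[OF u] mult.assoc)
qed

lemma bounded_weight_add:
  assumes "bounded_weight u M" "bounded_weight v N"
  shows "bounded_weight (\<lambda>z. u z + v z) (M + N)"
proof -
  have "(\<lambda>z. indicator unit_polydisc z * u z + indicator unit_polydisc z * v z) \<in> borel_measurable borel"
    using assms by (intro borel_measurable_add) (auto simp: bounded_weight_def)
  moreover have "\<bar>u z + v z\<bar> \<le> M + N" if "z \<in> unit_polydisc" for z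
    using assms that by (intro order_trans[OF abs_triangle_ineq add_mono]) (auto simp: bounded_weight_def)
  ultimately show ?thesis by (simp add: bounded_weight_def distrib_left)
qed

lemma bounded_weight_cmult:
  assumes "bounded_weight u M"
  shows "bounded_weight (\<lambda>z. c * u z) (\<bar>c\<bar> * M)"
  using assms borel_measurable_times[of "\<lambda>z. c" borel "\<lambda>z. indicator unit_polydisc z * u z"]
  by (auto simp: bounded_weight_def abs_mult mult.left_commute intro: mult_left_mono)

lemma weight_form_add:
  assumes "bounded_weight u M" "bounded_weight v N"
  shows "weight_form (\<lambda>z. u z + v z) = weight_form u + weight_form v"
proof (intro blinfun_eqI)
  fix f g :: "'a bergman_space"
  have "weighted_inner (\<lambda>z. u z + v z) (bfun f) (bfun g) = weighted_inner u (bfun f) (bfun g) + weighted_inner v (bfun f) (bfun g)"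
    unfolding weighted_inner_def
    using Bochner_Integration.integral_add[OF weighted_inner_integrable[OF assms(1), of "bfun f" "bfun g"] weighted_inner_integrable[OF assms(2), of "bfun f" "bfun g"]]
    by (simp add: distrib_right)
  then show "blinfun_apply (blinfun_apply (weight_form (\<lambda>z. u z + v z)) f) g = blinfun_apply (blinfun_apply (weight_form u + weight_form v) f) g"
    by (simp add: weight_form_apply[OF assms(1)] weight_form_apply[OF assms(2)] weight_form_apply[OF bounded_weight_add[OF assms]] blinfun.add_left)
qed

lemma weight_form_cmult:
  assumes "bounded_weight u M"
  shows "weight_form (\<lambda>z. c * u z) = c *\<^sub>R weight_form u"
proof (intro blinfun_eqI)
  fix f g :: "'a bergman_space"
  have "weighted_inner (\<lambda>z. c * u z) (bfun f) (bfun g) = c * weighted_inner u (bfun f) (bfun g)"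
    unfolding weighted_inner_def by (simp add: mult.assoc)
  then show "blinfun_apply (blinfun_apply (weight_form (\<lambda>z. c * u z)) f) g = blinfun_apply (blinfun_apply (c *\<^sub>R weight_form u) f) g"
    by (simp add: weight_form_apply[OF assms(1)] weight_form_apply[OF bounded_weight_cmult[OF assms]] blinfun.scaleR_left)
qed

lemma bounded_weight_sum:
  assumes "finite I" "\<And>i. i \<in> I \<Longrightarrow> bounded_weight (u i) (M i)"
  shows "bounded_weight (\<lambda>z. \<Sum>i\<in>I. u i z) (\<Sum>i\<in>I. M i)"
  using assms
proof (induction I rule: finite_induct)
  case empty
  then show ?case by (simp add: bounded_weight_def)
next
  case (insert i I)
  then show ?case using bounded_weight_add[of "u i" "M i" "\<lambda>z. \<Sum>i\<in>I. u i z"] by simp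
qed

lemma weight_form_sum:
  assumes "finite I" "\<And>i. i \<in> I \<Longrightarrow> bounded_weight (u i) (M i)"
  shows "weight_form (\<lambda>z. \<Sum>i\<in>I. u i z) = (\<Sum>i\<in>I. weight_form (u i))"
  using assms
proof (induction I rule: finite_induct)
  case empty
  have "weight_form (\<lambda>z. 0 * 1) = 0" unfolding weight_form_cmult[OF bounded_weight_1] by simp
  then show ?case by simp
next
  case (insert i I)
  then show ?case using weight_form_add[of "u i" "M i" "\<lambda>z. \<Sum>i\<in>I. u i z", OF _ bounded_weight_sum[of I u M]] by simp
qed

lemma bounded_weight_continuous:
  assumes "continuous_on unit_polydisc u" "\<And>z. z \<in> unit_polydisc \<Longrightarrow> \<bar>u z\<bar> \<le> M"
  shows "bounded_weight u M"
  using borel_measurable_continuous_on_indicator[OF unit_polydisc_borel assms(1)] assms(2)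
  by (simp add: bounded_weight_def)

section \<open>Smooth dependence of the weighted forms on the dilation\<close>

text \<open>A compact set that receives every dilated point \<open>coord_mult t z\<close> with t of
  norm below 1/2, so that continuous functions on the open polydisc are bounded and uniformly
  continuous where they are evaluated.\<close>

definition half_polydisc :: "(complex ^ 'n::finite) set" where
  "half_polydisc = {y. \<forall>i. norm (y $ i) \<le> 1 / 2}"

lemma norm_unit_polydisc_le:
  assumes "z \<in> unit_polydisc"
  shows "norm (z :: complex ^ 'n::finite) \<le> CARD('n)"
proof -
  have "norm z \<le> (\<Sum>i\<in>UNIV. norm (z $ i))" by (simp add: norm_vec_def L2_set_le_sum)
  also have "\<dots> \<le> (\<Sum>i\<in>(UNIV :: 'n set). 1)"
    using assms by (intro sum_mono) (auto simp: unit_polydisc_def less_imp_le)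
  finally show ?thesis by simp
qed

lemma half_polydisc_subset: "half_polydisc \<subseteq> unit_polydisc"
proof
  fix z :: "complex ^ 'n" assume z: "z \<in> half_polydisc"
  have "norm (z $ i) < 1" for i
  proof -
    have "norm (z $ i) \<le> 1 / 2" using z by (simp add: half_polydisc_def)
    then show ?thesis by simp
  qed
  then show "z \<in> unit_polydisc" by (simp add: unit_polydisc_def)
qed

lemma bounded_unit_polydisc: "bounded (unit_polydisc :: (complex ^ 'n::finite) set)"
  using norm_unit_polydisc_le bounded_iff by blast

lemma compact_half_polydisc: "compact (half_polydisc :: (complex ^ 'n::finite) set)"
proof -
  have "closed (half_polydisc :: (complex ^ 'n) set)"
    unfolding half_polydisc_def by (intro closed_Collect_all closed_Collect_le continuous_intros)
  then show ?thesis
    using bounded_subset[OF bounded_unit_polydisc half_polydisc_subset] compact_eq_bounded_closed by blast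
qed

lemma coord_mult_half_polydisc:
  assumes "t \<in> ball 0 (1/2)" "z \<in> unit_polydisc"
  shows "coord_mult t z \<in> half_polydisc"
proof -
  have "norm (t $ i * z $ i) \<le> 1 / 2" for i
  proof -
    have "norm (t $ i) \<le> 1 / 2" using assms(1) Finite_Cartesian_Product.norm_nth_le[of t i] by simp
    then have "norm (t $ i) * norm (z $ i) \<le> 1 / 2 * 1"
      using assms(2) by (intro mult_mono) (auto simp: unit_polydisc_def less_imp_le)
    then show ?thesis by (simp add: norm_mult)
  qed
  then show ?thesis by (simp add: half_polydisc_def)
qed

lemma coord_mult_unit_polydisc:
  assumes "t \<in> ball 0 (1/2)" "z \<in> unit_polydisc"
  shows "coord_mult t z \<in> unit_polydisc"
  using coord_mult_half_polydisc[OF assms] half_polydisc_subset by blast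

lemma continuous_on_coord_mult_compose:
  assumes "continuous_on unit_polydisc q" "t \<in> ball 0 (1/2)"
  shows "continuous_on unit_polydisc (\<lambda>z. q (coord_mult t z))"
  by (rule continuous_on_compose2[OF assms(1)])
    (auto intro!: coord_mult.continuous_on continuous_intros simp: coord_mult_unit_polydisc[OF assms(2)])

lemma bounded_on_half_polydisc:
  fixes q :: "complex ^ 'n::finite \<Rightarrow> real"
  assumes "continuous_on unit_polydisc q"
  obtains B where "B \<ge> 0" "\<And>y. y \<in> half_polydisc \<Longrightarrow> \<bar>q y\<bar> \<le> B"
proof -
  have "compact (q ` half_polydisc)"
    by (rule compact_continuous_image[OF continuous_on_subset[OF assms half_polydisc_subset] compact_half_polydisc])
  then obtain B where B: "\<And>y. y \<in> half_polydisc \<Longrightarrow> \<bar>q y\<bar> \<le> B"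
    using compact_imp_bounded bounded_iff by (metis image_eqI real_norm_def)
  show thesis by (rule that[of "max B 0"]) (use B in force)+
qed

lemma bounded_weight_dilate:
  fixes q :: "complex ^ 'n::finite \<Rightarrow> real"
  assumes q: "continuous_on unit_polydisc q" and t: "t \<in> ball 0 (1/2)"
    and p: "continuous_on unit_polydisc p" "\<And>z. z \<in> unit_polydisc \<Longrightarrow> \<bar>p z\<bar> \<le> P"
  shows "\<exists>M. bounded_weight (\<lambda>z. q (coord_mult t z) * p z) M"
proof -
  obtain B where B: "B \<ge> 0" "\<And>y. y \<in> half_polydisc \<Longrightarrow> \<bar>q y\<bar> \<le> B"
    using bounded_on_half_polydisc[OF q] by blast
  have "bounded_weight (\<lambda>z. q (coord_mult t z) * p z) (B * P)"
  proof (rule bounded_weight_continuous)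
    show "continuous_on unit_polydisc (\<lambda>z. q (coord_mult t z) * p z)"
      by (intro continuous_intros continuous_on_coord_mult_compose[OF q t] p)
    show "\<bar>q (coord_mult t z) * p z\<bar> \<le> B * P" if "z \<in> unit_polydisc" for z
      using B p(2)[OF that] coord_mult_half_polydisc[OF t that] by (simp add: abs_mult mult_mono)
  qed
  then show ?thesis by blast
qed

lemma bounded_weight_mono:
  assumes "bounded_weight u M" "\<And>z. z \<in> unit_polydisc \<Longrightarrow> \<bar>u z\<bar> \<le> N"
  shows "bounded_weight u N"
  using assms by (simp add: bounded_weight_def)

text \<open>Each t-derivative along v multiplies the fixed factor p by a real coordinate of
  \<open>coord_mult v z\<close>; the new factor is again continuous and bounded, which keeps the
  induction in \<open>Ck_on_weight_form\<close> running.\<close>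

lemma bounded_weight_direction:
  fixes p :: "complex ^ 'n::finite \<Rightarrow> real"
  assumes p: "continuous_on unit_polydisc p" "\<And>z. z \<in> unit_polydisc \<Longrightarrow> \<bar>p z\<bar> \<le> P"
  shows "continuous_on unit_polydisc (\<lambda>z. inner (coord_mult v z) b * p z)"
    and "z \<in> unit_polydisc \<Longrightarrow> \<bar>inner (coord_mult v z) b * p z\<bar> \<le> norm v * real CARD('n) * norm b * P"
proof -
  show "continuous_on unit_polydisc (\<lambda>z. inner (coord_mult v z) b * p z)"
    by (intro continuous_intros coord_mult.continuous_on p)
  assume z: "z \<in> unit_polydisc"
  have "\<bar>inner (coord_mult v z) b\<bar> \<le> norm (coord_mult v z) * norm b" by (rule Cauchy_Schwarz_ineq2)
  also have "\<dots> \<le> (norm v * real CARD('n)) * norm b"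
    using norm_unit_polydisc_le[OF z] by (intro mult_right_mono order_trans[OF norm_coord_mult_le] mult_left_mono) auto
  finally show "\<bar>inner (coord_mult v z) b * p z\<bar> \<le> norm v * real CARD('n) * norm b * P"
    unfolding abs_mult using p(2)[OF z] by (intro mult_mono) auto
qed

section \<open>Differentiating weighted forms in the dilation parameter\<close>

lemma frechet_derivative_gradient:
  fixes h :: "'a::euclidean_space \<Rightarrow> real"
  assumes "h differentiable (at y)"
  shows "frechet_derivative h (at y) x = (\<Sum>b\<in>Basis. frechet_derivative h (at y) b * inner x b)"
proof -
  interpret linear "frechet_derivative h (at y)"
    using assms by (rule linear_frechet_derivative)
  have "frechet_derivative h (at y) x = frechet_derivative h (at y) (\<Sum>b\<in>Basis. inner x b *\<^sub>R b)"
    by (simp add: euclidean_representation)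
  also have "\<dots> = (\<Sum>b\<in>Basis. frechet_derivative h (at y) b * inner x b)"
    by (simp add: sum scale mult.commute)
  finally show ?thesis .
qed

text \<open>The mean value theorem on the segment between the two dilated points, combined with
  uniform continuity of the gradient on the half polydisc, makes d independent of z.\<close>

lemma dilation_remainder:
  fixes h :: "complex ^ 'n::finite \<Rightarrow> real"
  assumes h: "Ck_on (Suc 0) unit_polydisc h" and t: "t \<in> ball 0 (1/2)" and "e > 0"
  obtains d where "d > 0" "\<And>t'. dist t' t < d \<Longrightarrow> t' \<in> ball 0 (1/2)"
    "\<And>t' z. dist t' t < d \<Longrightarrow> z \<in> unit_polydisc \<Longrightarrow>
      \<bar>h (coord_mult t' z) - h (coord_mult t z) - frechet_derivative h (at (coord_mult t z)) (coord_mult (t' - t) z)\<bar>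
        \<le> e * norm (t' - t)"
proof -
  let ?D = "unit_polydisc :: (complex ^ 'n) set"
  define R where "R = real CARD('n)"
  have R: "R > 0" by (simp add: R_def)
  \<comment> \<open>The gradient as a vector field: its uniform continuity handles all directions at
    once.\<close>
  define G where "G = (\<lambda>y. \<Sum>b\<in>Basis. frechet_derivative h (at y) b *\<^sub>R b)"
  have G: "frechet_derivative h (at y) x = inner (G y) x" if "y \<in> ?D" for x y
  proof -
    have "h differentiable (at y)" using h that by simp
    then show ?thesis
      by (subst frechet_derivative_gradient) (simp_all add: G_def inner_sum_right inner_commute[of _ x])
  qed
  have "continuous_on ?D G"
    unfolding G_def using h by (intro continuous_intros) auto
  then have "uniformly_continuous_on half_polydisc G"
    using compact_uniformly_continuous continuous_on_subset half_polydisc_subset compact_half_polydisc by blast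
  then obtain \<eta> where \<eta>: "\<eta> > 0" "\<And>y y'. y \<in> half_polydisc \<Longrightarrow> y' \<in> half_polydisc \<Longrightarrow> dist y' y < \<eta> \<Longrightarrow> dist (G y') (G y) < e / R"
    unfolding uniformly_continuous_on_def using \<open>e > 0\<close> R by (metis divide_pos_pos)
  \<comment> \<open>The first entry forces the dilated points within \<open>\<eta>\<close>, as
    points of the polydisc have norm at most R; the second keeps t' in the ball.\<close>
  define d where "d = min (\<eta> / R) (1/2 - norm t)"
  have d: "d > 0" using \<eta> R t by (simp add: d_def)
  have ball: "t' \<in> ball 0 (1/2)" if "dist t' t < d" for t'
    using that norm_triangle_ineq2[of t' t] by (simp add: d_def dist_norm)
  show thesis
  proof (rule that[OF d ball])
    fix t' z assume t': "dist t' t < d" and z: "z \<in> ?D"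
    let ?v = "coord_mult (t' - t) z"
    have nv: "norm ?v \<le> norm (t' - t) * R"
      using norm_unit_polydisc_le[OF z] by (intro order_trans[OF norm_coord_mult_le] mult_left_mono) (auto simp: R_def)
    have pt: "coord_mult t z + s *\<^sub>R ?v = coord_mult (t + s *\<^sub>R (t' - t)) z" for s
      by (simp add: coord_mult.add_left coord_mult.scaleR_left)
    have tin: "t + s *\<^sub>R (t' - t) \<in> ball 0 (1/2)" if "0 \<le> s" "s \<le> 1" for s
    proof -
      have "(1 - s) *\<^sub>R t + s *\<^sub>R t' \<in> ball 0 (1/2)"
        using that by (intro convexD[OF convex_ball t ball[OF t']]) auto
      then show ?thesis by (simp add: algebra_simps)
    qed
    have seg: "coord_mult t z + s *\<^sub>R ?v \<in> half_polydisc" if "0 \<le> s" "s \<le> 1" for s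
      unfolding pt by (rule coord_mult_half_polydisc[OF tin[OF that] z])
    have "\<exists>s>0. s < 1 \<and> h (coord_mult t z + 1 *\<^sub>R ?v) - h (coord_mult t z + 0 *\<^sub>R ?v) =
        (1 - 0) * frechet_derivative h (at (coord_mult t z + s *\<^sub>R ?v)) ?v"
      by (rule MVT2[OF zero_less_one]) (use seg half_polydisc_subset in \<open>blast intro: Ck_on_DERIV_line[OF h]\<close>)
    then obtain s where s: "0 < s" "s < 1" "h (coord_mult t z + 1 *\<^sub>R ?v) - h (coord_mult t z + 0 *\<^sub>R ?v) =
        (1 - 0) * frechet_derivative h (at (coord_mult t z + s *\<^sub>R ?v)) ?v" by blast
    let ?y = "coord_mult t z" and ?y' = "coord_mult t z + s *\<^sub>R ?v"
    have y: "?y \<in> half_polydisc" "?y' \<in> half_polydisc" using seg[of 0] seg[of s] s by auto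
    have eq: "h (coord_mult t' z) - h ?y = inner (G ?y') ?v"
      using s(3) G[of ?y' ?v] y half_polydisc_subset by (auto simp: coord_mult.diff_left)
    have "dist ?y' ?y = s * norm ?v" using s by (simp add: dist_norm)
    also have "\<dots> \<le> norm ?v" using s by (simp add: mult_left_le_one_le)
    also have "\<dots> < \<eta>" using nv t' R by (simp add: d_def dist_norm field_simps)
    finally have "norm (G ?y' - G ?y) < e / R" using \<eta>(2)[OF y] by (simp add: dist_norm)
    have "\<bar>h (coord_mult t' z) - h ?y - frechet_derivative h (at ?y) ?v\<bar> = \<bar>inner (G ?y' - G ?y) ?v\<bar>"
      using eq G[of ?y ?v] y half_polydisc_subset by (auto simp: inner_diff_left)
    also have "\<dots> \<le> norm (G ?y' - G ?y) * norm ?v" by (rule Cauchy_Schwarz_ineq2)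
    also have "\<dots> \<le> e / R * (norm (t' - t) * R)"
      using \<open>norm (G ?y' - G ?y) < e / R\<close> nv \<open>e > 0\<close> R by (intro mult_mono) auto
    also have "\<dots> = e * norm (t' - t)" using R by simp
    finally show "\<bar>h (coord_mult t' z) - h ?y - frechet_derivative h (at ?y) ?v\<bar> \<le> e * norm (t' - t)" .
  qed
qed

text \<open>Expanding over \<open>Basis\<close> separates the point, in a partial derivative of h,
  from the direction, in a factor free of t. Each summand then has the shape of the original weight,
  ready to be differentiated again.\<close>

lemma weight_form_has_derivative:
  fixes h :: "complex ^ 'n::finite \<Rightarrow> real"
  assumes h: "Ck_on (Suc 0) unit_polydisc h" and t: "t \<in> ball 0 (1/2)"
    and p: "continuous_on unit_polydisc p" "\<And>z. z \<in> unit_polydisc \<Longrightarrow> \<bar>p z\<bar> \<le> P"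
  shows "((\<lambda>t. weight_form (\<lambda>z. h (coord_mult t z) * p z)) has_derivative
     (\<lambda>v. \<Sum>b\<in>Basis. weight_form (\<lambda>z. frechet_derivative h (at (coord_mult t z)) b * (inner (coord_mult v z) b * p z)))) (at t)"
  unfolding has_derivative_at_alt
proof (intro conjI allI impI)
  let ?D = "unit_polydisc :: (complex ^ 'n) set"
  let ?w = "\<lambda>v b z. frechet_derivative h (at (coord_mult t z)) b * (inner (coord_mult v z) b * p z)"
  have Db: "continuous_on ?D (\<lambda>y. frechet_derivative h (at y) b)" for b using h by simp
  have hc: "continuous_on ?D h" by (rule Ck_on_imp_continuous_on[OF h])
  have ex: "\<exists>M. bounded_weight (?w v b) M" for v b
    by (rule bounded_weight_dilate[OF Db t bounded_weight_direction(1)[OF p] bounded_weight_direction(2)[OF p]])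
  \<comment> \<open>Only the existence of these bounds matters: they license additivity and
    homogeneity of \<open>weight_form\<close>.\<close>
  define M where "M = (\<lambda>v b. SOME m. bounded_weight (?w v b) m)"
  have M: "bounded_weight (?w v b) (M v b)" for v b unfolding M_def by (rule someI_ex[OF ex])
  have "linear (\<lambda>v. \<Sum>b\<in>Basis. weight_form (?w v b))"
  proof (intro linear_compose_sum ballI linearI)
    fix b v v' :: "complex ^ 'n" and r :: real
    have "?w (v + v') b = (\<lambda>z. ?w v b z + ?w v' b z)"
      by (auto simp: coord_mult.add_left inner_add_left algebra_simps)
    then show "weight_form (?w (v + v') b) = weight_form (?w v b) + weight_form (?w v' b)"
      using weight_form_add[OF M M] by (simp only:)
    have "?w (r *\<^sub>R v) b = (\<lambda>z. r * ?w v b z)"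
      by (auto simp: coord_mult.scaleR_left algebra_simps)
    then show "weight_form (?w (r *\<^sub>R v) b) = r *\<^sub>R weight_form (?w v b)"
      using weight_form_cmult[OF M] by (simp only:)
  qed
  then show "bounded_linear (\<lambda>v. \<Sum>b\<in>Basis. weight_form (?w v b))"
    by (simp add: linear_conv_bounded_linear)
  fix e :: real assume "e > 0"
  have P: "P \<ge> 0" using p(2)[OF zero_in_unit_polydisc] abs_ge_zero order_trans by blast
  \<comment> \<open>The 1 guards against P = 0.\<close>
  then have "e / (P + 1) > 0" using \<open>e > 0\<close> by simp
  from dilation_remainder[OF h t this] obtain d where d: "d > 0" "\<And>t'. dist t' t < d \<Longrightarrow> t' \<in> ball 0 (1/2)"
    "\<And>t' z. dist t' t < d \<Longrightarrow> z \<in> ?D \<Longrightarrow>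
      \<bar>h (coord_mult t' z) - h (coord_mult t z) - frechet_derivative h (at (coord_mult t z)) (coord_mult (t' - t) z)\<bar>
        \<le> e / (P + 1) * norm (t' - t)" by blast
  show "\<exists>d>0. \<forall>t'. norm (t' - t) < d \<longrightarrow> norm (weight_form (\<lambda>z. h (coord_mult t' z) * p z) -
        weight_form (\<lambda>z. h (coord_mult t z) * p z) - (\<Sum>b\<in>Basis. weight_form (?w (t' - t) b))) \<le> e * norm (t' - t)"
  proof (intro exI conjI allI impI, rule d(1))
    fix t' assume "norm (t' - t) < d"
    then have t': "dist t' t < d" by (simp add: dist_norm)
    let ?h = "\<lambda>t z. h (coord_mult t z) * p z" and ?S = "\<lambda>z. \<Sum>b\<in>Basis. ?w (t' - t) b z"
    obtain N where N: "bounded_weight (?h t) N" using bounded_weight_dilate[OF hc t p] by blast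
    obtain N' where N': "bounded_weight (?h t') N'" using bounded_weight_dilate[OF hc d(2)[OF t'] p] by blast
    have S: "bounded_weight ?S (\<Sum>b\<in>Basis. M (t' - t) b)" by (rule bounded_weight_sum) (auto intro: M)
    \<comment> \<open>The remainder as a single weight. The crude bound \<open>r1\<close> supplies
      its measurability; the sharp one from \<open>dilation_remainder\<close> controls the operator
      norm.\<close>
    define r where "r = (\<lambda>z. ?h t' z + ((-1) * ?h t z + (-1) * ?S z))"
    have r1: "bounded_weight r (N' + (\<bar>-1\<bar> * N + \<bar>-1\<bar> * (\<Sum>b\<in>Basis. M (t' - t) b)))"
      unfolding r_def by (intro bounded_weight_add bounded_weight_cmult N N' S)
    have wr: "weight_form r = weight_form (?h t') - weight_form (?h t) - (\<Sum>b\<in>Basis. weight_form (?w (t' - t) b))"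
      unfolding r_def
      by (simp only: weight_form_add[OF N' bounded_weight_add[OF bounded_weight_cmult[OF N] bounded_weight_cmult[OF S]]]
          weight_form_add[OF bounded_weight_cmult[OF N] bounded_weight_cmult[OF S]] weight_form_cmult[OF N] weight_form_cmult[OF S]
          weight_form_sum[OF finite_Basis M]) simp
    have "\<bar>r z\<bar> \<le> e * norm (t' - t)" if z: "z \<in> ?D" for z
    proof -
      have y: "h differentiable (at (coord_mult t z))"
        using h coord_mult_unit_polydisc[OF t z] by simp
      have "r z = (h (coord_mult t' z) - h (coord_mult t z) - frechet_derivative h (at (coord_mult t z)) (coord_mult (t' - t) z)) * p z"
        unfolding r_def frechet_derivative_gradient[OF y, of "coord_mult (t' - t) z"]
        by (simp add: algebra_simps sum_distrib_left sum_negf)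
      then have "\<bar>r z\<bar> \<le> (e / (P + 1) * norm (t' - t)) * P"
        using d(3)[OF t' z] p(2)[OF z] \<open>e > 0\<close> P by (simp only: abs_mult) (intro mult_mono, auto)
      also have "\<dots> = (e * norm (t' - t)) * (P / (P + 1))" by simp
      also have "\<dots> \<le> (e * norm (t' - t)) * 1" using P \<open>e > 0\<close> by (intro mult_left_mono) auto
      finally show ?thesis by simp
    qed
    from norm_weight_form_le[OF bounded_weight_mono[OF r1 this]]
    show "norm (weight_form (?h t') - weight_form (?h t) - (\<Sum>b\<in>Basis. weight_form (?w (t' - t) b))) \<le> e * norm (t' - t)"
      by (simp add: wr)
  qed
qed

text \<open>The factor p is there for the induction, since differentiation changes it; the
  application has p = 1. Full smoothness of h is inherited by its partial derivatives.\<close>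

lemma Ck_on_weight_form:
  fixes h :: "complex ^ 'n::finite \<Rightarrow> real"
  assumes h: "smooth_on unit_polydisc h"
    and p: "continuous_on unit_polydisc p" "\<And>z. z \<in> unit_polydisc \<Longrightarrow> \<bar>p z\<bar> \<le> P"
  shows "Ck_on k (ball 0 (1/2)) (\<lambda>t. weight_form (\<lambda>z. h (coord_mult t z) * p z))"
  using assms
proof (induction k arbitrary: h p P)
  case 0
  have h: "Ck_on (Suc 0) unit_polydisc h" using 0(1) unfolding smooth_on_def by blast
  show ?case
    using has_derivative_continuous[OF weight_form_has_derivative[OF h _ 0(2,3)]]
    by (auto intro!: continuous_at_imp_continuous_on)
next
  case (Suc k)
  have h: "Ck_on k unit_polydisc h" for k using Suc.prems(1) unfolding smooth_on_def by blast
  show ?case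
  proof (rule Ck_on_SucI[OF open_ball weight_form_has_derivative[OF h _ Suc.prems(2,3)]])
    fix v :: "complex ^ 'n"
    have "Ck_on k (ball 0 (1/2)) (\<lambda>t. weight_form (\<lambda>z. frechet_derivative h (at (coord_mult t z)) b * (inner (coord_mult v z) b * p z)))" for b
    proof (rule Suc.IH)
      show "smooth_on unit_polydisc (\<lambda>y. frechet_derivative h (at y) b)"
        unfolding smooth_on_def using h Ck_on_frechet_derivative by blast
      show "continuous_on unit_polydisc (\<lambda>z. inner (coord_mult v z) b * p z)"
        by (rule bounded_weight_direction(1)[OF Suc.prems(2,3)])
      show "\<bar>inner (coord_mult v z) b * p z\<bar> \<le> norm v * real CARD('n) * norm b * P" if "z \<in> unit_polydisc" for z
        by (rule bounded_weight_direction(2)[OF Suc.prems(2,3) that])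
    qed
    then show "Ck_on k (ball 0 (1/2)) (\<lambda>t. \<Sum>b\<in>Basis. weight_form (\<lambda>z. frechet_derivative h (at (coord_mult t z)) b * (inner (coord_mult v z) b * p z)))"
      by (intro Ck_on_sum open_ball)
  qed
qed

section \<open>The Bergman kernel at the origin\<close>

lemma emeasure_unit_polydisc:
  shows "emeasure lborel (unit_polydisc :: (complex ^ 'n::finite) set) = ennreal (measure lborel (unit_polydisc :: (complex ^ 'n) set))"
    and "0 < measure lborel (unit_polydisc :: (complex ^ 'n) set)"
proof -
  let ?D = "unit_polydisc :: (complex ^ 'n) set"
  have fin: "emeasure lborel ?D < \<infinity>" by (rule emeasure_bounded_finite[OF bounded_unit_polydisc])
  then show e: "emeasure lborel ?D = ennreal (measure lborel ?D)" by (simp add: emeasure_eq_ennreal_measure less_top)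
  have "?D \<notin> null_sets lborel"
  proof
    assume "?D \<in> null_sets lborel"
    then have "negligible ?D" unfolding negligible_iff_null_sets by (rule null_sets_completionI)
    then show False using open_not_negligible[OF open_unit_polydisc] zero_in_unit_polydisc by blast
  qed
  then have "emeasure lborel ?D \<noteq> 0" by (simp add: null_sets_def)
  then show "0 < measure lborel ?D" using e measure_nonneg[of lborel ?D] by (simp add: less_le)
qed

lemma nn_integral_bergman_functions:
  assumes f: "f \<in> bergman_functions" and u: "bounded_weight u M" and nn: "\<And>z. z \<in> unit_polydisc \<Longrightarrow> 0 \<le> u z"
  shows "(\<integral>\<^sup>+z\<in>unit_polydisc. ennreal ((norm (f z))\<^sup>2 * u z) \<partial>lborel) = ennreal (weighted_inner u f f)"
proof -
  have z: "f z = 0" if "z \<notin> unit_polydisc" for z using f that by (simp add: bergman_functions_def)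
  have "(\<integral>\<^sup>+z\<in>unit_polydisc. ennreal ((norm (f z))\<^sup>2 * u z) \<partial>lborel) = (\<integral>\<^sup>+z. ennreal (u z * inner (f z) (f z)) \<partial>lborel)"
    by (intro nn_integral_cong) (auto simp: indicator_def z dot_square_norm mult.commute)
  also have "\<dots> = ennreal (weighted_inner u f f)"
    unfolding weighted_inner_def
  proof (rule nn_integral_eq_integral[OF weighted_inner_integrable[OF u f f]])
    have "0 \<le> u z * inner (f z) (f z)" for z by (cases "z \<in> unit_polydisc") (auto simp: z nn)
    then show "AE z in lborel. 0 \<le> u z * inner (f z) (f z)" by simp
  qed
  finally show ?thesis .
qed

text \<open>The sub-mean value property with constant weight; it makes evaluation at 0 a bounded
  functional.\<close>

lemma bergman_point_evaluation:
  fixes f :: "complex ^ 'n::finite \<Rightarrow> complex"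
  assumes f: "f \<in> bergman_functions"
  shows "(norm (f 0))\<^sup>2 * measure lborel (unit_polydisc :: (complex ^ 'n) set) \<le> weighted_inner (\<lambda>z. 1) f f"
proof -
  let ?D = "unit_polydisc :: (complex ^ 'n) set"
  have "ennreal ((norm (f 0))\<^sup>2) * (\<integral>\<^sup>+z\<in>?D. 1 \<partial>lborel) \<le> (\<integral>\<^sup>+z\<in>?D. ennreal ((norm (f z))\<^sup>2) * 1 \<partial>lborel)"
    using f by (intro polydisc_submean) (auto simp: bergman_functions_def)
  then have "ennreal ((norm (f 0))\<^sup>2) * ennreal (measure lborel ?D) \<le> ennreal (weighted_inner (\<lambda>z. 1) f f)"
    using nn_integral_bergman_functions[OF f bounded_weight_1] emeasure_unit_polydisc(1)[where 'n='n] by simp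
  moreover have "0 \<le> weighted_inner (\<lambda>z. 1) f f" by (simp add: weighted_inner_def)
  ultimately show ?thesis by (simp add: ennreal_mult[symmetric])
qed

text \<open>The real part suits a real space; \<open>admissible_bergman_space\<close> shows that the
  modulus of f 0 is recovered by a rotation of f.\<close>

definition real_point_evaluation :: "'n::finite bergman_space \<Rightarrow>\<^sub>L real" where
  "real_point_evaluation = Blinfun (\<lambda>f. Re (bfun f 0))"

lemma real_point_evaluation_apply: "blinfun_apply real_point_evaluation f = Re (bfun (f :: 'n::finite bergman_space) 0)"
proof -
  define V where "V = measure lborel (unit_polydisc :: (complex ^ 'n) set)"
  have V: "V > 0" unfolding V_def by (rule emeasure_unit_polydisc)
  have "bounded_linear (\<lambda>f :: 'n bergman_space. Re (bfun f 0))"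
  proof (rule bounded_linear_intro)
    fix f :: "'n bergman_space"
    have "(norm (bfun f 0))\<^sup>2 * V \<le> (norm f)\<^sup>2"
      using bergman_point_evaluation[of "bfun f"] unfolding V_def power2_norm_eq_inner inner_bergman_space_def by simp
    then have "(norm (bfun f 0))\<^sup>2 \<le> (norm f * (1 / sqrt V))\<^sup>2"
      using V by (simp add: power_mult_distrib power_divide field_simps)
    then have "norm (bfun f 0) \<le> norm f * (1 / sqrt V)"
      by (rule power2_le_imp_le) (use V in simp)
    then show "norm (Re (bfun f 0)) \<le> norm f * (1 / sqrt V)"
      using abs_Re_le_cmod[of "bfun f 0"] by simp
  qed (auto simp: bfun_add bfun_scaleR)
  then show ?thesis by (simp add: real_point_evaluation_def bounded_linear_Blinfun_apply)
qed

lemma coercive_weight_form: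
  fixes u :: "complex ^ 'n::finite \<Rightarrow> real"
  assumes u: "bounded_weight u M" and m: "0 < m" "\<And>z. z \<in> unit_polydisc \<Longrightarrow> m \<le> u z"
  shows "coercive_form (weight_form u) m"
proof
  fix f g :: "'n bergman_space"
  show "blinfun_apply (blinfun_apply (weight_form u) f) g = blinfun_apply (blinfun_apply (weight_form u) g) f"
    by (simp add: weight_form_apply[OF u] weighted_inner_commute)
  have "m * (norm f)\<^sup>2 = (\<integral>z. m * (norm (bfun f z))\<^sup>2 \<partial>lborel)" by (simp add: norm_bergman_space_power2)
  also have "\<dots> \<le> (\<integral>z. u z * inner (bfun f z) (bfun f z) \<partial>lborel)"
  proof (rule integral_mono)
    show "integrable lborel (\<lambda>z. m * (norm (bfun f z))\<^sup>2)"
      using bfun_in[of f] by (simp add: bergman_functions_def)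
    show "integrable lborel (\<lambda>z. u z * inner (bfun f z) (bfun f z))" by (rule weighted_inner_integrable[OF u]) auto
    show "m * (norm (bfun f z))\<^sup>2 \<le> u z * inner (bfun f z) (bfun f z)" for z
      using m(2)[of z] bfun_in[of f] by (cases "z \<in> unit_polydisc") (auto simp: bergman_functions_def dot_square_norm mult_right_mono)
  qed
  finally show "m * (norm f)\<^sup>2 \<le> blinfun_apply (blinfun_apply (weight_form u) f) f"
    by (simp add: weight_form_apply[OF u] weighted_inner_def)
qed (rule m)

section \<open>The kernel as a supremum over the Bergman space\<close>

text \<open>The competitors of \<open>bergman_kernel\<close>; unlike members of
  \<open>bergman_functions\<close>, they are arbitrary off the polydisc.\<close>

definition admissible :: "(complex ^ 'n::finite \<Rightarrow> real) \<Rightarrow> (complex ^ 'n \<Rightarrow> complex) \<Rightarrow> bool" where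
  "admissible u f \<longleftrightarrow> holomorphic_several_on unit_polydisc f \<and>
     (\<integral>\<^sup>+w\<in>unit_polydisc. ennreal ((norm (f w))\<^sup>2 * exp (- u w)) \<partial>lborel) \<le> 1"

lemma bergman_kernel_admissible:
  "bergman_kernel u unit_polydisc 0 = (SUP f\<in>Collect (admissible u). (norm (f 0))\<^sup>2)"
  unfolding bergman_kernel_def admissible_def by (intro arg_cong[of _ _ Sup]) auto

lemma admissible_zero: "admissible u (\<lambda>z. 0)"
  by (simp add: admissible_def holomorphic_several_on_const)

text \<open>The competitor is cut off outside the polydisc and rotated. The lower bound m on the
  weight makes it square integrable without weight, hence a member of the Bergman space.\<close>

lemma admissible_bergman_space:
  fixes u :: "complex ^ 'n::finite \<Rightarrow> real"
  assumes u: "bounded_weight (\<lambda>z. exp (- u z)) M" and m: "0 < m" "\<And>z. z \<in> unit_polydisc \<Longrightarrow> m \<le> exp (- u z)"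
    and f: "admissible u f"
  obtains F where "weight_form (\<lambda>z. exp (- u z)) F F \<le> 1" "(real_point_evaluation F)\<^sup>2 = (norm (f 0))\<^sup>2"
proof -
  let ?D = "unit_polydisc :: (complex ^ 'n) set"
  \<comment> \<open>Unimodular, with the value of \<open>\<alpha> * f\<close> at 0 real and
    nonnegative, so its real part is the modulus of f 0.\<close>
  define \<alpha> where "\<alpha> = (if f 0 = 0 then 1 else cnj (f 0) / of_real (norm (f 0)))"
  have \<alpha>: "norm \<alpha> = 1" by (simp add: \<alpha>_def norm_divide)
  have \<alpha>0: "\<alpha> * f 0 = of_real (norm (f 0))"
  proof (cases "f 0 = 0")
    case False
    have "cnj (f 0) * f 0 = of_real (norm (f 0)) * of_real (norm (f 0))"
      using complex_norm_square[of "f 0"] by (simp add: mult.commute power2_eq_square)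
    then show ?thesis using False by (simp add: \<alpha>_def field_simps)
  qed simp
  define g where "g = (\<lambda>z. if z \<in> ?D then \<alpha> * f z else 0)"
  have g0: "g 0 = of_real (norm (f 0))" by (simp add: g_def \<alpha>0)
  have hol: "holomorphic_several_on ?D g"
  proof (rule holomorphic_several_on_cong[OF open_unit_polydisc])
    have "holomorphic_several_on ?D f" using f by (simp add: admissible_def)
    then show "holomorphic_several_on ?D (\<lambda>z. \<alpha> * f z)"
      by (rule holomorphic_several_on_mult[OF holomorphic_several_on_const])
  qed (simp add: g_def)
  have [measurable]: "g \<in> borel_measurable borel"
    by (rule holomorphic_several_on_borel_measurable[OF hol]) (simp add: g_def)
  have "(\<integral>\<^sup>+z. ennreal m * ennreal ((norm (g z))\<^sup>2) \<partial>lborel) \<le> (\<integral>\<^sup>+z\<in>?D. ennreal ((norm (f z))\<^sup>2 * exp (- u z)) \<partial>lborel)"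
  proof (rule nn_integral_mono)
    fix z
    show "ennreal m * ennreal ((norm (g z))\<^sup>2) \<le> ennreal ((norm (f z))\<^sup>2 * exp (- u z)) * indicator ?D z"
    proof (cases "z \<in> ?D")
      case True
      have "m * (norm (f z))\<^sup>2 \<le> (norm (f z))\<^sup>2 * exp (- u z)"
        using m(2)[OF True] mult_right_mono[of m "exp (- u z)" "(norm (f z))\<^sup>2"] by (simp add: mult.commute)
      then show ?thesis using True m(1) by (simp add: g_def norm_mult \<alpha> ennreal_mult[symmetric] ennreal_leI)
    qed (simp add: g_def)
  qed
  also have "\<dots> \<le> 1" using f by (simp add: admissible_def)
  finally have le1: "ennreal m * (\<integral>\<^sup>+z. ennreal ((norm (g z))\<^sup>2) \<partial>lborel) \<le> 1"
    by (subst nn_integral_cmult[symmetric]) auto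
  have fin: "(\<integral>\<^sup>+z. ennreal ((norm (g z))\<^sup>2) \<partial>lborel) < \<infinity>"
  proof (rule ccontr)
    assume "\<not> ?thesis"
    then have "(\<integral>\<^sup>+z. ennreal ((norm (g z))\<^sup>2) \<partial>lborel) = \<infinity>" by (simp add: less_top[symmetric])
    then show False using le1 m(1) by (simp add: ennreal_mult_top top_unique)
  qed
  have "integrable lborel (\<lambda>z. (norm (g z))\<^sup>2)"
    using fin by (intro integrableI_bounded) auto
  then have gb: "g \<in> bergman_functions" using hol by (simp add: bergman_functions_def g_def)
  define F where "F = Abs_bergman_space g"
  have F: "bfun F = g" using gb by (simp add: F_def Abs_bergman_space_inverse)
  have "ennreal (weighted_inner (\<lambda>z. exp (- u z)) g g) = (\<integral>\<^sup>+z\<in>?D. ennreal ((norm (g z))\<^sup>2 * exp (- u z)) \<partial>lborel)"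
    using nn_integral_bergman_functions[OF gb u] by simp
  also have "\<dots> = (\<integral>\<^sup>+z\<in>?D. ennreal ((norm (f z))\<^sup>2 * exp (- u z)) \<partial>lborel)"
    by (intro nn_integral_cong) (auto simp: g_def norm_mult \<alpha> indicator_def)
  also have "\<dots> \<le> 1" using f by (simp add: admissible_def)
  finally have "weighted_inner (\<lambda>z. exp (- u z)) g g \<le> 1" by simp
  then show thesis
    by (intro that[of F]) (simp_all add: weight_form_apply[OF u] F real_point_evaluation_apply g0)
qed

text \<open>Rotated competitors realise every value of the first set in the second; conversely the
  real part never exceeds the modulus, so each value of the second set is dominated in the
  first.\<close>

lemma bergman_kernel_eq_SUP:
  fixes u :: "complex ^ 'n::finite \<Rightarrow> real"
  assumes u: "bounded_weight (\<lambda>z. exp (- u z)) M" and m: "0 < m" "\<And>z. z \<in> unit_polydisc \<Longrightarrow> m \<le> exp (- u z)"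
  shows "bergman_kernel u unit_polydisc 0 =
      (SUP f\<in>{f. weight_form (\<lambda>z. exp (- u z)) f f \<le> 1}. (real_point_evaluation f)\<^sup>2)" (is "_ = Sup ?B")
    and "bdd_above ((\<lambda>f. (norm (f 0))\<^sup>2) ` Collect (admissible u))"
proof -
  let ?A = "(\<lambda>f. (norm (f 0))\<^sup>2) ` Collect (admissible u)"
  interpret coercive_form "weight_form (\<lambda>z. exp (- u z))" m by (rule coercive_weight_form[OF u m])
  obtain R :: "('n bergman_space \<Rightarrow>\<^sub>L real) \<Rightarrow>\<^sub>L (('n bergman_space \<Rightarrow>\<^sub>L real) \<Rightarrow>\<^sub>L real)"
    where R: "\<And>l. blinfun_apply R l o\<^sub>L weight_form (\<lambda>z. exp (- u z)) = l"
      "\<And>\<xi>. blinfun_apply R (\<xi> o\<^sub>L weight_form (\<lambda>z. exp (- u z))) = \<xi>" "norm R \<le> 1 / m"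
    by (rule transpose_inverse, rule that)
  have bdd: "bdd_above ?B" by (rule Sup_eq_bidual(2)[OF R(1)])
  have AB: "?A \<subseteq> ?B"
  proof
    fix a assume "a \<in> ?A"
    then obtain f where f: "admissible u f" "a = (norm (f 0))\<^sup>2" by blast
    obtain F where "weight_form (\<lambda>z. exp (- u z)) F F \<le> 1" "(real_point_evaluation F)\<^sup>2 = (norm (f 0))\<^sup>2"
      using admissible_bergman_space[OF u m f(1)] by blast
    then show "a \<in> ?B" unfolding f(2) by (intro image_eqI[of _ _ F]) auto
  qed
  then show bA: "bdd_above ?A" by (rule bdd_above_mono[OF bdd])
  have BA: "\<exists>a\<in>?A. b \<le> a" if "b \<in> ?B" for b
  proof -
    obtain F :: "'n bergman_space" where F: "weight_form (\<lambda>z. exp (- u z)) F F \<le> 1" "b = (real_point_evaluation F)\<^sup>2"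
      using \<open>b \<in> ?B\<close> by auto
    have "admissible u (bfun F)"
      using F(1) nn_integral_bergman_functions[OF bfun_in[of F] u] bfun_in[of F]
      by (simp add: admissible_def weight_form_apply[OF u] bergman_functions_def)
    moreover have "b \<le> (norm (bfun F 0))\<^sup>2"
      unfolding F(2) real_point_evaluation_apply using abs_Re_le_cmod[of "bfun F 0"]
      using power_mono[of "\<bar>Re (bfun F 0)\<bar>" "norm (bfun F 0)" 2] by simp
    ultimately show ?thesis by auto
  qed
  have "Sup ?A = Sup ?B"
  proof (rule antisym)
    have neA: "?A \<noteq> {}" using admissible_zero by blast
    then show "Sup ?A \<le> Sup ?B" using AB bdd by (intro cSup_subset_mono)
    show "Sup ?B \<le> Sup ?A" using neA AB BA bA by (intro cSup_mono) auto
  qed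
  then show "bergman_kernel u unit_polydisc 0 = Sup ?B" by (simp add: bergman_kernel_admissible)
qed

lemma bergman_kernel_lower:
  fixes u :: "complex ^ 'n::finite \<Rightarrow> real"
  assumes u: "bounded_weight (\<lambda>z. exp (- u z)) M" and m: "0 < m" "\<And>z. z \<in> unit_polydisc \<Longrightarrow> m \<le> exp (- u z)"
    and "admissible u f"
  shows "(norm (f 0))\<^sup>2 \<le> bergman_kernel u unit_polydisc 0"
  unfolding bergman_kernel_admissible
  using assms(4) by (intro cSUP_upper[OF _ bergman_kernel_eq_SUP(2)[OF u m]]) auto

lemma bergman_kernel_upper:
  assumes "\<And>f. admissible u f \<Longrightarrow> (norm (f 0))\<^sup>2 \<le> C"
  shows "bergman_kernel u unit_polydisc 0 \<le> C"
  unfolding bergman_kernel_admissible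
  using assms admissible_zero by (intro cSUP_least) auto

lemma bergman_kernel_pos:
  fixes u :: "complex ^ 'n::finite \<Rightarrow> real"
  assumes u: "bounded_weight (\<lambda>z. exp (- u z)) M" and m: "0 < m" "\<And>z. z \<in> unit_polydisc \<Longrightarrow> m \<le> exp (- u z)"
  shows "0 < bergman_kernel u unit_polydisc 0"
proof -
  let ?D = "unit_polydisc :: (complex ^ 'n) set"
  have V: "0 < measure lborel ?D" by (rule emeasure_unit_polydisc)
  have M: "M > 0"
    using u m(1) m(2)[OF zero_in_unit_polydisc] zero_in_unit_polydisc unfolding bounded_weight_def
    by (metis abs_exp_cancel exp_gt_zero less_le_trans)
  \<comment> \<open>The constant function \<open>sqrt s\<close> has weighted mass at most s M vol(D)
    = 1.\<close>
  define s where "s = 1 / (M * measure lborel ?D)"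
  have s: "s > 0" using V M by (simp add: s_def)
  have "(\<integral>\<^sup>+w\<in>?D. ennreal ((norm (complex_of_real (sqrt s)))\<^sup>2 * exp (- u w)) \<partial>lborel) \<le> (\<integral>\<^sup>+w\<in>?D. ennreal (s * M) \<partial>lborel)"
    using u s by (intro nn_integral_mono) (auto simp: bounded_weight_def indicator_def intro!: ennreal_leI mult_left_mono)
  also have "\<dots> = ennreal (s * M) * ennreal (measure lborel ?D)"
    by (subst nn_integral_cmult) (auto simp: emeasure_unit_polydisc(1))
  also have "\<dots> = 1" using s M V by (simp add: ennreal_mult[symmetric]) (simp add: s_def)
  finally have "admissible u (\<lambda>z. complex_of_real (sqrt s))"
    by (simp add: admissible_def holomorphic_several_on_const)
  from bergman_kernel_lower[OF u m this] show ?thesis using s by simp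
qed

section \<open>Dilated weights and smoothness of the log-kernel\<close>

lemma dilate_eq: "dilate t \<phi> = (\<lambda>z. \<phi> (coord_mult t z))"
  by (simp add: dilate_def coord_mult_def fun_eq_iff)

lemma dilate_weight:
  fixes \<phi> :: "complex ^ 'n::finite \<Rightarrow> real"
  assumes "continuous_on unit_polydisc \<phi>" "t \<in> ball 0 (1/2)"
  obtains M where "bounded_weight (\<lambda>z. exp (- dilate t \<phi> z)) M"
proof -
  have "continuous_on unit_polydisc (\<lambda>y. exp (- \<phi> y))" using assms(1) by (intro continuous_intros)
  from bounded_weight_dilate[OF this assms(2), of "\<lambda>z. 1" 1]
  obtain M where "bounded_weight (\<lambda>z. exp (- \<phi> (coord_mult t z)) * 1) M" by auto
  then show thesis by (intro that[of M]) (simp add: dilate_eq)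
qed

text \<open>The bound m is independent of t, because \<open>Ck_on_SUP_coercive_form\<close> asks for
  one coercivity constant on the whole ball.\<close>

lemma dilate_weight_lower:
  fixes \<phi> :: "complex ^ 'n::finite \<Rightarrow> real"
  assumes "continuous_on unit_polydisc \<phi>"
  obtains m where "0 < m" "\<And>t z. t \<in> ball 0 (1/2) \<Longrightarrow> z \<in> unit_polydisc \<Longrightarrow> m \<le> exp (- dilate t \<phi> z)"
proof -
  obtain B where B: "\<And>y. y \<in> half_polydisc \<Longrightarrow> \<bar>\<phi> y\<bar> \<le> B" using bounded_on_half_polydisc[OF assms] by blast
  have "exp (- B) \<le> exp (- dilate t \<phi> z)" if "t \<in> ball 0 (1/2)" "z \<in> unit_polydisc" for t z
    using B[OF coord_mult_half_polydisc[OF that]] by (simp add: dilate_eq abs_le_iff)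
  then show thesis by (intro that[of "exp (- B)"]) auto
qed

lemma smooth_on_imp_continuous_on: "smooth_on S f \<Longrightarrow> continuous_on S f"
  unfolding smooth_on_def using Ck_on_imp_continuous_on by blast

lemma smooth_on_log_bergman:
  fixes \<phi> :: "complex ^ 'n::finite \<Rightarrow> real"
  assumes \<phi>: "smooth_on unit_polydisc \<phi>"
  shows "smooth_on (ball 0 (1/2)) (\<lambda>t. log_bergman \<phi> t 0)"
  unfolding smooth_on_def
proof
  fix k
  let ?U = "ball (0 :: complex ^ 'n) (1/2)"
  have cont: "continuous_on unit_polydisc \<phi>" by (rule smooth_on_imp_continuous_on[OF \<phi>])
  obtain m where m: "0 < m" "\<And>t z. t \<in> ?U \<Longrightarrow> z \<in> unit_polydisc \<Longrightarrow> m \<le> exp (- dilate t \<phi> z)"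
    using dilate_weight_lower[OF cont] by blast
  have h: "smooth_on unit_polydisc (\<lambda>y. exp (- \<phi> y))"
    using \<phi> unfolding smooth_on_def by (auto intro!: Ck_on_exp Ck_on_uminus open_unit_polydisc)
  have "Ck_on k ?U (\<lambda>t. weight_form (\<lambda>z. exp (- \<phi> (coord_mult t z)) * 1))"
    by (rule Ck_on_weight_form[OF h]) auto
  then have W: "Ck_on k ?U (\<lambda>t. weight_form (\<lambda>z. exp (- dilate t \<phi> z)))"
    by (simp add: dilate_eq)
  have form: "coercive_form (weight_form (\<lambda>z. exp (- dilate t \<phi> z))) m" if t: "t \<in> ?U" for t
  proof -
    obtain M where "bounded_weight (\<lambda>z. exp (- dilate t \<phi> z)) M" using dilate_weight[OF cont t] by blast
    then show ?thesis by (rule coercive_weight_form[OF _ m(1) m(2)[OF t]])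
  qed
  have eq: "bergman_kernel (dilate t \<phi>) unit_polydisc 0 = 
      (SUP f\<in>{f. weight_form (\<lambda>z. exp (- dilate t \<phi> z)) f f \<le> 1}. (real_point_evaluation f)\<^sup>2)"
    and pos: "0 < bergman_kernel (dilate t \<phi>) unit_polydisc 0" if t: "t \<in> ?U" for t
  proof -
    obtain M where M: "bounded_weight (\<lambda>z. exp (- dilate t \<phi> z)) M" using dilate_weight[OF cont t] by blast
    show "bergman_kernel (dilate t \<phi>) unit_polydisc 0 = 
      (SUP f\<in>{f. weight_form (\<lambda>z. exp (- dilate t \<phi> z)) f f \<le> 1}. (real_point_evaluation f)\<^sup>2)"
      by (rule bergman_kernel_eq_SUP(1)[OF M m(1) m(2)[OF t]])
    show "0 < bergman_kernel (dilate t \<phi>) unit_polydisc 0"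
      by (rule bergman_kernel_pos[OF M m(1) m(2)[OF t]])
  qed
  have "Ck_on k ?U (\<lambda>t. SUP f\<in>{f. weight_form (\<lambda>z. exp (- dilate t \<phi> z)) f f \<le> 1}. (real_point_evaluation f)\<^sup>2)"
    by (rule Ck_on_SUP_coercive_form[OF open_ball W form])
  then have "Ck_on k ?U (\<lambda>t. bergman_kernel (dilate t \<phi>) unit_polydisc 0)"
    using Ck_on_cong[of ?U "\<lambda>t. bergman_kernel (dilate t \<phi>) unit_polydisc 0"
        "\<lambda>t. SUP f\<in>{f. weight_form (\<lambda>z. exp (- dilate t \<phi> z)) f f \<le> 1}. (real_point_evaluation f)\<^sup>2", OF open_ball eq]
    by simp
  then show "Ck_on k ?U (\<lambda>t. log_bergman \<phi> t 0)"
    unfolding log_bergman_def by (rule Ck_on_ln[OF open_ball _ pos])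
qed

section \<open>Complex Hessians and second-order expansions\<close>

abbreviation second_derivative ::
  "('a::real_normed_vector \<Rightarrow> 'b::real_normed_vector) \<Rightarrow> 'a \<Rightarrow> 'a \<Rightarrow> 'a \<Rightarrow> 'b" where
  "second_derivative f u v x \<equiv> frechet_derivative (\<lambda>y. frechet_derivative f (at y) u) (at x) v"

lemma second_derivative_bilinear:
  fixes f :: "'a::real_normed_vector \<Rightarrow> real"
  assumes "open S" "x \<in> S" and f: "Ck_on (Suc (Suc 0)) S f"
  shows "second_derivative f (a *\<^sub>R u + b *\<^sub>R v) (a *\<^sub>R u + b *\<^sub>R v) x =
    a\<^sup>2 * second_derivative f u u x + a * b * (second_derivative f u v x + second_derivative f v u x)
      + b\<^sup>2 * second_derivative f v v x"
proof -
  let ?D = "\<lambda>u y. frechet_derivative f (at y) u"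
  have d: "(?D u has_derivative frechet_derivative (?D u) (at x)) (at x)" for u
    by (rule Ck_on_has_derivative[OF Ck_on_frechet_derivative[OF f] \<open>x \<in> S\<close>])
  have lin: "linear (frechet_derivative (?D u) (at x))" for u
    using d[of u] has_derivative_linear by blast
  have eq: "?D (a *\<^sub>R u + b *\<^sub>R v) y = a * ?D u y + b * ?D v y" if "y \<in> S" for y
  proof -
    have "linear (frechet_derivative f (at y))"
      using Ck_on_has_derivative[OF f that] has_derivative_linear by blast
    then show ?thesis by (simp add: linear_add linear_scale)
  qed
  have "((\<lambda>y. a * ?D u y + b * ?D v y) has_derivative
      (\<lambda>w. a * frechet_derivative (?D u) (at x) w + b * frechet_derivative (?D v) (at x) w)) (at x)"
    by (intro has_derivative_add has_derivative_mult_right d)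
  then have "(?D (a *\<^sub>R u + b *\<^sub>R v) has_derivative
      (\<lambda>w. a * frechet_derivative (?D u) (at x) w + b * frechet_derivative (?D v) (at x) w)) (at x)"
    by (rule has_derivative_transform_within_open[OF _ assms(1,2)]) (simp add: eq)
  from frechet_derivative_at[OF this, symmetric]
  show ?thesis
    by (simp add: linear_add[OF lin] linear_scale[OF lin] power2_eq_square algebra_simps)
qed

lemma second_derivative_continuous:
  fixes f :: "'a::real_normed_vector \<Rightarrow> real"
  assumes "open S" "x \<in> S" and f: "Ck_on (Suc (Suc 0)) S f"
  shows "isCont (second_derivative f u v) x"
proof -
  have "Ck_on 0 S (second_derivative f u v)" by (intro Ck_on_frechet_derivative f)
  then show ?thesis using assms(1,2) by (simp add: continuous_on_eq_continuous_at)
qed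

lemma second_order_taylor:
  fixes f :: "'a::real_normed_vector \<Rightarrow> real"
  assumes f: "Ck_on (Suc (Suc 0)) S f" and S: "\<And>s. 0 \<le> s \<Longrightarrow> s \<le> 1 \<Longrightarrow> x + s *\<^sub>R w \<in> S"
  obtains s where "0 < s" "s < 1"
    "f (x + w) = f x + frechet_derivative f (at x) w + second_derivative f w w (x + s *\<^sub>R w) / 2"
proof -
  define diff where "diff = (\<lambda>m::nat. if m = 0 then (\<lambda>s. f (x + s *\<^sub>R w))
     else if m = 1 then (\<lambda>s. frechet_derivative f (at (x + s *\<^sub>R w)) w) else (\<lambda>s. second_derivative f w w (x + s *\<^sub>R w)))"
  have "\<exists>t>0. t < 1 \<and> f (x + 1 *\<^sub>R w) = (\<Sum>m<2. diff m 0 / fact m * 1 ^ m) + diff 2 t / fact 2 * 1 ^ 2"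
  proof (rule Maclaurin)
    show "\<forall>m t. m < 2 \<and> 0 \<le> t \<and> t \<le> 1 \<longrightarrow> (diff m has_real_derivative diff (Suc m) t) (at t)"
    proof (intro allI impI)
      fix m :: nat and t :: real assume mt: "m < 2 \<and> 0 \<le> t \<and> t \<le> 1"
      then consider "m = 0" | "m = 1" by linarith
      then show "(diff m has_real_derivative diff (Suc m) t) (at t)"
      proof cases
        case 1
        then show ?thesis using Ck_on_DERIV_line[OF f S] mt by (simp add: diff_def)
      next
        case 2
        then show ?thesis using Ck_on_DERIV_line[OF Ck_on_frechet_derivative[OF f] S] mt by (simp add: diff_def)
      qed
    qed
  qed (auto simp: diff_def)
  then show thesis using that by (auto simp: diff_def numeral_2_eq_2)
qed

lemma frechet_derivative_of_real:
  assumes "u differentiable (at y)"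
  shows "frechet_derivative (\<lambda>w. complex_of_real (u w)) (at y) = (\<lambda>v. complex_of_real (frechet_derivative u (at y) v))"
  using assms frechet_derivative_works has_derivative_of_real frechet_derivative_at by metis

lemma complex_hessian_eq:
  fixes u :: "complex ^ 'n::finite \<Rightarrow> real"
  assumes "open S" "z \<in> S" and u: "Ck_on (Suc (Suc 0)) S u"
  defines "D \<equiv> \<lambda>a b. complex_of_real (second_derivative u a b z)"
  shows "complex_hessian u z $ j $ k =
    (D (axis k 1) (axis j 1) + D (axis k \<i>) (axis j \<i>) + \<i> * (D (axis k \<i>) (axis j 1) - D (axis k 1) (axis j \<i>))) / 4"
proof -
  let ?d = "\<lambda>a y. frechet_derivative u (at y) a"
  let ?g = "\<lambda>y. (complex_of_real (?d (axis k 1) y) + \<i> * complex_of_real (?d (axis k \<i>) y)) / 2"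
  have diff: "u differentiable (at y)" if "y \<in> S" for y using u that by simp
  have eq: "?g y = wirtinger_bar k (\<lambda>w. complex_of_real (u w)) y" if "y \<in> S" for y
    by (simp add: wirtinger_bar_def frechet_derivative_of_real[OF diff[OF that]])
  have d: "(?d a has_derivative (\<lambda>b. second_derivative u a b z)) (at z)" for a
    by (rule Ck_on_has_derivative[OF Ck_on_frechet_derivative[OF u] \<open>z \<in> S\<close>])
  have "(?g has_derivative (\<lambda>b. (D (axis k 1) b + \<i> * D (axis k \<i>) b) / 2)) (at z)"
    unfolding D_def by (intro bounded_linear.has_derivative[OF bounded_linear_divide] has_derivative_add has_derivative_mult_right has_derivative_of_real d)
  then have "(wirtinger_bar k (\<lambda>w. complex_of_real (u w)) has_derivative (\<lambda>b. (D (axis k 1) b + \<i> * D (axis k \<i>) b) / 2)) (at z)"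
    by (rule has_derivative_transform_within_open[OF _ assms(1,2)]) (rule eq)
  from frechet_derivative_at[OF this, symmetric]
  show ?thesis by (simp add: complex_hessian_def wirtinger_def field_simps)
qed

text \<open>The cross terms cancel by symmetry of second derivatives, leaving a quarter of the
  Laplacian in the j-th coordinate.\<close>

lemma complex_hessian_diagonal:
  fixes u :: "complex ^ 'n::finite \<Rightarrow> real"
  assumes "open S" "z \<in> S" and u: "Ck_on (Suc (Suc 0)) S u"
  shows "complex_hessian u z $ j $ j = complex_of_real
     ((second_derivative u (axis j 1) (axis j 1) z + second_derivative u (axis j \<i>) (axis j \<i>) z) / 4)"
  unfolding complex_hessian_eq[OF assms]
  using Ck_on_second_derivative_symmetric[OF assms, of "axis j 1" "axis j \<i>"] by simp

lemma complex_hessian_tendsto: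
  fixes u :: "complex ^ 'n::finite \<Rightarrow> real"
  assumes "open S" "z \<in> S" and u: "Ck_on (Suc (Suc 0)) S u"
  shows "((\<lambda>w. complex_hessian u w $ j $ k) \<longlongrightarrow> complex_hessian u z $ j $ k) (at z)"
proof -
  let ?E = "\<lambda>w. (complex_of_real (second_derivative u (axis k 1) (axis j 1) w) + complex_of_real (second_derivative u (axis k \<i>) (axis j \<i>) w) +
    \<i> * (complex_of_real (second_derivative u (axis k \<i>) (axis j 1) w) - complex_of_real (second_derivative u (axis k 1) (axis j \<i>) w))) / 4"
  have lim: "((\<lambda>w. complex_of_real (second_derivative u a b w)) \<longlongrightarrow> complex_of_real (second_derivative u a b z)) (at z)" for a b
    by (intro tendsto_of_real isContD second_derivative_continuous[OF assms])
  have "(?E \<longlongrightarrow> ?E z) (at z)"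
    by (intro tendsto_divide tendsto_add tendsto_mult tendsto_diff tendsto_const lim) simp
  moreover have "\<forall>\<^sub>F w in at z. ?E w = complex_hessian u w $ j $ k"
    using eventually_at_in_open'[OF assms(1,2)] by eventually_elim (simp add: complex_hessian_eq[OF assms(1) _ u])
  ultimately show ?thesis
    unfolding complex_hessian_eq[OF assms] by (rule Lim_transform_eventually)
qed

lemma axis_complex: "axis j \<zeta> = Re \<zeta> *\<^sub>R axis j 1 + Im \<zeta> *\<^sub>R axis j (\<i> :: complex)"
  by (auto simp: vec_eq_iff axis_def complex_eq_iff)

lemma norm_axis_complex: "norm (axis j (\<zeta> :: complex) :: complex ^ 'n::finite) = norm \<zeta>"
proof -
  have "norm (axis j \<zeta> :: complex ^ 'n) ^ 2 = norm \<zeta> ^ 2"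
    by (simp only: power2_norm_eq_inner inner_axis_axis) simp
  then show ?thesis by (metis norm_ge_zero power2_eq_imp_eq)
qed

text \<open>\<open>a\<close> and \<open>b\<close> collect the pluriharmonic part of the second-order Taylor polynomial; what remains is its Levi part.\<close>

lemma coordinate_line_expansion:
  fixes \<phi> :: "complex ^ 'n::finite \<Rightarrow> real"
  assumes "open S" "0 \<in> S" and \<phi>: "Ck_on (Suc (Suc 0)) S \<phi>"
  obtains a b where "\<And>\<eta>. 0 < \<eta> \<Longrightarrow> \<exists>\<delta>>0. \<forall>\<zeta>. norm \<zeta> < \<delta> \<longrightarrow>
    \<bar>\<phi> (axis j \<zeta>) - \<phi> 0 - Re (a * \<zeta> + b * \<zeta>\<^sup>2) - Re (complex_hessian \<phi> 0 $ j $ j) * (norm \<zeta>)\<^sup>2\<bar> \<le> \<eta> * (norm \<zeta>)\<^sup>2"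
proof -
  let ?e = "axis j 1 :: complex ^ 'n" and ?f = "axis j \<i> :: complex ^ 'n"
  let ?d = "\<lambda>v. frechet_derivative \<phi> (at 0) v"
  let ?D = "second_derivative \<phi>"
  \<comment> \<open>Chosen so that \<open>Re (a * \<zeta>)\<close> is the first-order Taylor
    term.\<close>
  define a where "a = Complex (?d ?e) (- ?d ?f)"
  define p q r where "p = ?D ?e ?e 0" and "q = ?D ?e ?f 0 + ?D ?f ?e 0" and "r = ?D ?f ?f 0"
  \<comment> \<open>With this b, (p x^2 + q x y + r y^2) / 2 equals
    \<open>Re (b * \<zeta>\<^sup>2)\<close> plus (p + r) / 4 times x^2 + y^2.\<close>
  define b where "b = Complex ((p - r) / 4) (- q / 4)"
  have hess: "Re (complex_hessian \<phi> 0 $ j $ j) = (p + r) / 4"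
    by (simp add: complex_hessian_diagonal[OF assms] p_def r_def)
  obtain \<rho> where \<rho>: "\<rho> > 0" "ball 0 \<rho> \<subseteq> S" using assms(1,2) open_contains_ball by blast
  show thesis
  proof (rule that[of a b])
    fix \<eta> :: real assume "\<eta> > 0"
    have "\<exists>d>0. \<forall>y. norm y < d \<longrightarrow> \<bar>?D u v y - ?D u v 0\<bar> < \<eta>" for u v
      using second_derivative_continuous[OF assms, of u v] \<open>\<eta> > 0\<close>
      unfolding continuous_at_eps_delta by (simp add: dist_real_def dist_norm)
    then obtain d where d: "\<And>u v. d u v > 0" "\<And>u v y. norm y < d u v \<Longrightarrow> \<bar>?D u v y - ?D u v 0\<bar> < \<eta>"
      by metis
    define \<delta> where "\<delta> = min \<rho> (min (min (d ?e ?e) (d ?e ?f)) (min (d ?f ?e) (d ?f ?f)))"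
    have \<delta>: "\<delta> > 0" using \<rho> d by (simp add: \<delta>_def)
    show "\<exists>\<delta>>0. \<forall>\<zeta>. norm \<zeta> < \<delta> \<longrightarrow> \<bar>\<phi> (axis j \<zeta>) - \<phi> 0 - Re (a * \<zeta> + b * \<zeta>\<^sup>2)
        - Re (complex_hessian \<phi> 0 $ j $ j) * (norm \<zeta>)\<^sup>2\<bar> \<le> \<eta> * (norm \<zeta>)\<^sup>2"
    proof (intro exI conjI allI impI, rule \<delta>)
      fix \<zeta> :: complex assume \<zeta>: "norm \<zeta> < \<delta>"
      define x y where "x = Re \<zeta>" and "y = Im \<zeta>"
      let ?w = "axis j \<zeta> :: complex ^ 'n"
      have nz: "(norm \<zeta>)\<^sup>2 = x\<^sup>2 + y\<^sup>2" by (simp add: cmod_power2 x_def y_def)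
      have w: "?w = x *\<^sub>R ?e + y *\<^sub>R ?f" unfolding x_def y_def by (rule axis_complex)
      have nw: "norm (s *\<^sub>R ?w) < \<delta>" if "0 \<le> s" "s \<le> 1" for s
        using \<zeta> that mult_left_le_one_le[of "norm \<zeta>" s] by (simp add: norm_axis_complex)
      have sS: "0 + s *\<^sub>R ?w \<in> S" if "0 \<le> s" "s \<le> 1" for s
        using nw[OF that] \<rho> by (auto simp: \<delta>_def)
      obtain s where s: "0 < s" "s < 1" "\<phi> (0 + ?w) = \<phi> 0 + ?d ?w + ?D ?w ?w (0 + s *\<^sub>R ?w) / 2"
        using second_order_taylor[OF \<phi> sS] by blast
      have lin: "?d ?w = Re (a * \<zeta>)"
      proof -
        have "linear ?d" using Ck_on_has_derivative[OF \<phi> assms(2)] has_derivative_linear by blast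
        then show ?thesis by (simp add: w linear_add linear_scale a_def x_def y_def)
      qed
      let ?z = "s *\<^sub>R ?w"
      have n: "norm ?z < \<delta>" using nw s by simp
      have zS: "?z \<in> S" using sS[of s] s by simp
      have Dz: "?D ?w ?w ?z = x\<^sup>2 * ?D ?e ?e ?z + x * y * (?D ?e ?f ?z + ?D ?f ?e ?z) + y\<^sup>2 * ?D ?f ?f ?z"
        unfolding w by (rule second_derivative_bilinear[OF assms(1) zS[unfolded w] \<phi>])
      \<comment> \<open>Deviations of the second derivatives at the intermediate Taylor point from
        their values at 0.\<close>
      define A B C where "A = ?D ?e ?e ?z - p" and "B = ?D ?e ?f ?z + ?D ?f ?e ?z - q" and "C = ?D ?f ?f ?z - r"
      have A: "\<bar>A\<bar> \<le> \<eta>" using d(2)[of ?z ?e ?e] n by (simp add: A_def p_def \<delta>_def)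
      have C: "\<bar>C\<bar> \<le> \<eta>" using d(2)[of ?z ?f ?f] n by (simp add: C_def r_def \<delta>_def)
      have B: "\<bar>B\<bar> \<le> 2 * \<eta>" using d(2)[of ?z ?e ?f] d(2)[of ?z ?f ?e] n by (simp add: B_def q_def \<delta>_def)
      have "\<phi> ?w - \<phi> 0 - Re (a * \<zeta> + b * \<zeta>\<^sup>2) - Re (complex_hessian \<phi> 0 $ j $ j) * (norm \<zeta>)\<^sup>2
          = ?D ?w ?w ?z / 2 - Re (b * \<zeta>\<^sup>2) - (p + r) / 4 * (norm \<zeta>)\<^sup>2"
        using s(3) by (simp add: hess lin)
      also have "\<dots> = (x\<^sup>2 * A + x * y * B + y\<^sup>2 * C) / 2"
        unfolding Dz A_def B_def C_def nz
        by (simp add: b_def x_def[symmetric] y_def[symmetric] power2_eq_square field_simps)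
      also have "\<bar>\<dots>\<bar> \<le> \<eta> * (x\<^sup>2 + y\<^sup>2)"
      proof -
        have 1: "\<bar>x\<^sup>2 * A\<bar> \<le> x\<^sup>2 * \<eta>" using A by (simp add: abs_mult mult_left_mono)
        have 2: "\<bar>y\<^sup>2 * C\<bar> \<le> y\<^sup>2 * \<eta>" using C by (simp add: abs_mult mult_left_mono)
        have "\<bar>x * y * B\<bar> \<le> \<bar>x * y\<bar> * (2 * \<eta>)" using B by (simp add: abs_mult mult_left_mono)
        also have "\<bar>x * y\<bar> * (2 * \<eta>) \<le> (x\<^sup>2 + y\<^sup>2) / 2 * (2 * \<eta>)"
        proof (rule mult_right_mono)
          show "\<bar>x * y\<bar> \<le> (x\<^sup>2 + y\<^sup>2) / 2"
            using zero_le_power2[of "\<bar>x\<bar> - \<bar>y\<bar>"] by (simp add: power2_eq_square algebra_simps abs_mult)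
        qed (use \<open>\<eta> > 0\<close> in simp)
        finally have 3: "\<bar>x * y * B\<bar> \<le> \<eta> * (x\<^sup>2 + y\<^sup>2)" by (simp add: algebra_simps)
        have "\<bar>x\<^sup>2 * A + x * y * B + y\<^sup>2 * C\<bar> \<le> 2 * (\<eta> * (x\<^sup>2 + y\<^sup>2))"
          using 1 2 3 by (simp add: algebra_simps abs_le_iff)
        then show ?thesis by simp
      qed
      also have "\<dots> = \<eta> * (norm \<zeta>)\<^sup>2" by (simp add: nz)
      finally show "\<bar>\<phi> ?w - \<phi> 0 - Re (a * \<zeta> + b * \<zeta>\<^sup>2) - Re (complex_hessian \<phi> 0 $ j $ j) * (norm \<zeta>)\<^sup>2\<bar> \<le> \<eta> * (norm \<zeta>)\<^sup>2" .
    qed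
  qed
qed

section \<open>Second derivatives from expansions and from symmetries\<close>

text \<open>The symmetric second difference is 2 c s^2 + o(s^2) by the expansion, and for a C^2
  function it is s^2 times a second derivative at a point close to 0.\<close>

lemma second_derivative_from_expansion:
  fixes f :: "'a::real_normed_vector \<Rightarrow> real"
  assumes "open S" "0 \<in> S" and f: "Ck_on (Suc (Suc 0)) S f"
    and expansion: "\<And>\<eta>. 0 < \<eta> \<Longrightarrow> \<exists>\<delta>>0. \<forall>s. \<bar>s\<bar> < \<delta> \<longrightarrow> \<bar>f (s *\<^sub>R v) - f 0 - c * s\<^sup>2\<bar> \<le> \<eta> * s\<^sup>2"
  shows "second_derivative f v v 0 = 2 * c"
proof -
  have "\<bar>second_derivative f v v 0 - 2 * c\<bar> \<le> 3 * e" if "e > 0" for e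
  proof -
    obtain d where d: "d > 0" "\<And>y. norm y < d \<Longrightarrow> \<bar>second_derivative f v v y - second_derivative f v v 0\<bar> < e"
      using second_derivative_continuous[OF assms(1-3), of v v] \<open>e > 0\<close>
      unfolding continuous_at_eps_delta by (auto simp: dist_real_def dist_norm)
    obtain \<rho> where \<rho>: "\<rho> > 0" "ball 0 \<rho> \<subseteq> S" using assms(1,2) open_contains_ball by blast
    obtain \<delta> where \<delta>: "\<delta> > 0" "\<And>s. \<bar>s\<bar> < \<delta> \<Longrightarrow> \<bar>f (s *\<^sub>R v) - f 0 - c * s\<^sup>2\<bar> \<le> e * s\<^sup>2"
      using expansion[OF \<open>e > 0\<close>] by blast
    define N where "N = norm v + 1"
    have N: "N > 0" by (simp add: N_def add_nonneg_pos)
    \<comment> \<open>The mean value lemma is applied to the degenerate parallelogram based at -s v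
      with both sides s v. Its points are r v with |r| at most s, and this s keeps them within every
      radius in play.\<close>
    define s where "s = min (\<delta> / 2) (min (d / (2 * N)) (\<rho> / (2 * N)))"
    have s: "s > 0" "s < \<delta>" using \<delta> d \<rho> N by (auto simp: s_def min_def)
    have near: "norm (r *\<^sub>R v) < d" "norm (r *\<^sub>R v) < \<rho>" if "\<bar>r\<bar> \<le> s" for r
    proof -
      have "norm (r *\<^sub>R v) \<le> s * N" using that s by (simp add: N_def mult_mono)
      also have "s * N \<le> min (d / 2) (\<rho> / 2)" using N by (simp add: s_def min_def field_simps)
      finally show "norm (r *\<^sub>R v) < d" "norm (r *\<^sub>R v) < \<rho>" using d \<rho> by auto
    qed
    have pt: "(- s) *\<^sub>R v + a *\<^sub>R v + b *\<^sub>R v = (a + b - s) *\<^sub>R v" for a b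
      by (simp add: algebra_simps)
    have inS: "(- s) *\<^sub>R v + a *\<^sub>R v + b *\<^sub>R v \<in> S" if "0 \<le> a" "a \<le> s" "0 \<le> b" "b \<le> s" for a b
      unfolding pt using near(2)[of "a + b - s"] that \<rho> by auto
    obtain a b where ab: "0 < a" "a < s" "0 < b" "b < s"
      "f ((- s) *\<^sub>R v + s *\<^sub>R v + s *\<^sub>R v) - f ((- s) *\<^sub>R v + s *\<^sub>R v) - f ((- s) *\<^sub>R v + s *\<^sub>R v) + f ((- s) *\<^sub>R v) =
        s * s * second_derivative f v v ((- s) *\<^sub>R v + a *\<^sub>R v + b *\<^sub>R v)"
      using second_difference_mvt[OF f s(1) inS] by blast
    let ?y = "(a + b - s) *\<^sub>R v"
    have "\<bar>second_derivative f v v ?y - second_derivative f v v 0\<bar> < e"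
      using ab by (intro d near) auto
    moreover have "\<bar>second_derivative f v v ?y - 2 * c\<bar> \<le> 2 * e"
    proof -
      have "s * s * second_derivative f v v ?y = f (s *\<^sub>R v) - 2 * f 0 + f ((- s) *\<^sub>R v)"
        using ab(5) unfolding pt by simp
      then have "\<bar>s * s * second_derivative f v v ?y - 2 * c * s\<^sup>2\<bar> \<le> 2 * e * s\<^sup>2"
        using \<delta>(2)[of s] \<delta>(2)[of "- s"] s by (simp add: abs_le_iff)
      then have "\<bar>s\<^sup>2 * (second_derivative f v v ?y - 2 * c)\<bar> \<le> s\<^sup>2 * (2 * e)"
        by (simp add: power2_eq_square algebra_simps)
      then show ?thesis using s by (simp add: abs_mult)
    qed
    ultimately show ?thesis by (simp add: abs_le_iff abs_less_iff)
  qed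
  \<comment> \<open>With e a sixth of the gap, the gap is at most half of itself.\<close>
  from this[of "\<bar>second_derivative f v v 0 - 2 * c\<bar> / 6"] show ?thesis
    by (cases "second_derivative f v v 0 = 2 * c") auto
qed

text \<open>The chain rule applied twice to f o T = f; T fixes 0, so both sides are taken at the
  same point.\<close>

lemma second_derivative_linear_invariant:
  fixes f :: "'a::real_normed_vector \<Rightarrow> real"
  assumes "open S" "0 \<in> S" and f: "Ck_on (Suc (Suc 0)) S f" and T: "bounded_linear T"
    and TS: "\<And>x. x \<in> S \<Longrightarrow> T x \<in> S" and inv: "\<And>x. x \<in> S \<Longrightarrow> f (T x) = f x"
  shows "second_derivative f u v 0 = second_derivative f (T u) (T v) 0"
proof -
  have dT: "(T has_derivative T) (at x)" for x by (rule bounded_linear_imp_has_derivative[OF T])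
  have T0: "T 0 = 0" using T linear_0 bounded_linear.linear by blast
  have first: "frechet_derivative f (at (T x)) (T u) = frechet_derivative f (at x) u" if "x \<in> S" for x
  proof -
    have "((\<lambda>x. f (T x)) has_derivative (\<lambda>w. frechet_derivative f (at (T x)) (T w))) (at x)"
      by (rule has_derivative_compose[OF dT Ck_on_has_derivative[OF f TS[OF that]]])
    then have "(f has_derivative (\<lambda>w. frechet_derivative f (at (T x)) (T w))) (at x)"
      by (rule has_derivative_transform_within_open[OF _ assms(1) that]) (rule inv)
    from fun_cong[OF frechet_derivative_at[OF this], of u] show ?thesis .
  qed
  have "(0::'a) \<in> S" "T 0 \<in> S" using assms(2) T0 by auto
  have "((\<lambda>x. frechet_derivative f (at (T x)) (T u)) has_derivative (\<lambda>w. second_derivative f (T u) (T w) (T 0))) (at 0)"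
    by (rule has_derivative_compose[OF dT Ck_on_has_derivative[OF Ck_on_frechet_derivative[OF f] \<open>T 0 \<in> S\<close>]])
  then have "((\<lambda>x. frechet_derivative f (at x) u) has_derivative (\<lambda>w. second_derivative f (T u) (T w) (T 0))) (at 0)"
    by (rule has_derivative_transform_within_open[OF _ assms(1,2)]) (rule first)
  from fun_cong[OF frechet_derivative_at[OF this], of v] show ?thesis by (simp add: T0)
qed

section \<open>Symmetry and Gaussian weights on the polydisc\<close>

lemma coord_mult_in_unit_polydisc_iff:
  assumes "\<And>i. norm (s $ i) = 1"
  shows "coord_mult s z \<in> unit_polydisc \<longleftrightarrow> z \<in> unit_polydisc"
  using assms by (simp add: unit_polydisc_def norm_mult)

lemma admissible_rotate:
  fixes u :: "complex ^ 'n::finite \<Rightarrow> real"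
  assumes s: "\<And>i. norm (s $ i) = 1" and u: "continuous_on unit_polydisc u" and f: "admissible u f"
  shows "admissible (\<lambda>z. u (coord_mult s z)) (\<lambda>z. f (coord_mult s z))"
proof -
  let ?D = "unit_polydisc :: (complex ^ 'n) set"
  have hol: "holomorphic_several_on ?D f" using f by (simp add: admissible_def)
  have "holomorphic_several_on ?D (\<lambda>z. f (coord_mult s z))"
    unfolding holomorphic_several_on_def
  proof
    fix z assume "z \<in> ?D"
    then have "coord_mult s z \<in> ?D" by (simp add: coord_mult_in_unit_polydisc_iff[OF s])
    then obtain f' where f': "(f has_derivative f') (at (coord_mult s z))" "\<forall>c v. f' (c *s v) = c * f' v"
      using hol unfolding holomorphic_several_on_def by blast
    have "(coord_mult s has_derivative coord_mult s) (at z)"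
      by (rule bounded_linear_imp_has_derivative[OF coord_mult.bounded_linear_right])
    from has_derivative_compose[OF this f'(1)]
    have "((\<lambda>z. f (coord_mult s z)) has_derivative (\<lambda>v. f' (coord_mult s v))) (at z)" .
    moreover have "coord_mult s (c *s v) = c *s coord_mult s v" for c v by (simp add: vec_eq_iff)
    ultimately show "\<exists>g'. ((\<lambda>z. f (coord_mult s z)) has_derivative g') (at z) \<and> (\<forall>c v. g' (c *s v) = c * g' v)"
      using f'(2) by auto
  qed
  moreover have "(\<integral>\<^sup>+w\<in>?D. ennreal ((norm (f (coord_mult s w)))\<^sup>2 * exp (- u (coord_mult s w))) \<partial>lborel) =
      (\<integral>\<^sup>+w\<in>?D. ennreal ((norm (f w))\<^sup>2 * exp (- u w)) \<partial>lborel)"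
  proof -
    define G where "G = (\<lambda>w. ennreal (indicator ?D w *\<^sub>R ((norm (f w))\<^sup>2 * exp (- u w))))"
    have "continuous_on ?D (\<lambda>w. (norm (f w))\<^sup>2 * exp (- u w))"
      by (intro continuous_intros holomorphic_several_on_continuous_on[OF hol] u)
    from borel_measurable_continuous_on_indicator[OF unit_polydisc_borel this]
    have [measurable]: "G \<in> borel_measurable borel"
      unfolding G_def by (rule measurable_compose[OF _ measurable_ennreal])
    have "(\<integral>\<^sup>+w. G (coord_mult s w) \<partial>lborel) = (\<integral>\<^sup>+w. G w \<partial>lborel)"
      by (rule nn_integral_lborel_orthogonal[OF orthogonal_transformation_coord_mult[OF s]]) measurable
    moreover have "G w = ennreal ((norm (f w))\<^sup>2 * exp (- u w)) * indicator ?D w" for w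
      by (simp add: G_def indicator_def)
    moreover have "indicator ?D (coord_mult s w) = (indicator ?D w :: ennreal)" for w
      by (simp add: indicator_def coord_mult_in_unit_polydisc_iff[OF s])
    ultimately show ?thesis by simp
  qed
  ultimately show ?thesis using f by (simp add: admissible_def)
qed

text \<open>A sign change of t can be moved onto z, where it is a rotation that carries competitors
  to competitors and fixes the origin; being an involution, it gives both inclusions.\<close>

lemma log_bergman_sign_invariant:
  fixes \<phi> :: "complex ^ 'n::finite \<Rightarrow> real"
  assumes \<phi>: "continuous_on unit_polydisc \<phi>" and t: "t \<in> ball 0 (1/2)"
    and s: "\<And>i. s $ i = 1 \<or> s $ i = -1"
  shows "log_bergman \<phi> (coord_mult s t) 0 = log_bergman \<phi> t 0"
proof -
  have n: "norm (s $ i) = 1" for i using s[of i] by auto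
  have ss: "coord_mult s (coord_mult s z) = z" for z
  proof -
    have "s $ i * (s $ i * z $ i) = z $ i" for i using s[of i] by auto
    then show ?thesis by (simp add: vec_eq_iff)
  qed
  define u where "u = dilate t \<phi>"
  have us: "dilate (coord_mult s t) \<phi> = (\<lambda>z. u (coord_mult s z))"
  proof -
    have "coord_mult (coord_mult s t) z = coord_mult t (coord_mult s z)" for z by (simp add: vec_eq_iff)
    then show ?thesis by (simp add: u_def dilate_eq)
  qed
  have cu: "continuous_on unit_polydisc u"
    unfolding u_def dilate_eq by (rule continuous_on_coord_mult_compose[OF \<phi> t])
  have cus: "continuous_on unit_polydisc (\<lambda>z. u (coord_mult s z))"
    by (rule continuous_on_compose2[OF cu])
      (auto intro!: coord_mult.continuous_on continuous_intros simp: coord_mult_in_unit_polydisc_iff[OF n])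
  have sub: "(\<lambda>f. (norm (f 0))\<^sup>2) ` Collect (admissible u) \<subseteq> (\<lambda>f. (norm (f 0))\<^sup>2) ` Collect (admissible (\<lambda>z. u (coord_mult s z)))"
    if "continuous_on unit_polydisc u" for u
  proof
    fix a assume "a \<in> (\<lambda>f. (norm (f 0))\<^sup>2) ` Collect (admissible u)"
    then obtain f where f: "admissible u f" "a = (norm (f 0))\<^sup>2" by blast
    have "a = (norm (f (coord_mult s 0)))\<^sup>2" using f(2) by (simp add: coord_mult.zero_right)
    then show "a \<in> (\<lambda>f. (norm (f 0))\<^sup>2) ` Collect (admissible (\<lambda>z. u (coord_mult s z)))"
      using admissible_rotate[OF n that f(1)] by (intro image_eqI[of _ _ "\<lambda>z. f (coord_mult s z)"]) auto
  qed
  have "(\<lambda>f. (norm (f 0))\<^sup>2) ` Collect (admissible u) = (\<lambda>f. (norm (f 0))\<^sup>2) ` Collect (admissible (\<lambda>z. u (coord_mult s z)))"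
    using sub[OF cu] sub[OF cus] by (simp add: ss)
  then show ?thesis by (simp add: log_bergman_def bergman_kernel_admissible us u_def[symmetric])
qed

section \<open>The second moment of one coordinate over the polydisc\<close>

lemma emeasure_polydisc_scaled:
  fixes j :: "'n::finite"
  assumes r: "0 < r" "r \<le> 1"
  shows "emeasure lborel {z \<in> unit_polydisc :: (complex ^ 'n) set. norm (z $ j) < r} =
    ennreal (r\<^sup>2) * emeasure lborel (unit_polydisc :: (complex ^ 'n) set)"
proof -
  let ?D = "unit_polydisc :: (complex ^ 'n) set"
  let ?A = "{z \<in> ?D. norm (z $ j) < r}"
  \<comment> \<open>Equal to r exactly on the two real basis vectors of coordinate j, so the
    Jacobian of T is r^2. The translation by 0 in T fits
    \<open>lborel_affine_euclidean\<close>.\<close>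
  define c where "c = (\<lambda>b :: complex ^ 'n. if b $ j = 0 then 1 else r)"
  define T where "T = (\<lambda>x :: complex ^ 'n. 0 + (\<Sum>b\<in>Basis. (c b * inner x b) *\<^sub>R b))"
  have T: "T x $ i = (if i = j then r *\<^sub>R (x $ i) else x $ i)" for x i
  proof -
    have "T x = (\<chi> i. if i = j then r *\<^sub>R (x $ i) else x $ i)" (is "_ = ?y")
    proof (rule euclidean_eqI)
      fix b :: "complex ^ 'n" assume b: "b \<in> Basis"
      then obtain k w where kw: "b = axis k w" "w \<in> Basis" by (auto simp: Basis_vec_def)
      then have "w \<noteq> 0" by auto
      have "inner (T x) b = c b * inner x b" using b by (simp add: T_def)
      also have "c b = (if k = j then r else 1)" using kw(1) \<open>w \<noteq> 0\<close> by (simp add: c_def axis_def)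
      also have "(if k = j then r else 1) * inner x b = inner ?y b" unfolding kw(1) inner_axis by simp
      finally show "inner (T x) b = inner ?y b" .
    qed
    then show ?thesis by simp
  qed
  have [measurable]: "T \<in> borel \<rightarrow>\<^sub>M borel" by (simp add: T_def[abs_def])
  have op: "open ?A"
  proof -
    have "open {z :: complex ^ 'n. norm (z $ j) < r}" by (intro open_Collect_less continuous_intros)
    moreover have "?A = ?D \<inter> {z. norm (z $ j) < r}" by auto
    ultimately show ?thesis using open_Int[OF open_unit_polydisc] by metis
  qed
  then have [measurable]: "?A \<in> sets borel" by (rule borel_open)
  have TA: "T -` ?A = ?D"
  proof (intro set_eqI iffI)
    fix z assume "z \<in> T -` ?A"
    then have "norm (T z $ i) < 1" "norm (T z $ j) < r" for i by (auto simp: unit_polydisc_def)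
    then show "z \<in> ?D" using r unfolding unit_polydisc_def T
      by (smt (verit) mem_Collect_eq mult_less_cancel_left2 norm_scaleR)
  next
    fix z assume z: "z \<in> ?D"
    then have n: "norm (z $ i) < 1" for i by (simp add: unit_polydisc_def)
    have "norm (T z $ j) < r" using n[of j] r by (simp add: T)
    moreover have "norm (T z $ i) < 1" for i
    proof (cases "i = j")
      case True
      then show ?thesis using \<open>norm (T z $ j) < r\<close> r by simp
    next
      case False
      then show ?thesis using n[of i] by (simp add: T)
    qed
    ultimately show "z \<in> T -` ?A" by (simp add: unit_polydisc_def)
  qed
  have "(\<Prod>b\<in>Basis. \<bar>c b\<bar>) = r\<^sup>2"
  proof -
    have B: "{b \<in> (Basis :: (complex ^ 'n) set). b $ j \<noteq> 0} = {axis j 1, axis j \<i>}"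
      by (auto simp: Basis_vec_def Basis_complex_def axis_def split: if_splits)
    have "(\<Prod>b\<in>Basis. \<bar>c b\<bar>) = (\<Prod>b\<in>{b \<in> (Basis :: (complex ^ 'n) set). b $ j \<noteq> 0}. r)"
      using r by (intro prod.mono_neutral_cong_right) (auto simp: c_def)
    also have "\<dots> = r\<^sup>2" unfolding B by (simp add: axis_eq_axis complex_eq_iff power2_eq_square)
    finally show ?thesis .
  qed
  moreover have "lborel = density (distr lborel borel T) (\<lambda>_. (\<Prod>b\<in>Basis. \<bar>c b\<bar>))"
    unfolding T_def using r by (intro lborel_affine_euclidean) (simp add: c_def)
  ultimately have "emeasure lborel ?A = emeasure (density (distr lborel borel T) (\<lambda>_. ennreal (r\<^sup>2))) ?A" by simp
  also have "\<dots> = ennreal (r\<^sup>2) * emeasure (distr lborel borel T) ?A"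
    by (subst emeasure_density_const) auto
  also have "emeasure (distr lborel borel T) ?A = emeasure lborel ?D"
    using emeasure_distr[of T lborel borel ?A] by (simp only: TA) simp
  finally show ?thesis .
qed

lemma norm_nth_unit_polydisc: "z \<in> unit_polydisc \<Longrightarrow> (norm (z $ j))\<^sup>2 < 1"
  by (simp add: unit_polydisc_def power_less_one_iff)

lemma integrable_indicator_unit_polydisc: "integrable lborel (indicator (unit_polydisc :: (complex ^ 'n::finite) set) :: _ \<Rightarrow> real)"
  using emeasure_unit_polydisc(1)[where 'n='n] by (intro integrable_real_indicator) auto

text \<open>Layer-cake formula, with the measures of the layers given by scaling.\<close>

lemma polydisc_second_moment:
  fixes j :: "'n::finite"
  defines "D \<equiv> unit_polydisc :: (complex ^ 'n) set"
  shows "(\<integral>z. indicator D z * (norm (z $ j))\<^sup>2 \<partial>lborel) = measure lborel D / 2"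
    and "integrable lborel (\<lambda>z. indicator D z * (norm (z $ j))\<^sup>2)"
proof -
  have [measurable]: "D \<in> sets borel" unfolding D_def by measurable
  have [measurable]: "(\<lambda>z :: complex ^ 'n. z $ j) \<in> borel_measurable borel"
    by (intro borel_measurable_continuous_onI continuous_intros)
  have intD: "integrable lborel (indicator D :: _ \<Rightarrow> real)"
    unfolding D_def by (rule integrable_indicator_unit_polydisc)
  have lt: "(norm (z $ j))\<^sup>2 < 1" if "z \<in> D" for z
    using that unfolding D_def by (rule norm_nth_unit_polydisc)
  show int: "integrable lborel (\<lambda>z. indicator D z * (norm (z $ j))\<^sup>2)"
  proof (rule Bochner_Integration.integrable_bound[OF intD])
    have "norm (indicator D z * (norm (z $ j))\<^sup>2) \<le> norm (indicator D z :: real)" for z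
      using lt[of z] by (cases "z \<in> D") auto
    then show "AE z in lborel. norm (indicator D z * (norm (z $ j))\<^sup>2) \<le> norm (indicator D z :: real)"
      by simp
  qed measurable
  \<comment> \<open>The layers of 1 - |z_j|^2 are the sets |z_j|^2 < u, whose volume is u times that
    of the polydisc; the second moment then follows by subtraction.\<close>
  have "(\<integral>\<^sup>+z. ennreal (indicator D z * (1 - (norm (z $ j))\<^sup>2)) \<partial>lborel) =
     (\<integral>\<^sup>+z. (\<integral>\<^sup>+u. indicator {0..1} u * indicator {z \<in> D. (norm (z $ j))\<^sup>2 < u} z \<partial>lborel) \<partial>lborel)"
  proof (rule nn_integral_cong)
    fix z :: "complex ^ 'n"
    show "ennreal (indicator D z * (1 - (norm (z $ j))\<^sup>2)) =
      (\<integral>\<^sup>+u. indicator {0..1} u * indicator {z \<in> D. (norm (z $ j))\<^sup>2 < u} z \<partial>lborel)"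
    proof (cases "z \<in> D")
      case True
      have "(\<integral>\<^sup>+u. indicator {0..1} u * indicator {z \<in> D. (norm (z $ j))\<^sup>2 < u} z \<partial>lborel) =
        (\<integral>\<^sup>+u. indicator {(norm (z $ j))\<^sup>2<..1} u \<partial>lborel)"
        using True by (intro nn_integral_cong) (auto simp: indicator_def intro: order_trans[OF zero_le_power2 less_imp_le])
      also have "\<dots> = ennreal (1 - (norm (z $ j))\<^sup>2)"
        using lt[OF True] by simp
      finally show ?thesis using True by simp
    qed simp
  qed
  also have "\<dots> = (\<integral>\<^sup>+u. (\<integral>\<^sup>+z. indicator {0..1} u * indicator {z \<in> D. (norm (z $ j))\<^sup>2 < u} z \<partial>lborel) \<partial>lborel)"
  proof (rule lborel_pair.Fubini')
    have "(\<lambda>p. indicator {0..1} (fst p) * (indicator D (snd p) * indicator {p. (norm (snd p $ j))\<^sup>2 < fst p} p) :: ennreal)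
        \<in> borel_measurable (lborel \<Otimes>\<^sub>M lborel)"
      by measurable
    then show "(\<lambda>(u, z). indicator {0..1} u * indicator {z \<in> D. (norm (z $ j))\<^sup>2 < u} z :: ennreal)
        \<in> borel_measurable (lborel \<Otimes>\<^sub>M lborel)"
      by (rule measurable_cong[THEN iffD1, rotated]) (auto simp: indicator_def)
  qed
  also have "\<dots> = (\<integral>\<^sup>+u. ennreal u * indicator {0..1} u * ennreal (measure lborel D) \<partial>lborel)"
  proof (rule nn_integral_cong)
    fix u :: real
    show "(\<integral>\<^sup>+z. indicator {0..1} u * indicator {z \<in> D. (norm (z $ j))\<^sup>2 < u} z \<partial>lborel) =
      ennreal u * indicator {0..1} u * ennreal (measure lborel D)"
    proof (cases "0 < u \<and> u \<le> 1")
      case True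
      have "{z \<in> D. (norm (z $ j))\<^sup>2 < u} = {z \<in> D. norm (z $ j) < sqrt u}"
        by (auto simp: real_less_rsqrt) (metis norm_ge_zero real_less_rsqrt real_sqrt_less_iff real_sqrt_pow2_iff real_sqrt_unique)+
      then have "emeasure lborel {z \<in> D. (norm (z $ j))\<^sup>2 < u} = ennreal u * ennreal (measure lborel D)"
        using emeasure_polydisc_scaled[of "sqrt u" j] True emeasure_unit_polydisc(1)[where 'n='n] by (simp add: D_def)
      then show ?thesis using True by (simp add: nn_integral_cmult)
    next
      case False
      \<comment> \<open>The scaling lemma needs a positive radius, so u = 0 is treated apart; its
        layer is empty.\<close>
      then consider "u \<notin> {0..1}" | "u = 0" by fastforce
      then show ?thesis
      proof cases
        case 2
        then have "{z \<in> D. (norm (z $ j))\<^sup>2 < u} = {}" by auto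
        then show ?thesis using 2 by simp
      qed simp
    qed
  qed
  also have "\<dots> = (\<integral>\<^sup>+u. ennreal u * indicator {0..1} u \<partial>lborel) * ennreal (measure lborel D)"
    by (rule nn_integral_multc) auto
  also have "(\<integral>\<^sup>+u. ennreal u * indicator {0..1} u \<partial>lborel) = ennreal (1\<^sup>2 / 2 - 0\<^sup>2 / 2)"
    by (rule nn_integral_FTC_Icc[where F = "\<lambda>u. u\<^sup>2 / 2"]) (auto intro!: derivative_eq_intros)
  also have "ennreal (1\<^sup>2 / 2 - 0\<^sup>2 / 2) * ennreal (measure lborel D) = ennreal (measure lborel D / 2)"
    by (subst ennreal_mult[symmetric]) auto
  finally have nn: "(\<integral>\<^sup>+z. ennreal (indicator D z * (1 - (norm (z $ j))\<^sup>2)) \<partial>lborel) = ennreal (measure lborel D / 2)" .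
  have "(\<integral>z. indicator D z * (1 - (norm (z $ j))\<^sup>2) \<partial>lborel) = measure lborel D / 2"
  proof (subst integral_eq_nn_integral)
    show "AE z in lborel. 0 \<le> indicator D z * (1 - (norm (z $ j))\<^sup>2)"
      using lt by (intro AE_I2) (auto simp: indicator_def less_imp_le)
  qed (simp_all add: nn)
  moreover have "(\<integral>z. indicator D z * (1 - (norm (z $ j))\<^sup>2) \<partial>lborel) = (\<integral>z. indicator D z - indicator D z * (norm (z $ j))\<^sup>2 \<partial>lborel)"
    by (simp add: algebra_simps)
  moreover have "\<dots> = measure lborel D - (\<integral>z. indicator D z * (norm (z $ j))\<^sup>2 \<partial>lborel)"
    using intD int by simp
  ultimately show "(\<integral>z. indicator D z * (norm (z $ j))\<^sup>2 \<partial>lborel) = measure lborel D / 2" by simp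
qed

section \<open>Mass of the rotation invariant weight and its logarithm\<close>

text \<open>Here \<open>\<kappa>\<close> stands for c |t_j|^2, of either sign. By
  \<open>polydisc_submean\<close>, the reciprocal is the kernel at the origin for the weight
  \<open>\<kappa>\<close> |z_j|^2.\<close>

definition gaussian_mass :: "'n::finite \<Rightarrow> real \<Rightarrow> real" where
  "gaussian_mass j \<kappa> = (\<integral>z. indicator (unit_polydisc :: (complex ^ 'n) set) z * exp (- \<kappa> * (norm (z $ j))\<^sup>2) \<partial>lborel)"

lemma gaussian_integrable:
  fixes j :: "'n::finite"
  shows "integrable lborel (\<lambda>z. indicator (unit_polydisc :: (complex ^ 'n) set) z * exp (- \<kappa> * (norm (z $ j))\<^sup>2))"
proof (rule Bochner_Integration.integrable_bound)
  let ?D = "unit_polydisc :: (complex ^ 'n) set"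
  have [measurable]: "(\<lambda>z :: complex ^ 'n. z $ j) \<in> borel_measurable borel"
    by (intro borel_measurable_continuous_onI continuous_intros)
  show "integrable lborel (\<lambda>z. exp \<bar>\<kappa>\<bar> * indicator ?D z)"
    using integrable_indicator_unit_polydisc[where 'n='n] by simp
  show "(\<lambda>z. indicator ?D z * exp (- \<kappa> * (norm (z $ j))\<^sup>2)) \<in> borel_measurable lborel" by measurable
  have "norm (indicator ?D z * exp (- \<kappa> * (norm (z $ j))\<^sup>2)) \<le> norm (exp \<bar>\<kappa>\<bar> * indicator ?D z)" for z
  proof (cases "z \<in> ?D")
    case True
    have "- \<kappa> * (norm (z $ j))\<^sup>2 \<le> \<bar>\<kappa>\<bar> * 1"
      using norm_nth_unit_polydisc[OF True, of j] by (intro mult_mono) auto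
    then show ?thesis using True by simp
  qed simp
  then show "AE z in lborel. norm (indicator ?D z * exp (- \<kappa> * (norm (z $ j))\<^sup>2)) \<le> norm (exp \<bar>\<kappa>\<bar> * indicator ?D z)"
    by (intro AE_I2)
qed

lemma nn_integral_gaussian:
  fixes j :: "'n::finite"
  shows "(\<integral>\<^sup>+z\<in>(unit_polydisc :: (complex ^ 'n) set). ennreal (exp (- \<kappa> * (norm (z $ j))\<^sup>2)) \<partial>lborel) = ennreal (gaussian_mass j \<kappa>)"
proof -
  let ?D = "unit_polydisc :: (complex ^ 'n) set"
  have "(\<integral>\<^sup>+z\<in>?D. ennreal (exp (- \<kappa> * (norm (z $ j))\<^sup>2)) \<partial>lborel) = (\<integral>\<^sup>+z. ennreal (indicator ?D z * exp (- \<kappa> * (norm (z $ j))\<^sup>2)) \<partial>lborel)"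
    by (intro nn_integral_cong) (auto simp: indicator_def)
  also have "\<dots> = ennreal (gaussian_mass j \<kappa>)"
    unfolding gaussian_mass_def by (intro nn_integral_eq_integral gaussian_integrable AE_I2) simp
  finally show ?thesis .
qed

text \<open>The upper bound inverts exp (-x) >= 1 - x; the range of x keeps both 1 - x and 1 - 2 x
  from being negative.\<close>

lemma exp_second_order_bounds:
  fixes x :: real
  assumes "\<bar>x\<bar> \<le> 1/2"
  shows "1 + x \<le> exp x" "exp x \<le> 1 + x + 2 * x\<^sup>2"
proof -
  show "1 + x \<le> exp x" by (rule exp_ge_add_one_self)
  have "1 - x \<le> exp (- x)" using exp_ge_add_one_self[of "- x"] by simp
  moreover have "1 - x > 0" using assms by simp
  ultimately have "exp x \<le> 1 / (1 - x)" by (simp add: exp_minus field_simps)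
  also have "\<dots> \<le> 1 + x + 2 * x\<^sup>2"
  proof -
    have "0 \<le> x\<^sup>2 * (1 - 2 * x)" using assms by (intro mult_nonneg_nonneg) auto
    then have "1 \<le> (1 + x + 2 * x\<^sup>2) * (1 - x)" by (simp add: algebra_simps power2_eq_square)
    then show ?thesis using \<open>1 - x > 0\<close> by (simp add: pos_divide_le_eq)
  qed
  finally show "exp x \<le> 1 + x + 2 * x\<^sup>2" .
qed

text \<open>The exponential bounds are integrated at x = -\<open>\<kappa>\<close> |z_j|^2: the
  second moment gives the linear term, and |z_j| < 1 turns the quadratic error into 2
  \<open>\<kappa>\<close>^2.\<close>

lemma gaussian_mass_bounds:
  fixes j :: "'n::finite"
  assumes \<kappa>: "\<bar>\<kappa>\<bar> \<le> 1/2"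
  defines "V \<equiv> measure lborel (unit_polydisc :: (complex ^ 'n) set)"
  shows "V * (1 - \<kappa> / 2) \<le> gaussian_mass j \<kappa>" "gaussian_mass j \<kappa> \<le> V * (1 - \<kappa> / 2 + 2 * \<kappa>\<^sup>2)"
proof -
  let ?D = "unit_polydisc :: (complex ^ 'n) set"
  let ?i = "indicator ?D :: complex ^ 'n \<Rightarrow> real"
  note int = integrable_indicator_unit_polydisc[where 'n='n] polydisc_second_moment(2)[of j]
  have i1: "integrable lborel (\<lambda>z. ?i z - \<kappa> * (?i z * (norm (z $ j))\<^sup>2))" using int by simp
  have i2: "integrable lborel (\<lambda>z. ?i z - \<kappa> * (?i z * (norm (z $ j))\<^sup>2) + 2 * \<kappa>\<^sup>2 * ?i z)" using int by simp
  have e1: "(\<integral>z. ?i z - \<kappa> * (?i z * (norm (z $ j))\<^sup>2) \<partial>lborel) = V * (1 - \<kappa> / 2)"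
    using int polydisc_second_moment(1)[of j] by (simp add: V_def algebra_simps)
  have e2: "(\<integral>z. ?i z - \<kappa> * (?i z * (norm (z $ j))\<^sup>2) + 2 * \<kappa>\<^sup>2 * ?i z \<partial>lborel) = V * (1 - \<kappa> / 2 + 2 * \<kappa>\<^sup>2)"
    using int i1 e1 by (simp add: V_def algebra_simps)
  have pw: "?i z - \<kappa> * (?i z * (norm (z $ j))\<^sup>2) \<le> ?i z * exp (- \<kappa> * (norm (z $ j))\<^sup>2)"
    "?i z * exp (- \<kappa> * (norm (z $ j))\<^sup>2) \<le> ?i z - \<kappa> * (?i z * (norm (z $ j))\<^sup>2) + 2 * \<kappa>\<^sup>2 * ?i z" for z
  proof -
    have *: "1 - \<kappa> * (norm (z $ j))\<^sup>2 \<le> exp (- \<kappa> * (norm (z $ j))\<^sup>2) \<and>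
        exp (- \<kappa> * (norm (z $ j))\<^sup>2) \<le> 1 - \<kappa> * (norm (z $ j))\<^sup>2 + 2 * \<kappa>\<^sup>2" if "z \<in> ?D"
    proof -
      define q where "q = (norm (z $ j))\<^sup>2"
      have q: "0 \<le> q" "q \<le> 1" using norm_nth_unit_polydisc[OF that, of j] by (auto simp: q_def)
      have "\<bar>- \<kappa> * q\<bar> \<le> 1/2 * 1" unfolding abs_mult using \<kappa> q by (intro mult_mono) auto
      then have b: "\<bar>- \<kappa> * q\<bar> \<le> 1/2" by simp
      have "(- \<kappa> * q)\<^sup>2 = \<kappa>\<^sup>2 * q\<^sup>2" by (simp add: power_mult_distrib)
      also have "\<dots> \<le> \<kappa>\<^sup>2 * 1" using q by (intro mult_left_mono) (auto simp: power_le_one)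
      finally show ?thesis using exp_second_order_bounds[OF b] unfolding q_def[symmetric] by auto
    qed
    show "?i z - \<kappa> * (?i z * (norm (z $ j))\<^sup>2) \<le> ?i z * exp (- \<kappa> * (norm (z $ j))\<^sup>2)"
      "?i z * exp (- \<kappa> * (norm (z $ j))\<^sup>2) \<le> ?i z - \<kappa> * (?i z * (norm (z $ j))\<^sup>2) + 2 * \<kappa>\<^sup>2 * ?i z"
      using * by (cases "z \<in> ?D"; simp)+
  qed
  show "V * (1 - \<kappa> / 2) \<le> gaussian_mass j \<kappa>"
    unfolding e1[symmetric] gaussian_mass_def by (intro integral_mono i1 gaussian_integrable pw)
  show "gaussian_mass j \<kappa> \<le> V * (1 - \<kappa> / 2 + 2 * \<kappa>\<^sup>2)"
    unfolding e2[symmetric] gaussian_mass_def by (intro integral_mono i2 gaussian_integrable pw)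
qed

lemma gaussian_mass_pos:
  fixes j :: "'n::finite"
  assumes \<kappa>: "\<bar>\<kappa>\<bar> \<le> 1/2"
  shows "0 < gaussian_mass j \<kappa>"
proof -
  have "0 < measure lborel (unit_polydisc :: (complex ^ 'n) set) * (1 - \<kappa> / 2)"
    using emeasure_unit_polydisc(2)[where 'n='n] \<kappa> by (intro mult_pos_pos) auto
  also have "\<dots> \<le> gaussian_mass j \<kappa>" by (rule gaussian_mass_bounds[OF \<kappa>])
  finally show ?thesis .
qed

text \<open>With y the relative deviation of the mass from V, both y + \<open>\<kappa>\<close> / 2
  and ln (1 + y) - y have modulus at most 2 \<open>\<kappa>\<close>^2. This gives 4
  \<open>\<kappa>\<close>^2; the constant 7 leaves slack.\<close>

lemma ln_gaussian_mass:
  fixes j :: "'n::finite"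
  assumes \<kappa>: "\<bar>\<kappa>\<bar> \<le> 1/4"
  shows "\<bar>ln (gaussian_mass j \<kappa>) - ln (measure lborel (unit_polydisc :: (complex ^ 'n) set)) + \<kappa> / 2\<bar> \<le> 7 * \<kappa>\<^sup>2"
proof -
  define V where "V = measure lborel (unit_polydisc :: (complex ^ 'n) set)"
  have V: "V > 0" unfolding V_def by (rule emeasure_unit_polydisc)
  define y where "y = gaussian_mass j \<kappa> / V - 1"
  have k2: "\<bar>\<kappa>\<bar> \<le> 1/2" using \<kappa> by simp
  have y1: "- \<kappa> / 2 \<le> y" using gaussian_mass_bounds(1)[OF k2, of j] V by (simp add: y_def V_def[symmetric] field_simps)
  have "gaussian_mass j \<kappa> / V \<le> 1 - \<kappa> / 2 + 2 * \<kappa>\<^sup>2"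
    using gaussian_mass_bounds(2)[OF k2, of j] V by (simp add: V_def[symmetric] pos_divide_le_eq mult.commute)
  then have y2: "y \<le> - \<kappa> / 2 + 2 * \<kappa>\<^sup>2" by (simp add: y_def)
  have "\<kappa>\<^sup>2 = \<bar>\<kappa>\<bar> * \<bar>\<kappa>\<bar>" by (simp add: power2_eq_square)
  also have "\<dots> \<le> \<bar>\<kappa>\<bar> * (1/4)" using \<kappa> by (intro mult_left_mono) auto
  finally have k: "2 * \<kappa>\<^sup>2 \<le> \<bar>\<kappa>\<bar> / 2" by simp
  \<comment> \<open>Puts y in the range |y| <= 1/2 of the library's logarithm estimate.\<close>
  have ay: "\<bar>y\<bar> \<le> \<bar>\<kappa>\<bar>" using y1 y2 k by (simp add: abs_le_iff) (auto simp: abs_if split: if_splits)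
  then have "\<bar>ln (1 + y) - y\<bar> \<le> 2 * y\<^sup>2"
    using abs_ln_one_plus_x_minus_x_bound[of y] \<kappa> by simp
  also have "y\<^sup>2 \<le> \<kappa>\<^sup>2" using ay abs_le_square_iff by blast
  finally have "\<bar>ln (1 + y) - y\<bar> \<le> 2 * \<kappa>\<^sup>2" by simp
  then have "\<bar>ln (1 + y) + \<kappa> / 2\<bar> \<le> 4 * \<kappa>\<^sup>2" using y1 y2 by (simp add: abs_le_iff)
  moreover have "ln (1 + y) = ln (gaussian_mass j \<kappa>) - ln V"
    using V gaussian_mass_pos[OF k2, of j] by (simp add: y_def ln_div)
  moreover have "0 \<le> \<kappa>\<^sup>2" by simp
  ultimately show ?thesis unfolding V_def[symmetric] by linarith
qed

section \<open>The complex Hessian of the kernel\<close>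

lemma holomorphic_several_on_component:
  fixes j :: "'n::finite"
  assumes "g holomorphic_on UNIV"
  shows "holomorphic_several_on S (\<lambda>z. g (z $ j))"
  unfolding holomorphic_several_on_def
proof
  fix z :: "complex ^ 'n"
  obtain g' where g': "(g has_field_derivative g') (at (z $ j))"
    using assms by (auto simp: holomorphic_on_def field_differentiable_def)
  have "((\<lambda>z :: complex ^ 'n. z $ j) has_derivative (\<lambda>v. v $ j)) (at z)"
    by (rule bounded_linear_imp_has_derivative[OF bounded_linear_vec_nth])
  from has_derivative_compose[OF this g'[unfolded has_field_derivative_def]]
  have "((\<lambda>z. g (z $ j)) has_derivative (\<lambda>v. g' * v $ j)) (at z)" .
  then show "\<exists>f'. ((\<lambda>z. g (z $ j)) has_derivative f') (at z) \<and> (\<forall>c v. f' (c *s v) = c * f' v)"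
    by (intro exI[of _ "\<lambda>v. g' * v $ j"]) auto
qed

text \<open>The reason for the halves in the competitors: squaring the modulus of exp (p / 2)
  produces exp (Re p).\<close>

lemma norm_exp_half_power2: "(norm (exp (w / 2)))\<^sup>2 = exp (Re w)"
  by (simp add: power2_eq_square exp_add[symmetric])

text \<open>Multiplying by \<open>exp (\<plusminus>(a s z\<^sub>j + b s\<^sup>2 z\<^sub>j\<^sup>2) / 2)\<close> removes the pluriharmonic part of the weight and does not change
  the value at the origin; the remaining weight is rotation invariant up to the error \<open>\<eta>\<close>.\<close>

lemma log_bergman_axis_bound:
  fixes \<phi> :: "complex ^ 'n::finite \<Rightarrow> real"
  assumes \<phi>: "continuous_on unit_polydisc \<phi>" and s: "norm s < 1/2" and \<kappa>: "\<bar>c * (norm s)\<^sup>2\<bar> \<le> 1/2" and "0 \<le> \<eta>"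
    and expansion: "\<And>\<zeta>. norm \<zeta> \<le> norm s \<Longrightarrow>
      \<bar>\<phi> (axis j \<zeta>) - \<phi> 0 - Re (a * \<zeta> + b * \<zeta>\<^sup>2) - c * (norm \<zeta>)\<^sup>2\<bar> \<le> \<eta> * (norm \<zeta>)\<^sup>2"
  shows "\<bar>log_bergman \<phi> (axis j s) 0 - \<phi> 0 + ln (gaussian_mass j (c * (norm s)\<^sup>2))\<bar> \<le> \<eta> * (norm s)\<^sup>2"
proof -
  let ?D = "unit_polydisc :: (complex ^ 'n) set"
  let ?t = "axis j s :: complex ^ 'n"
  define \<tau> where "\<tau> = (norm s)\<^sup>2"
  define I where "I = gaussian_mass j (c * \<tau>)"
  have I: "I > 0" unfolding I_def \<tau>_def by (rule gaussian_mass_pos[OF \<kappa>])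
  define u where "u = dilate ?t \<phi>"
  define p where "p = (\<lambda>w. a * (s * w) + b * (s * w)\<^sup>2)"
  have t: "?t \<in> ball 0 (1/2)" using s by (simp add: norm_axis_complex)
  obtain M where "bounded_weight (\<lambda>z. exp (- dilate ?t \<phi> z)) M"
    by (rule dilate_weight[OF \<phi> t])
  then have M: "bounded_weight (\<lambda>z. exp (- u z)) M" unfolding u_def .
  obtain m where m': "0 < m" "\<And>t z. t \<in> ball 0 (1/2) \<Longrightarrow> z \<in> ?D \<Longrightarrow> m \<le> exp (- dilate t \<phi> z)"
    by (rule dilate_weight_lower[OF \<phi>], rule that)
  have m: "0 < m" "\<And>z. z \<in> ?D \<Longrightarrow> m \<le> exp (- u z)" unfolding u_def using m' t by blast+
  have cu: "continuous_on ?D u"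
    unfolding u_def dilate_eq by (rule continuous_on_coord_mult_compose[OF \<phi> t])
  have u_eq: "u z = \<phi> (axis j (s * z $ j))" for z
  proof -
    have "coord_mult ?t z = axis j (s * z $ j)" by (auto simp: vec_eq_iff axis_def)
    then show ?thesis by (simp add: u_def dilate_eq)
  qed
  have u_bound: "\<bar>u z - \<phi> 0 - Re (p (z $ j)) - c * \<tau> * (norm (z $ j))\<^sup>2\<bar> \<le> \<eta> * \<tau>" if "z \<in> ?D" for z
  proof -
    have n: "norm (s * z $ j) \<le> norm s"
      using that by (simp add: norm_mult unit_polydisc_def mult_left_le less_imp_le)
    have "\<bar>u z - \<phi> 0 - Re (p (z $ j)) - c * (norm (s * z $ j))\<^sup>2\<bar> \<le> \<eta> * (norm (s * z $ j))\<^sup>2"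
      using expansion[OF n] by (simp add: u_eq p_def)
    also have "\<dots> \<le> \<eta> * \<tau>" unfolding \<tau>_def using n \<open>0 \<le> \<eta>\<close> by (intro mult_left_mono power_mono) auto
    finally show ?thesis by (simp add: norm_mult power_mult_distrib \<tau>_def mult.assoc)
  qed
  have hol: "holomorphic_several_on ?D (\<lambda>z. exp (p (z $ j) / 2))" "holomorphic_several_on ?D (\<lambda>z. exp (- p (z $ j) / 2))"
  proof -
    have "p holomorphic_on UNIV" unfolding p_def by (intro holomorphic_intros)
    then have *: "(\<lambda>w. exp (p w / 2)) holomorphic_on UNIV" "(\<lambda>w. exp (- p w / 2)) holomorphic_on UNIV"
      by (auto intro!: holomorphic_intros)
    show "holomorphic_several_on ?D (\<lambda>z. exp (p (z $ j) / 2))" "holomorphic_several_on ?D (\<lambda>z. exp (- p (z $ j) / 2))"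
      using holomorphic_several_on_component[OF *(1)] holomorphic_several_on_component[OF *(2)] .
  qed
  have [measurable]: "(\<lambda>z :: complex ^ 'n. z $ j) \<in> borel_measurable borel"
    by (intro borel_measurable_continuous_onI continuous_intros)
  have upper: "bergman_kernel u ?D 0 \<le> exp (\<phi> 0 + \<eta> * \<tau>) / I"
  proof (rule bergman_kernel_upper)
    fix f assume f: "admissible u f"
    define h where "h = (\<lambda>z. f z * exp (- p (z $ j) / 2))"
    have hh: "holomorphic_several_on ?D h"
      unfolding h_def using f by (intro holomorphic_several_on_mult hol(2)) (simp add: admissible_def)
    have h0: "h 0 = f 0" by (simp add: h_def p_def)
    have "continuous_on ?D (\<lambda>z. (norm (f z))\<^sup>2 * exp (- u z))"
      using f cu by (intro continuous_intros holomorphic_several_on_continuous_on) (simp_all add: admissible_def)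
    from measurable_compose[OF borel_measurable_continuous_on_indicator[OF unit_polydisc_borel this] measurable_ennreal]
    have meas: "(\<lambda>z. ennreal ((norm (f z))\<^sup>2 * exp (- u z)) * indicator ?D z) \<in> borel_measurable borel"
      by (rule measurable_cong[THEN iffD1, rotated]) (auto simp: indicator_def)
    \<comment> \<open>Here constants are seen to be extremal: any h has at least the weighted mass
      of the constant h 0.\<close>
    have "ennreal ((norm (h 0))\<^sup>2) * (\<integral>\<^sup>+z\<in>?D. ennreal (exp (- (c * \<tau>) * (norm (z $ j))\<^sup>2)) \<partial>lborel) \<le>
        (\<integral>\<^sup>+z\<in>?D. ennreal ((norm (h z))\<^sup>2) * ennreal (exp (- (c * \<tau>) * (norm (z $ j))\<^sup>2)) \<partial>lborel)"
      by (rule polydisc_submean[OF hh]) (auto simp: norm_mult)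
    then have "ennreal ((norm (f 0))\<^sup>2 * I) \<le> (\<integral>\<^sup>+z\<in>?D. ennreal ((norm (h z))\<^sup>2) * ennreal (exp (- (c * \<tau>) * (norm (z $ j))\<^sup>2)) \<partial>lborel)"
      unfolding nn_integral_gaussian h0 I_def[symmetric] using I by (simp add: ennreal_mult)
    also have "\<dots> \<le> (\<integral>\<^sup>+z. ennreal (exp (\<phi> 0 + \<eta> * \<tau>)) * (ennreal ((norm (f z))\<^sup>2 * exp (- u z)) * indicator ?D z) \<partial>lborel)"
    proof (rule nn_integral_mono)
      fix z
      show "ennreal ((norm (h z))\<^sup>2) * ennreal (exp (- (c * \<tau>) * (norm (z $ j))\<^sup>2)) * indicator ?D z
        \<le> ennreal (exp (\<phi> 0 + \<eta> * \<tau>)) * (ennreal ((norm (f z))\<^sup>2 * exp (- u z)) * indicator ?D z)"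
      proof (cases "z \<in> ?D")
        case True
        have "(norm (h z))\<^sup>2 * exp (- (c * \<tau>) * (norm (z $ j))\<^sup>2) = (norm (f z))\<^sup>2 * exp (- Re (p (z $ j)) - c * \<tau> * (norm (z $ j))\<^sup>2)"
        proof -
          have "(norm (h z))\<^sup>2 = (norm (f z))\<^sup>2 * exp (- Re (p (z $ j)))"
            by (simp only: h_def norm_mult power_mult_distrib norm_exp_half_power2 uminus_complex.sel)
          then show ?thesis by (simp add: mult.assoc exp_add[symmetric])
        qed
        also have "\<dots> \<le> (norm (f z))\<^sup>2 * exp (\<phi> 0 + \<eta> * \<tau> - u z)"
          using u_bound[OF True] by (intro mult_left_mono) (auto simp: abs_le_iff)
        also have "\<dots> = exp (\<phi> 0 + \<eta> * \<tau>) * ((norm (f z))\<^sup>2 * exp (- u z))"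
          by (simp add: exp_diff exp_minus field_simps)
        finally show ?thesis using True by (simp add: ennreal_mult'[symmetric] ennreal_leI)
      qed simp
    qed
    also have "\<dots> = ennreal (exp (\<phi> 0 + \<eta> * \<tau>)) * (\<integral>\<^sup>+z\<in>?D. ennreal ((norm (f z))\<^sup>2 * exp (- u z)) \<partial>lborel)"
      using meas by (subst nn_integral_cmult) auto
    also have "\<dots> \<le> ennreal (exp (\<phi> 0 + \<eta> * \<tau>)) * 1"
      using f by (intro mult_left_mono) (auto simp: admissible_def)
    finally have "(norm (f 0))\<^sup>2 * I \<le> exp (\<phi> 0 + \<eta> * \<tau>)" by simp
    then show "(norm (f 0))\<^sup>2 \<le> exp (\<phi> 0 + \<eta> * \<tau>) / I" using I by (simp add: field_simps)
  qed
  have lower: "exp (\<phi> 0 - \<eta> * \<tau>) / I \<le> bergman_kernel u ?D 0"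
  proof -
    \<comment> \<open>The factor 1 / I normalises the Gaussian mass; the exponential absorbs the
      constant term of the weight and its error.\<close>
    define l where "l = sqrt (exp (\<phi> 0 - \<eta> * \<tau>) / I)"
    have l: "l > 0" "l\<^sup>2 = exp (\<phi> 0 - \<eta> * \<tau>) / I" using I by (auto simp: l_def)
    define f where "f = (\<lambda>z. of_real l * exp (p (z $ j) / 2))"
    have f0: "(norm (f 0))\<^sup>2 = exp (\<phi> 0 - \<eta> * \<tau>) / I" by (simp add: f_def p_def norm_mult power_mult_distrib l)
    have "(\<integral>\<^sup>+z\<in>?D. ennreal ((norm (f z))\<^sup>2 * exp (- u z)) \<partial>lborel) \<le>
        (\<integral>\<^sup>+z. ennreal (1 / I) * (ennreal (exp (- (c * \<tau>) * (norm (z $ j))\<^sup>2)) * indicator ?D z) \<partial>lborel)"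
    proof (rule nn_integral_mono)
      fix z
      show "ennreal ((norm (f z))\<^sup>2 * exp (- u z)) * indicator ?D z \<le> ennreal (1 / I) * (ennreal (exp (- (c * \<tau>) * (norm (z $ j))\<^sup>2)) * indicator ?D z)"
      proof (cases "z \<in> ?D")
        case True
        have "(norm (f z))\<^sup>2 * exp (- u z) = (1 / I) * (exp (\<phi> 0 - \<eta> * \<tau>) * exp (Re (p (z $ j))) * exp (- u z))"
          by (simp only: f_def norm_mult power_mult_distrib norm_exp_half_power2 norm_of_real power2_abs l(2)) simp
        also have "\<dots> = (1 / I) * exp (\<phi> 0 - \<eta> * \<tau> + Re (p (z $ j)) - u z)"
          by (simp add: exp_add exp_diff exp_minus field_simps)
        also have "\<dots> \<le> (1 / I) * exp (- (c * \<tau>) * (norm (z $ j))\<^sup>2)"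
          using u_bound[OF True] I by (intro mult_left_mono) (auto simp: abs_le_iff)
        finally show ?thesis using True I by (simp add: ennreal_mult'[symmetric] ennreal_leI)
      qed simp
    qed
    also have "\<dots> = ennreal (1 / I) * ennreal I"
      unfolding I_def nn_integral_gaussian[symmetric] by (rule nn_integral_cmult) measurable
    also have "\<dots> = 1" using I by (simp add: ennreal_mult[symmetric])
    finally have "admissible u f"
      unfolding admissible_def f_def by (intro conjI holomorphic_several_on_mult holomorphic_several_on_const hol(1))
    from bergman_kernel_lower[OF M m this] show ?thesis by (simp add: f0)
  qed
  have pos: "0 < exp (\<phi> 0 - \<eta> * \<tau>) / I" using I by simp
  have "log_bergman \<phi> ?t 0 = ln (bergman_kernel u ?D 0)" by (simp add: log_bergman_def u_def)
  moreover have "ln (bergman_kernel u ?D 0) \<le> ln (exp (\<phi> 0 + \<eta> * \<tau>) / I)"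
    using upper lower pos by simp
  moreover have "ln (exp (\<phi> 0 - \<eta> * \<tau>) / I) \<le> ln (bergman_kernel u ?D 0)"
    using lower pos by simp
  ultimately show ?thesis
    using I by (simp add: ln_div I_def[symmetric] \<tau>_def[symmetric] abs_le_iff)
qed

section \<open>Second derivatives of the log-kernel at the origin\<close>

text \<open>On the axis the log-kernel is \<open>\<phi>\<close> 0 - ln V + (c / 2) s^2 + o(s^2), the
  quadratic term being that of the Gaussian logarithm; doubling its coefficient gives c. The
  direction enters only through its modulus.\<close>

lemma log_bergman_axis_second_derivative:
  fixes \<phi> :: "complex ^ 'n::finite \<Rightarrow> real"
  assumes \<phi>: "smooth_on unit_polydisc \<phi>" and \<omega>: "norm \<omega> = 1"
  shows "second_derivative (\<lambda>t. log_bergman \<phi> t 0) (axis j \<omega>) (axis j \<omega>) 0 = Re (complex_hessian \<phi> 0 $ j $ j)"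
proof -
  let ?F = "\<lambda>t. log_bergman \<phi> t 0" and ?U = "ball (0 :: complex ^ 'n) (1/2)"
  define c where "c = Re (complex_hessian \<phi> 0 $ j $ j)"
  have cont: "continuous_on unit_polydisc \<phi>" by (rule smooth_on_imp_continuous_on[OF \<phi>])
  have C2: "Ck_on (Suc (Suc 0)) unit_polydisc \<phi>" using \<phi> unfolding smooth_on_def by blast
  have FC2: "Ck_on (Suc (Suc 0)) ?U ?F" using smooth_on_log_bergman[OF \<phi>] unfolding smooth_on_def by blast
  obtain a b where ab: "\<And>\<eta>. 0 < \<eta> \<Longrightarrow> \<exists>\<delta>>0. \<forall>\<zeta>. norm \<zeta> < \<delta> \<longrightarrow>
    \<bar>\<phi> (axis j \<zeta>) - \<phi> 0 - Re (a * \<zeta> + b * \<zeta>\<^sup>2) - c * (norm \<zeta>)\<^sup>2\<bar> \<le> \<eta> * (norm \<zeta>)\<^sup>2"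
    using coordinate_line_expansion[OF open_unit_polydisc zero_in_unit_polydisc C2, of j] unfolding c_def by blast
  define V where "V = measure lborel (unit_polydisc :: (complex ^ 'n) set)"
  have "second_derivative ?F (axis j \<omega>) (axis j \<omega>) 0 = 2 * (c / 2)"
  proof (rule second_derivative_from_expansion[OF open_ball _ FC2])
    fix \<eta> :: real assume "0 < \<eta>"
    \<comment> \<open>One half of \<open>\<eta>\<close> pays for the Taylor error of
      \<open>\<phi>\<close>, the other for the error in \<open>ln_gaussian_mass\<close>.\<close>
    then have "0 < \<eta> / 2" by simp
    from ab[OF this] obtain \<delta> where \<delta>: "\<delta> > 0" "\<And>\<zeta>. norm \<zeta> < \<delta> \<Longrightarrow>
      \<bar>\<phi> (axis j \<zeta>) - \<phi> 0 - Re (a * \<zeta> + b * \<zeta>\<^sup>2) - c * (norm \<zeta>)\<^sup>2\<bar> \<le> \<eta> / 2 * (norm \<zeta>)\<^sup>2" by blast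
    \<comment> \<open>C dominates |c|, which keeps |c s^2| below 1/4, and 28 c^2, where 28 is 4
      times the 7 of \<open>ln_gaussian_mass\<close>; the 1 makes division by C safe.\<close>
    define C where "C = 28 * c\<^sup>2 + \<bar>c\<bar> + 1"
    have C: "C \<ge> 1" by (simp add: C_def)
    define d where "d = min (min \<delta> (1/2)) (min (1 / (4 * C)) (\<eta> / C))"
    have d: "d > 0" using \<delta> \<open>0 < \<eta>\<close> C by (simp add: d_def)
    have bound: "\<bar>?F (s *\<^sub>R axis j \<omega>) - \<phi> 0 + ln V - c / 2 * s\<^sup>2\<bar> \<le> \<eta> * s\<^sup>2" if s: "\<bar>s\<bar> < d" for s :: real
    proof -
      define z where "z = of_real s * \<omega>"
      have nz: "norm z = \<bar>s\<bar>" using \<omega> by (simp add: z_def norm_mult)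
      have sz: "s *\<^sub>R axis j \<omega> = axis j z" by (simp add: vec_eq_iff axis_def z_def scaleR_conv_of_real[of s \<omega>])
      have s1: "\<bar>s\<bar> < 1/2" "\<bar>s\<bar> < \<delta>" "\<bar>s\<bar> \<le> 1 / (4 * C)" "\<bar>s\<bar> \<le> \<eta> / C" using s by (auto simp: d_def)
      have s2: "s\<^sup>2 \<le> \<bar>s\<bar>"
      proof -
        have "\<bar>s\<bar> * \<bar>s\<bar> \<le> \<bar>s\<bar> * 1" using s1 by (intro mult_left_mono) auto
        then show ?thesis by (simp add: power2_eq_square)
      qed
      have "C * s\<^sup>2 \<le> C * (1 / (4 * C))" using s2 s1 C by (intro mult_left_mono) auto
      then have C1: "C * s\<^sup>2 \<le> 1/4" using C by simp
      have "C * s\<^sup>2 \<le> C * (\<eta> / C)" using s2 s1 C by (intro mult_left_mono) auto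
      then have C2: "C * s\<^sup>2 \<le> \<eta>" using C by simp
      have "\<bar>c\<bar> * s\<^sup>2 \<le> C * s\<^sup>2" by (intro mult_right_mono) (auto simp: C_def)
      then have k: "\<bar>c * s\<^sup>2\<bar> \<le> 1/4" using C1 by (simp add: abs_mult)
      have 1: "\<bar>?F (axis j z) - \<phi> 0 + ln (gaussian_mass j (c * (norm z)\<^sup>2))\<bar> \<le> \<eta> / 2 * (norm z)\<^sup>2"
      proof (rule log_bergman_axis_bound[OF cont, where a = a and b = b])
        show "norm z < 1/2" "\<bar>c * (norm z)\<^sup>2\<bar> \<le> 1/2" "0 \<le> \<eta> / 2" using s1 k \<open>0 < \<eta>\<close> by (auto simp: nz)
        show "\<bar>\<phi> (axis j \<zeta>) - \<phi> 0 - Re (a * \<zeta> + b * \<zeta>\<^sup>2) - c * (norm \<zeta>)\<^sup>2\<bar> \<le> \<eta> / 2 * (norm \<zeta>)\<^sup>2"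
          if "norm \<zeta> \<le> norm z" for \<zeta>
          using that s1 by (intro \<delta>(2)) (simp add: nz)
      qed
      have 2: "\<bar>ln (gaussian_mass j (c * s\<^sup>2)) - ln V + c * s\<^sup>2 / 2\<bar> \<le> 7 * (c * s\<^sup>2)\<^sup>2"
        unfolding V_def by (rule ln_gaussian_mass[OF k])
      have "7 * (c * s\<^sup>2)\<^sup>2 = (28 * c\<^sup>2 * s\<^sup>2) * s\<^sup>2 / 4" by (simp add: power2_eq_square)
      also have "28 * c\<^sup>2 * s\<^sup>2 \<le> C * s\<^sup>2" by (intro mult_right_mono) (auto simp: C_def)
      also have "C * s\<^sup>2 \<le> \<eta>" by (rule C2)
      finally have "7 * (c * s\<^sup>2)\<^sup>2 \<le> \<eta> * s\<^sup>2 / 4"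
        by (simp add: mult_right_mono divide_right_mono)
      moreover have "0 \<le> \<eta> * s\<^sup>2" using \<open>0 < \<eta>\<close> by simp
      ultimately have 3: "7 * (c * s\<^sup>2)\<^sup>2 \<le> \<eta> / 2 * s\<^sup>2" by simp
      have "c / 2 * s\<^sup>2 = c * s\<^sup>2 / 2" "\<eta> * s\<^sup>2 = \<eta> / 2 * s\<^sup>2 + \<eta> / 2 * s\<^sup>2" by simp_all
      then show ?thesis using 1 2 3 unfolding sz nz power2_abs by linarith
    qed
    \<comment> \<open>At s = 0 the error bound is zero, which identifies the constant term of the
      expansion.\<close>
    have "?F 0 = \<phi> 0 - ln V" using bound[of 0] d by simp
    then have "\<bar>?F (s *\<^sub>R axis j \<omega>) - ?F 0 - c / 2 * s\<^sup>2\<bar> \<le> \<eta> * s\<^sup>2" if "\<bar>s\<bar> < d" for s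
      using bound[OF that] by (simp add: algebra_simps)
    then show "\<exists>\<delta>>0. \<forall>s. \<bar>s\<bar> < \<delta> \<longrightarrow> \<bar>?F (s *\<^sub>R axis j \<omega>) - ?F 0 - c / 2 * s\<^sup>2\<bar> \<le> \<eta> * s\<^sup>2"
      using d by blast
  qed simp
  then show ?thesis by (simp add: c_def)
qed

text \<open>With x and y arbitrary, all four real second derivatives that make up the (j, k) entry
  of the Hessian vanish.\<close>

lemma log_bergman_mixed_second_derivative:
  fixes \<phi> :: "complex ^ 'n::finite \<Rightarrow> real"
  assumes \<phi>: "smooth_on unit_polydisc \<phi>" and "j \<noteq> k"
  shows "second_derivative (\<lambda>t. log_bergman \<phi> t 0) (axis k x) (axis j y) 0 = 0"
proof -
  let ?F = "\<lambda>t. log_bergman \<phi> t 0" and ?U = "ball (0 :: complex ^ 'n) (1/2)"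
  define s :: "complex ^ 'n" where "s = (\<chi> i. if i = j then -1 else 1)"
  have sgn: "s $ i = 1 \<or> s $ i = -1" for i by (simp add: s_def)
  have n: "norm (s $ i) = 1" for i using sgn[of i] by auto
  have C2: "Ck_on (Suc (Suc 0)) ?U ?F" using smooth_on_log_bergman[OF \<phi>] unfolding smooth_on_def by blast
  have cont: "continuous_on unit_polydisc \<phi>" by (rule smooth_on_imp_continuous_on[OF \<phi>])
  have sU: "coord_mult s t \<in> ?U" if "t \<in> ?U" for t
    using that orthogonal_transformation_norm[OF orthogonal_transformation_coord_mult[OF n]] by simp
  have "second_derivative ?F (axis k x) (axis j y) 0 = second_derivative ?F (coord_mult s (axis k x)) (coord_mult s (axis j y)) 0"
    by (rule second_derivative_linear_invariant[OF open_ball _ C2 coord_mult.bounded_linear_right sU log_bergman_sign_invariant[OF cont _ sgn]]) auto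
  also have "coord_mult s (axis k x) = axis k x" using \<open>j \<noteq> k\<close> by (auto simp: vec_eq_iff s_def axis_def)
  also have "coord_mult s (axis j y) = - axis j y" by (auto simp: vec_eq_iff s_def axis_def)
  also have "second_derivative ?F (axis k x) (- axis j y) 0 = - second_derivative ?F (axis k x) (axis j y) 0"
  proof -
    have "((\<lambda>t. frechet_derivative ?F (at t) (axis k x)) has_derivative (\<lambda>v. second_derivative ?F (axis k x) v 0)) (at 0)"
      by (rule Ck_on_has_derivative[OF Ck_on_frechet_derivative[OF C2]]) simp
    then show ?thesis using has_derivative_linear linear_neg by blast
  qed
  finally show ?thesis by simp
qed

lemma complex_hessian_log_bergman:
  fixes \<phi> :: "complex ^ 'n::finite \<Rightarrow> real"
  assumes \<phi>: "smooth_on unit_polydisc \<phi>"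
  shows "complex_hessian (\<lambda>t. log_bergman \<phi> t 0) 0 $ j $ k = (if j = k then 1 / 2 * complex_hessian \<phi> 0 $ j $ j else 0)"
proof -
  have C2: "Ck_on (Suc (Suc 0)) (ball 0 (1/2)) (\<lambda>t. log_bergman \<phi> t 0)"
    using smooth_on_log_bergman[OF \<phi>] unfolding smooth_on_def by blast
  have \<phi>C2: "Ck_on (Suc (Suc 0)) unit_polydisc \<phi>" using \<phi> unfolding smooth_on_def by blast
  have 0: "(0 :: complex ^ 'n) \<in> ball 0 (1/2)" by simp
  show ?thesis
  proof (cases "j = k")
    case True
    have "complex_hessian \<phi> 0 $ j $ j = complex_of_real (Re (complex_hessian \<phi> 0 $ j $ j))"
      unfolding complex_hessian_diagonal[OF open_unit_polydisc zero_in_unit_polydisc \<phi>C2] by simp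
    \<comment> \<open>The directions 1 and \<open>\<i>\<close> each contribute the real part of the
      entry for \<open>\<phi>\<close>; the division by 4 in \<open>complex_hessian_diagonal\<close>
      leaves half of it.\<close>
    then show ?thesis
      using True log_bergman_axis_second_derivative[OF \<phi>, of 1 j] log_bergman_axis_second_derivative[OF \<phi>, of \<i> j]
      by (simp add: complex_hessian_diagonal[OF open_ball 0 C2])
  next
    case False
    then show ?thesis
      by (simp add: complex_hessian_eq[OF open_ball 0 C2] log_bergman_mixed_second_derivative[OF \<phi>])
  qed
qed

theorem theorem1p4:
  fixes \<phi> :: "complex ^ 'n \<Rightarrow> real"
  assumes smooth: "smooth_on unit_polydisc \<phi>"
    and psh: "plurisubharmonic_on unit_polydisc \<phi>"
  shows "(\<exists>U. open U \<and> 0 \<in> U \<and> smooth_on U (\<lambda>t. log_bergman \<phi> t 0)) \<and>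
         (\<forall>j k. ((\<lambda>t. complex_hessian (\<lambda>s. log_bergman \<phi> s 0) t $ j $ k) \<longlongrightarrow>
                   (if j = k then 1 / 2 * complex_hessian \<phi> 0 $ j $ j else 0)) (at 0)) \<and>
         (strictly_plurisubharmonic_at \<phi> 0 \<longrightarrow>
            strictly_plurisubharmonic_at (\<lambda>t. log_bergman \<phi> t 0) 0)"
proof (intro conjI allI impI)
  let ?F = "\<lambda>t. log_bergman \<phi> t 0" and ?U = "ball (0 :: complex ^ 'n) (1/2)"
  have F: "smooth_on ?U ?F" by (rule smooth_on_log_bergman[OF smooth])
  then have C2: "Ck_on (Suc (Suc 0)) ?U ?F" unfolding smooth_on_def by blast
  show U: "\<exists>U. open U \<and> 0 \<in> U \<and> smooth_on U ?F" using F by (intro exI[of _ ?U]) simp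
  \<comment> \<open>The Hessian of a C^2 function is continuous, so the limit is its value at
    0.\<close>
  show "((\<lambda>t. complex_hessian ?F t $ j $ k) \<longlongrightarrow> (if j = k then 1 / 2 * complex_hessian \<phi> 0 $ j $ j else 0)) (at 0)" for j k
    using complex_hessian_tendsto[OF open_ball _ C2, of 0 j k] by (simp only: complex_hessian_log_bergman[OF smooth]) simp
  assume strict: "strictly_plurisubharmonic_at \<phi> 0"
  then have pd: "positive_definite (complex_hessian \<phi> 0)" by (simp add: strictly_plurisubharmonic_at_def)
  have real: "cnj (complex_hessian \<phi> 0 $ j $ j) = complex_hessian \<phi> 0 $ j $ j" for j
    using pd unfolding positive_definite_def by metis
  have pd': "\<forall>v. v \<noteq> 0 \<longrightarrow> 0 < Re (\<Sum>j\<in>UNIV. \<Sum>k\<in>UNIV. complex_hessian \<phi> 0 $ j $ k * v $ j * cnj (v $ k))"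
    using pd unfolding positive_definite_def by (rule conjunct2)
  have pos: "0 < Re (complex_hessian \<phi> 0 $ j $ j)" for j
  proof -
    \<comment> \<open>Testing the Hermitian form on the j-th unit vector isolates the diagonal
      entry.\<close>
    have "0 < Re (\<Sum>i\<in>UNIV. \<Sum>k\<in>UNIV. complex_hessian \<phi> 0 $ i $ k * (axis j 1 :: complex ^ 'n) $ i * cnj ((axis j 1 :: complex ^ 'n) $ k))"
      by (rule pd'[THEN spec, THEN mp]) simp
    also have "(\<Sum>i\<in>UNIV. \<Sum>k\<in>UNIV. complex_hessian \<phi> 0 $ i $ k * (axis j 1 :: complex ^ 'n) $ i * cnj ((axis j 1 :: complex ^ 'n) $ k)) = complex_hessian \<phi> 0 $ j $ j"
    proof -
      have "complex_hessian \<phi> 0 $ i $ k * (axis j 1 :: complex ^ 'n) $ i * cnj ((axis j 1 :: complex ^ 'n) $ k) =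
          (if k = j then if i = j then complex_hessian \<phi> 0 $ j $ j else 0 else 0)" for i k
        by (auto simp: axis_def)
      then show ?thesis by simp
    qed
    finally show ?thesis .
  qed
  \<comment> \<open>The Hessian is diagonal with positive entries: no coordinate of v contributes
    negatively, and a nonzero coordinate contributes positively.\<close>
  have "positive_definite (complex_hessian ?F 0)"
    unfolding positive_definite_def complex_hessian_log_bergman[OF smooth]
  proof (intro conjI allI impI)
    fix j k
    show "(if k = j then 1 / 2 * complex_hessian \<phi> 0 $ k $ k else 0) = cnj (if j = k then 1 / 2 * complex_hessian \<phi> 0 $ j $ j else 0)"
      by (simp add: real)
  next
    fix v :: "complex ^ 'n" assume "v \<noteq> 0"
    have "(\<Sum>j\<in>UNIV. \<Sum>k\<in>UNIV. (if j = k then 1 / 2 * complex_hessian \<phi> 0 $ j $ j else 0) * v $ j * cnj (v $ k)) =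
      (\<Sum>j\<in>UNIV. 1 / 2 * complex_hessian \<phi> 0 $ j $ j * (v $ j * cnj (v $ j)))"
    proof -
      have "(if j = k then 1 / 2 * complex_hessian \<phi> 0 $ j $ j else 0) * v $ j * cnj (v $ k) =
          (if j = k then 1 / 2 * complex_hessian \<phi> 0 $ j $ j * (v $ j * cnj (v $ j)) else 0)" for j k
        by auto
      then show ?thesis by (simp only: sum.delta' finite if_True UNIV_I)
    qed
    then have eq: "Re (\<Sum>j\<in>UNIV. \<Sum>k\<in>UNIV. (if j = k then 1 / 2 * complex_hessian \<phi> 0 $ j $ j else 0) * v $ j * cnj (v $ k)) =
      (\<Sum>j\<in>UNIV. 1 / 2 * Re (complex_hessian \<phi> 0 $ j $ j) * (norm (v $ j))\<^sup>2)"
      by (simp add: complex_norm_square[symmetric] Re_divide_numeral)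
    obtain i where i: "v $ i \<noteq> 0" using \<open>v \<noteq> 0\<close> by (auto simp: vec_eq_iff)
    show "0 < Re (\<Sum>j\<in>UNIV. \<Sum>k\<in>UNIV. (if j = k then 1 / 2 * complex_hessian \<phi> 0 $ j $ j else 0) * v $ j * cnj (v $ k))"
      unfolding eq
    proof (rule sum_pos2[of _ i])
      show "0 < 1 / 2 * Re (complex_hessian \<phi> 0 $ i $ i) * (norm (v $ i))\<^sup>2" using pos[of i] i by simp
      show "0 \<le> 1 / 2 * Re (complex_hessian \<phi> 0 $ j $ j) * (norm (v $ j))\<^sup>2" for j using pos[of j] by simp
    qed auto
  qed
  with U show "strictly_plurisubharmonic_at ?F 0" by (auto simp: strictly_plurisubharmonic_at_def)
qed

end
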